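(* Let $\mathfrak{g}$ be an arbitrary Kac-Moody algebra over $\mathbb{C}$ (associated to an indecomposable generalized Cartan matrix). Then $\mathcal{H}(\mathfrak{g})\neq\varnothing$ if and only if $\mathfrak{g}$ is of finite type $A_l$ $(l\ge1)$ or $C_l$ $(l\ge2)$.
   Context: A generalized Cartan matrix is an integer matrix $A=(a_{ij})_{1\le i,j\le l}$ with $a_{ii}=2$, $a_{ij}\le 0$ for $i\ne j$, and $a_{ij}=0\Leftrightarrow a_{ji}=0$; it is indecomposable if there is no partition of $\{1,\dots,l\}$ into two nonempty parts $I_1,I_2$ with $a_{ij}=0$ for all $i\in I_1,j\in I_2$. The Kac-Moody algebra $\mathfrak{g}=\mathfrak{g}(A)$ over $\mathbb{C}$: take a vector space $\mathfrak{h}$ (the Cartan subalgebra) of dimension $2l-\mathrm{rank}\,A$ with linearly independent simple roots $\alpha_1,\dots,\alpha_l\in\mathfrak{h}^*$ and linearly independent simple coroots $\alpha_1^\vee,\dots,\alpha_l^\vee\in\mathfrak{h}$ such that $\alpha_j(\alpha_i^\vee)=a_{ij}$; let $\tilde{\mathfrak{g}}(A)$ be the Lie algebra generated by $\mathfrak{h}$ and $e_i,f_i$ ($1\le i\le l$) with relations $[\mathfrak{h},\mathfrak{h}]=0$, $[h,e_i]=\alpha_i(h)e_i$, $[h,f_i]=-\alpha_i(h)f_i$ ($h\in\mathfrak{h}$), $[e_i,f_j]=\delta_{ij}\alpha_i^\vee$; then $\mathfrak{g}(A)$ is the quotient of $\tilde{\mathfrak{g}}(A)$ by its unique maximal ideal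 intersecting $\mathfrak{h}$ trivially. $\mathcal{H}(\mathfrak{g})$ denotes the full subcategory of $\mathfrak{g}$-modules whose restriction to $U(\mathfrak{h})$ is free of rank $1$; $\mathcal{H}(\mathfrak{g})\ne\varnothing$ means that such a module exists. Type $A_l$ is the Cartan matrix of $\mathfrak{sl}_{l+1}(\mathbb{C})$ ($a_{i,i\pm1}=-1$, other off-diagonal entries $0$); type $C_l$ is that of $\mathfrak{sp}_{2l}(\mathbb{C})$ (same as $A_l$ except $a_{l-1,l}=-2$), up to renumbering of indices. *)

theory Defs
  imports
    "HOL-Analysis.Cartesian_Space"
    "HOL-Algebra.QuotRing"
    "HOL-Algebra.Algebraic_Closure_Type"
begin

section \<open>Generalized Cartan matrices and their realizations\<close>

definition generalized_cartan_matrix :: "int ^ 'n ^ 'n \<Rightarrow> bool" where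
  "generalized_cartan_matrix A \<longleftrightarrow>
     (\<forall>i. A $ i $ i = 2) \<and>
     (\<forall>i j. i \<noteq> j \<longrightarrow> A $ i $ j \<le> 0) \<and>
     (\<forall>i j. A $ i $ j = 0 \<longleftrightarrow> A $ j $ i = 0)"

definition indecomposable :: "int ^ 'n ^ 'n \<Rightarrow> bool" where
  "indecomposable A \<longleftrightarrow>
     \<not> (\<exists>I\<^sub>1 I\<^sub>2. I\<^sub>1 \<noteq> {} \<and> I\<^sub>2 \<noteq> {} \<and> I\<^sub>1 \<inter> I\<^sub>2 = {} \<and> I\<^sub>1 \<union> I\<^sub>2 = UNIV \<and>
          (\<forall>i\<in>I\<^sub>1. \<forall>j\<in>I\<^sub>2. A $ i $ j = 0))"

text \<open>
  The Cartan subalgebra is the type \<open>'h\<close> with scalar multiplication \<open>sc\<close>; \<open>\<alpha>\<close> is the family of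
  simple roots and \<open>\<alpha>v\<close> the family of simple coroots. Since the required dimension is positive,
  the dimension equation also says that the space is finite-dimensional
  (\<open>dim\<close> is 0 otherwise).
\<close>

definition realization ::
    "int ^ 'n ^ 'n \<Rightarrow> (complex \<Rightarrow> 'h::ab_group_add \<Rightarrow> 'h) \<Rightarrow> ('n::finite \<Rightarrow> 'h \<Rightarrow> complex) \<Rightarrow>
     ('n \<Rightarrow> 'h) \<Rightarrow> bool" where
  "realization A sc \<alpha> \<alpha>v \<longleftrightarrow>
     vector_space sc \<and>
     vector_space.dim sc UNIV
       = 2 * CARD('n) - rank (map_matrix of_int A :: complex ^ 'n ^ 'n) \<and>
     (\<forall>i. Vector_Spaces.linear sc (*) (\<alpha> i)) \<and>
     (\<forall>c. (\<forall>x. (\<Sum>i\<in>UNIV. c i * \<alpha> i x) = 0) \<longrightarrow> (\<forall>i. c i = 0)) \<and>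
     (\<forall>c. (\<Sum>i\<in>UNIV. sc (c i) (\<alpha>v i)) = 0 \<longrightarrow> (\<forall>i. c i = 0)) \<and>
     (\<forall>i j. \<alpha> j (\<alpha>v i) = of_int (A $ i $ j))"

definition cartan_A :: "nat \<Rightarrow> nat \<Rightarrow> int" where
  "cartan_A i j = (if i = j then 2 else if j = i + 1 \<or> i = j + 1 then -1 else 0)"

definition cartan_C :: "nat \<Rightarrow> nat \<Rightarrow> nat \<Rightarrow> int" where
  "cartan_C l i j = (if i + 1 = l \<and> j = l then -2 else cartan_A i j)"

text \<open>\<open>A\<close> equals the matrix \<open>B\<close> with rows and columns \<open>1, \<dots>, l\<close>, up to renumbering.\<close>

definition matrix_of_type :: "nat \<Rightarrow> (nat \<Rightarrow> nat \<Rightarrow> int) \<Rightarrow> int ^ 'n ^ 'n \<Rightarrow> bool" where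
  "matrix_of_type l B A \<longleftrightarrow>
     (\<exists>\<sigma>. bij_betw \<sigma> {1..l} UNIV \<and> (\<forall>i\<in>{1..l}. \<forall>j\<in>{1..l}. A $ \<sigma> i $ \<sigma> j = B i j))"

definition type_A :: "nat \<Rightarrow> int ^ 'n ^ 'n \<Rightarrow> bool" where
  "type_A l = matrix_of_type l cartan_A"

definition type_C :: "nat \<Rightarrow> int ^ 'n ^ 'n \<Rightarrow> bool" where
  "type_C l = matrix_of_type l (cartan_C l)"


section \<open>Algebras given by generators and relations\<close>

text \<open>
  A complex, not necessarily associative or unital, algebra is a record of type
  \<open>(complex, 'a) module\<close> whose \<open>mult\<close> component is the bilinear product. The \<open>one\<close> component is
  meaningful only for enveloping algebras.
\<close>

abbreviation Cring :: "complex ring" where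
  "Cring \<equiv> ring_of_type_algebra"

datatype 'x alg_term =
    Gen 'x
  | Zero
  | Add "'x alg_term" "'x alg_term"
  | Scale complex "'x alg_term"
  | Prod "'x alg_term" "'x alg_term"

text \<open>
  The least congruence on terms that contains the relations \<open>R\<close> and makes the quotient
  a complex vector space with a bilinear product.
\<close>

inductive alg_cong :: "('x alg_term \<times> 'x alg_term) set \<Rightarrow> 'x alg_term \<Rightarrow> 'x alg_term \<Rightarrow> bool"
  for R where
  rel: "(s, t) \<in> R \<Longrightarrow> alg_cong R s t"
| refl: "alg_cong R s s"
| sym: "alg_cong R s t \<Longrightarrow> alg_cong R t s"
| trans: "alg_cong R s t \<Longrightarrow> alg_cong R t u \<Longrightarrow> alg_cong R s u"
| cong_Add: "alg_cong R s s' \<Longrightarrow> alg_cong R t t' \<Longrightarrow> alg_cong R (Add s t) (Add s' t')"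
| cong_Scale: "alg_cong R s s' \<Longrightarrow> alg_cong R (Scale c s) (Scale c s')"
| cong_Prod: "alg_cong R s s' \<Longrightarrow> alg_cong R t t' \<Longrightarrow> alg_cong R (Prod s t) (Prod s' t')"
| Add_assoc: "alg_cong R (Add (Add s t) u) (Add s (Add t u))"
| Add_comm: "alg_cong R (Add s t) (Add t s)"
| Add_Zero: "alg_cong R (Add Zero s) s"
| Add_neg: "alg_cong R (Add (Scale (-1) s) s) Zero"
| Scale_Add: "alg_cong R (Scale c (Add s t)) (Add (Scale c s) (Scale c t))"
| Scale_plus: "alg_cong R (Scale (c + d) s) (Add (Scale c s) (Scale d s))"
| Scale_Scale: "alg_cong R (Scale c (Scale d s)) (Scale (c * d) s)"
| Scale_one: "alg_cong R (Scale 1 s) s"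
| Prod_Add_left: "alg_cong R (Prod (Add s t) u) (Add (Prod s u) (Prod t u))"
| Prod_Add_right: "alg_cong R (Prod s (Add t u)) (Add (Prod s t) (Prod s u))"
| Prod_Scale_left: "alg_cong R (Prod (Scale c s) t) (Scale c (Prod s t))"
| Prod_Scale_right: "alg_cong R (Prod s (Scale c t)) (Scale c (Prod s t))"

definition alg_class ::
    "'x set \<Rightarrow> ('x alg_term \<times> 'x alg_term) set \<Rightarrow> 'x alg_term \<Rightarrow> 'x alg_term set" where
  "alg_class S R t = {s. set_alg_term s \<subseteq> S \<and> alg_cong R s t}"

text \<open>
  The algebra with generators \<open>S\<close> and relations \<open>R\<close>. Each relation set used below is stable under
  sending the generators outside \<open>S\<close> to \<open>Zero\<close>, up to trivial relations, so that those generators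
  do not identify further terms over \<open>S\<close>.
\<close>

definition presented_algebra ::
    "'x set \<Rightarrow> ('x alg_term \<times> 'x alg_term) set \<Rightarrow> (complex, 'x alg_term set) module" where
  "presented_algebra S R =
     \<lparr>carrier = alg_class S R ` {t. set_alg_term t \<subseteq> S},
      monoid.mult = (\<lambda>u v. \<Union>s\<in>u. \<Union>t\<in>v. alg_class S R (Prod s t)),
      one = undefined,
      zero = alg_class S R Zero,
      add = (\<lambda>u v. \<Union>s\<in>u. \<Union>t\<in>v. alg_class S R (Add s t)),
      module.smult = (\<lambda>c u. \<Union>s\<in>u. alg_class S R (Scale c s))\<rparr>"


section \<open>Lie algebras and their modules\<close>

text \<open>The bracket of a Lie algebra is the \<open>mult\<close> component \<open>\<otimes>\<close>.\<close>

locale lie_algebra = L?: Module.module Cring L for L :: "(complex, 'a) module" (structure) +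
  assumes bracket_closed: "x \<in> carrier L \<Longrightarrow> y \<in> carrier L \<Longrightarrow> x \<otimes> y \<in> carrier L"
    and bracket_add_left:
      "x \<in> carrier L \<Longrightarrow> y \<in> carrier L \<Longrightarrow> z \<in> carrier L \<Longrightarrow> (x \<oplus> y) \<otimes> z = x \<otimes> z \<oplus> y \<otimes> z"
    and bracket_add_right:
      "x \<in> carrier L \<Longrightarrow> y \<in> carrier L \<Longrightarrow> z \<in> carrier L \<Longrightarrow> x \<otimes> (y \<oplus> z) = x \<otimes> y \<oplus> x \<otimes> z"
    and bracket_smult_left:
      "x \<in> carrier L \<Longrightarrow> y \<in> carrier L \<Longrightarrow> (c \<odot> x) \<otimes> y = c \<odot> (x \<otimes> y)"
    and bracket_smult_right:
      "x \<in> carrier L \<Longrightarrow> y \<in> carrier L \<Longrightarrow> x \<otimes> (c \<odot> y) = c \<odot> (x \<otimes> y)"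
    and bracket_self: "x \<in> carrier L \<Longrightarrow> x \<otimes> x = \<zero>"
    and jacobi:
      "x \<in> carrier L \<Longrightarrow> y \<in> carrier L \<Longrightarrow> z \<in> carrier L \<Longrightarrow>
       x \<otimes> (y \<otimes> z) \<oplus> y \<otimes> (z \<otimes> x) \<oplus> z \<otimes> (x \<otimes> y) = \<zero>"

definition lie_ideal :: "(complex, 'a) module \<Rightarrow> 'a set \<Rightarrow> bool" where
  "lie_ideal L I \<longleftrightarrow>
     Module.submodule I Cring L \<and> (\<forall>x\<in>carrier L. \<forall>y\<in>I. x \<otimes>\<^bsub>L\<^esub> y \<in> I)"

definition lie_quotient :: "(complex, 'a) module \<Rightarrow> 'a set \<Rightarrow> (complex, 'a set) module" where
  "lie_quotient L I =
     ring.extend (L Quot I) \<lparr>module.smult = (\<lambda>c C. \<Union>x\<in>C. I +>\<^bsub>L\<^esub> (c \<odot>\<^bsub>L\<^esub> x))\<rparr>"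

text \<open>The action of \<open>x\<close> on \<open>v\<close> is \<open>\<rho> x v\<close>; the values of \<open>\<rho>\<close> off the carriers play no role.\<close>

locale lie_module = lie_algebra L + V?: Module.module Cring V
  for L :: "(complex, 'a) module" and V :: "(complex, 'v) module" +
  fixes \<rho> :: "'a \<Rightarrow> 'v \<Rightarrow> 'v"
  assumes act_closed: "x \<in> carrier L \<Longrightarrow> v \<in> carrier V \<Longrightarrow> \<rho> x v \<in> carrier V"
    and act_add:
      "x \<in> carrier L \<Longrightarrow> v \<in> carrier V \<Longrightarrow> w \<in> carrier V \<Longrightarrow>
       \<rho> x (v \<oplus>\<^bsub>V\<^esub> w) = \<rho> x v \<oplus>\<^bsub>V\<^esub> \<rho> x w"
    and act_smult:
      "x \<in> carrier L \<Longrightarrow> v \<in> carrier V \<Longrightarrow> \<rho> x (c \<odot>\<^bsub>V\<^esub> v) = c \<odot>\<^bsub>V\<^esub> \<rho> x v"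
    and add_act:
      "x \<in> carrier L \<Longrightarrow> y \<in> carrier L \<Longrightarrow> v \<in> carrier V \<Longrightarrow>
       \<rho> (x \<oplus>\<^bsub>L\<^esub> y) v = \<rho> x v \<oplus>\<^bsub>V\<^esub> \<rho> y v"
    and smult_act:
      "x \<in> carrier L \<Longrightarrow> v \<in> carrier V \<Longrightarrow> \<rho> (c \<odot>\<^bsub>L\<^esub> x) v = c \<odot>\<^bsub>V\<^esub> \<rho> x v"
    and bracket_act:
      "x \<in> carrier L \<Longrightarrow> y \<in> carrier L \<Longrightarrow> v \<in> carrier V \<Longrightarrow>
       \<rho> (x \<otimes>\<^bsub>L\<^esub> y) v = \<rho> x (\<rho> y v) \<ominus>\<^bsub>V\<^esub> \<rho> y (\<rho> x v)"


section \<open>Universal enveloping algebras\<close>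

text \<open>
  The generator \<open>None\<close> is the unit of the enveloping algebra, and \<open>Some x\<close> is the image of \<open>x\<close>.
\<close>

definition env_generators :: "(complex, 'a) module \<Rightarrow> 'a option set" where
  "env_generators L = insert None (Some ` carrier L)"

definition env_relations ::
    "(complex, 'a) module \<Rightarrow> ('a option alg_term \<times> 'a option alg_term) set" where
  "env_relations L =
     {(Prod (Prod s t) u, Prod s (Prod t u)) |s t u. True} \<union>
     {(Prod (Gen None) s, s) |s. True} \<union>
     {(Prod s (Gen None), s) |s. True} \<union>
     {(Gen (Some (x \<oplus>\<^bsub>L\<^esub> y)), Add (Gen (Some x)) (Gen (Some y))) |x y.
        x \<in> carrier L \<and> y \<in> carrier L} \<union>
     {(Gen (Some (c \<odot>\<^bsub>L\<^esub> x)), Scale c (Gen (Some x))) |c x. x \<in> carrier L} \<union>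
     {(Gen (Some (x \<otimes>\<^bsub>L\<^esub> y)),
       Add (Prod (Gen (Some x)) (Gen (Some y)))
           (Scale (-1) (Prod (Gen (Some y)) (Gen (Some x))))) |x y.
        x \<in> carrier L \<and> y \<in> carrier L}"

definition enveloping_algebra ::
    "(complex, 'a) module \<Rightarrow> (complex, 'a option alg_term set) module" where
  "enveloping_algebra L =
     (presented_algebra (env_generators L) (env_relations L))
       \<lparr>one := alg_class (env_generators L) (env_relations L) (Gen None)\<rparr>"

primrec env_term_act ::
    "(complex, 'v) module \<Rightarrow> ('a \<Rightarrow> 'v \<Rightarrow> 'v) \<Rightarrow> 'a option alg_term \<Rightarrow> 'v \<Rightarrow> 'v" where
  "env_term_act V \<rho> (Gen g) v = (case g of None \<Rightarrow> v | Some x \<Rightarrow> \<rho> x v)"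
| "env_term_act V \<rho> Zero v = \<zero>\<^bsub>V\<^esub>"
| "env_term_act V \<rho> (Add s t) v = env_term_act V \<rho> s v \<oplus>\<^bsub>V\<^esub> env_term_act V \<rho> t v"
| "env_term_act V \<rho> (Scale c s) v = c \<odot>\<^bsub>V\<^esub> env_term_act V \<rho> s v"
| "env_term_act V \<rho> (Prod s t) v = env_term_act V \<rho> s (env_term_act V \<rho> t v)"

text \<open>
  A module over a Lie algebra as a module over its enveloping algebra: an element of the latter
  acts through any of the terms representing it.
\<close>

definition env_module ::
    "(complex, 'v) module \<Rightarrow> ('a \<Rightarrow> 'v \<Rightarrow> 'v) \<Rightarrow> ('a option alg_term set, 'v) module" where
  "env_module V \<rho> =
     \<lparr>carrier = carrier V, monoid.mult = monoid.mult V, one = one V, zero = zero V, add = add V,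
      module.smult = (\<lambda>u v. the_elem ((\<lambda>t. env_term_act V \<rho> t v) ` u))\<rparr>"

text \<open>\<open>M\<close> has an \<open>R\<close>-basis consisting of one element.\<close>

definition free_of_rank_one :: "('r, 'm) ring_scheme \<Rightarrow> ('r, 'v) module \<Rightarrow> bool" where
  "free_of_rank_one R M \<longleftrightarrow>
     (\<exists>b\<in>carrier M. \<forall>v\<in>carrier M. \<exists>!r. r \<in> carrier R \<and> v = r \<odot>\<^bsub>M\<^esub> b)"

text \<open>
  The \<open>L\<close>-modules with underlying set in the universe \<open>'v\<close> whose restriction to the enveloping
  algebra of the subalgebra \<open>H\<close> is free of rank 1. For \<open>H\<close> abelian of finite positive dimension
  such a module has the cardinality of the continuum, so every universe of at least that
  cardinality contains an isomorphic copy of it.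
\<close>

definition category_H ::
    "(complex, 'a) module \<Rightarrow> 'a set \<Rightarrow> ((complex, 'v) module \<times> ('a \<Rightarrow> 'v \<Rightarrow> 'v)) set" where
  "category_H L H =
     {(V, \<rho>). lie_module L V \<rho> \<and>
        free_of_rank_one (enveloping_algebra (L\<lparr>carrier := H\<rparr>)) (env_module V \<rho>)}"


section \<open>Kac-Moody algebras\<close>

datatype ('h, 'n) km_gen = H 'h | E 'n | F 'n

definition lie_relations :: "('x alg_term \<times> 'x alg_term) set" where
  "lie_relations =
     {(Prod s s, Zero) |s. True} \<union>
     {(Add (Add (Prod s (Prod t u)) (Prod t (Prod u s))) (Prod u (Prod s t)), Zero) |s t u. True}"

text \<open>
  The first two families make \<open>H\<close> linear, so that the vector space \<open>'h\<close> itself is among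
  the generators.
\<close>

definition km_relations ::
    "(complex \<Rightarrow> 'h::ab_group_add \<Rightarrow> 'h) \<Rightarrow> ('n \<Rightarrow> 'h \<Rightarrow> complex) \<Rightarrow> ('n \<Rightarrow> 'h) \<Rightarrow>
     (('h, 'n) km_gen alg_term \<times> ('h, 'n) km_gen alg_term) set" where
  "km_relations sc \<alpha> \<alpha>v =
     {(Gen (H (x + y)), Add (Gen (H x)) (Gen (H y))) |x y. True} \<union>
     {(Gen (H (sc c x)), Scale c (Gen (H x))) |c x. True} \<union>
     {(Prod (Gen (H x)) (Gen (H y)), Zero) |x y. True} \<union>
     {(Prod (Gen (H x)) (Gen (E i)), Scale (\<alpha> i x) (Gen (E i))) |x i. True} \<union>
     {(Prod (Gen (H x)) (Gen (F i)), Scale (- \<alpha> i x) (Gen (F i))) |x i. True} \<union>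
     {(Prod (Gen (E i)) (Gen (F j)), if i = j then Gen (H (\<alpha>v i)) else Zero) |i j. True}"

definition km_tilde ::
    "(complex \<Rightarrow> 'h::ab_group_add \<Rightarrow> 'h) \<Rightarrow> ('n \<Rightarrow> 'h \<Rightarrow> complex) \<Rightarrow> ('n \<Rightarrow> 'h) \<Rightarrow>
     (complex, ('h, 'n) km_gen alg_term set) module" where
  "km_tilde sc \<alpha> \<alpha>v = presented_algebra UNIV (lie_relations \<union> km_relations sc \<alpha> \<alpha>v)"

definition cartan_tilde ::
    "(complex \<Rightarrow> 'h::ab_group_add \<Rightarrow> 'h) \<Rightarrow> ('n \<Rightarrow> 'h \<Rightarrow> complex) \<Rightarrow> ('n \<Rightarrow> 'h) \<Rightarrow>
     ('h, 'n) km_gen alg_term set set" where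
  "cartan_tilde sc \<alpha> \<alpha>v =
     range (\<lambda>x. alg_class UNIV (lie_relations \<union> km_relations sc \<alpha> \<alpha>v) (Gen (H x)))"

definition trivial_ideal ::
    "(complex \<Rightarrow> 'h::ab_group_add \<Rightarrow> 'h) \<Rightarrow> ('n \<Rightarrow> 'h \<Rightarrow> complex) \<Rightarrow> ('n \<Rightarrow> 'h) \<Rightarrow>
     ('h, 'n) km_gen alg_term set set \<Rightarrow> bool" where
  "trivial_ideal sc \<alpha> \<alpha>v I \<longleftrightarrow>
     lie_ideal (km_tilde sc \<alpha> \<alpha>v) I \<and>
     I \<inter> cartan_tilde sc \<alpha> \<alpha>v = {\<zero>\<^bsub>km_tilde sc \<alpha> \<alpha>v\<^esub>}"

definition km_radical ::
    "(complex \<Rightarrow> 'h::ab_group_add \<Rightarrow> 'h) \<Rightarrow> ('n \<Rightarrow> 'h \<Rightarrow> complex) \<Rightarrow> ('n \<Rightarrow> 'h) \<Rightarrow>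
     ('h, 'n) km_gen alg_term set set" where
  "km_radical sc \<alpha> \<alpha>v =
     (THE I. trivial_ideal sc \<alpha> \<alpha>v I \<and> (\<forall>J. trivial_ideal sc \<alpha> \<alpha>v J \<longrightarrow> I \<subseteq> J \<longrightarrow> J = I))"

definition kac_moody_algebra ::
    "(complex \<Rightarrow> 'h::ab_group_add \<Rightarrow> 'h) \<Rightarrow> ('n \<Rightarrow> 'h \<Rightarrow> complex) \<Rightarrow> ('n \<Rightarrow> 'h) \<Rightarrow>
     (complex, ('h, 'n) km_gen alg_term set set) module" where
  "kac_moody_algebra sc \<alpha> \<alpha>v = lie_quotient (km_tilde sc \<alpha> \<alpha>v) (km_radical sc \<alpha> \<alpha>v)"

definition cartan_subalgebra ::
    "(complex \<Rightarrow> 'h::ab_group_add \<Rightarrow> 'h) \<Rightarrow> ('n \<Rightarrow> 'h \<Rightarrow> complex) \<Rightarrow> ('n \<Rightarrow> 'h) \<Rightarrow>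
     ('h, 'n) km_gen alg_term set set set" where
  "cartan_subalgebra sc \<alpha> \<alpha>v =
     (\<lambda>x. km_radical sc \<alpha> \<alpha>v +>\<^bsub>km_tilde sc \<alpha> \<alpha>v\<^esub> x) ` cartan_tilde sc \<alpha> \<alpha>v"

end

theory Submission
  imports Defs "HOL-Analysis.Abstract_Topology_2"
begin

text \<open>
  A module that is free of rank 1 over \<open>U(\<hh>)\<close> is a polynomial ring on which \<open>e\<^sub>i\<close> and \<open>f\<^sub>i\<close> act as
  translations by \<open>-\<alpha>\<^sub>i\<close> and \<open>\<alpha>\<^sub>i\<close> followed by multiplication with polynomials \<open>p\<^sub>i\<close> and \<open>q\<^sub>i\<close>. Put
  \<open>r\<^sub>i(c) = q\<^sub>i(c) p\<^sub>i(c + \<alpha>\<^sub>i)\<close>. The relations between the generators give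
  \<open>r\<^sub>i(c - \<alpha>\<^sub>i) = r\<^sub>i(c) + \<alpha>\<^sub>i\<^sup>\<or>(c)\<close> and, for \<open>i \<noteq> j\<close>, \<open>r\<^sub>i(c) r\<^sub>j(c) = r\<^sub>j(c + \<alpha>\<^sub>i) r\<^sub>i(c + \<alpha>\<^sub>j)\<close>.
  Comparing leading coefficients in the plane spanned by \<open>\<alpha>\<^sub>i\<close> and \<open>\<alpha>\<^sub>j\<close> bounds the entries of the
  Cartan matrix by 2 and makes \<open>- r\<^sub>i\<close> split into two factors with sum \<open>\<alpha>\<^sub>i\<^sup>\<or> + 1\<close>, one for each
  neighbour of \<open>i\<close> in the Dynkin diagram. Hence a vertex has at most two neighbours, a long root only
  one, and summing over a cycle or over a chain with two long ends would make the coroots dependent.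

  Conversely, for the types A and C such polynomials exist, with affine \<open>p\<^sub>i\<close> and \<open>q\<^sub>i\<close> except at the long
  root, where \<open>p\<^sub>i = 1\<close> and \<open>q\<^sub>i\<close> is quadratic. They define a representation of the algebra without the
  maximal ideal. A homogeneous element of a graded ideal that meets \<open>\<hh>\<close> trivially acts as a translation
  followed by multiplication with a polynomial \<open>w\<close>; by induction on the height it commutes with all
  \<open>f\<^sub>i\<close>, or with all \<open>e\<^sub>i\<close>, and the resulting difference equations force \<open>w = 0\<close>.
\<close>

section \<open>Pairs of simple roots\<close>

text \<open>Only the products \<open>r i\<close> enter the first half: the relations do not
  determine \<open>p i\<close> and \<open>q i\<close> separately, whereas \<open>r i\<close>
  satisfies identities that involve nothing else. With s fixed, the mixed identity reads f(t) g(t) =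
  h(t) f(t + 1), where -g and -h are monic quadratics because \<open>r j\<close> is quadratic along
  its own root. Their linear coefficients differ by a Cartan entry up to sign, and this difference
  is the degree of f. The obstacle in the converse is that the maximal ideal comes without
  generators, so its action must be found from its defining property. In type C the polynomial
  \<open>p i = 1\<close> at the long root has no zero, hence its difference equation gives no first
  zero of w. What helps is a submodule: functions that vanish wherever a suitable coordinate is a
  nonpositive integer. An operator that leads out of this set of points must have w = 0 there, which
  yields a hyperplane of zeros to start from.\<close>

lemma pcompose_monom: "pcompose (monom 1 k) q = q ^ k" for q :: "complex poly"
  by (induction k) (simp_all add: monom_Suc pcompose_pCons monom_0)

lemma coeff_shift_power: "coeff ([:1,1:] ^ k) m = (of_nat (k choose m) :: complex)"
proof (induction k arbitrary: m)
  case 0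
  then show ?case by (cases m) auto
next
  case (Suc k)
  then show ?case by (cases m) (simp_all add: mult_pCons_left coeff_pCons)
qed

lemma coeff_pcompose_shift:
  fixes f :: "complex poly"
  assumes "degree f \<le> n"
  shows "coeff (pcompose f [:1,1:]) m = (\<Sum>k\<le>n. coeff f k * of_nat (k choose m))"
proof -
  have "f = (\<Sum>k\<le>n. smult (coeff f k) (monom 1 k))"
    using assms by (simp add: smult_monom poly_as_sum_of_monoms')
  then have "pcompose f [:1,1:] = pcompose (\<Sum>k\<le>n. smult (coeff f k) (monom 1 k)) [:1,1:]"
    by simp
  also have "\<dots> = (\<Sum>k\<le>n. smult (coeff f k) ([:1,1:] ^ k))"
    by (simp add: pcompose_sum pcompose_smult pcompose_monom)
  finally have "coeff (pcompose f [:1,1:]) m = (\<Sum>k\<le>n. coeff (smult (coeff f k) ([:1,1:] ^ k)) m)"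
    by (simp add: coeff_sum)
  then show ?thesis
    by (simp add: coeff_shift_power)
qed

text \<open>The degree bound need not be attained: with a vanishing coefficient at
  \<open>Suc (Suc n)\<close> the same formulas serve polynomials of degree \<open>Suc n\<close>,
  which is how \<open>shift_equation\<close> determines the degree and treats
  \<open>B = 1\<close>.\<close>

lemma shift_top_coeffs:
  fixes f :: "complex poly"
  assumes "degree f \<le> Suc (Suc n)"
  defines "g \<equiv> pcompose f [:1,1:]"
  shows "coeff g (Suc (Suc n)) = coeff f (Suc (Suc n))"
    and "coeff g (Suc n) = coeff f (Suc n) + of_nat (n + 2) * coeff f (Suc (Suc n))"
    and "coeff g n = coeff f n + of_nat (n + 1) * coeff f (Suc n)
           + of_nat ((n + 1) * (n + 2)) / 2 * coeff f (Suc (Suc n))"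
proof -
  have c: "(n + 2) choose n = (n + 1) * (n + 2) div 2"
    using binomial_symmetric[of n "n + 2"] by (simp add: choose_two mult.commute)
  have "even ((n + 1) * (n + 2))" by auto
  then have c': "of_nat (Suc (Suc n) choose n) = (of_nat ((n + 1) * (n + 2)) / 2 :: complex)"
    using c by (metis add_2_eq_Suc' dvd_div_mult_self eq_divide_eq_numeral1(1) of_nat_mult of_nat_numeral zero_neq_numeral)
  have s: "coeff g m = (\<Sum>k\<le>Suc (Suc n). coeff f k * of_nat (k choose m))" for m
    unfolding g_def by (rule coeff_pcompose_shift[OF assms(1)])
  have z: "(\<Sum>k\<le>r. coeff f k * of_nat (k choose m)) = 0" if "r < m" for r m
    using that by (intro sum.neutral) auto
  have z': "(\<Sum>k\<le>m. coeff f k * of_nat (k choose m)) = coeff f m" for m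
    by (cases m) (simp_all add: z del: binomial_Suc_Suc)
  show "coeff g (Suc (Suc n)) = coeff f (Suc (Suc n))"
    unfolding s by (rule z')
  show "coeff g (Suc n) = coeff f (Suc n) + of_nat (n + 2) * coeff f (Suc (Suc n))"
    unfolding s using binomial_Suc_n[of "Suc n"]
    by (subst sum.atMost_Suc, subst z') (simp del: binomial_Suc_Suc)
  show "coeff g n = coeff f n + of_nat (n + 1) * coeff f (Suc n)
           + of_nat ((n + 1) * (n + 2)) / 2 * coeff f (Suc (Suc n))"
    unfolding s using binomial_Suc_n[of n]
    by (subst sum.atMost_Suc, subst sum.atMost_Suc, subst z') (simp add: c' del: binomial_Suc_Suc of_nat_mult)
qed

text \<open>The two highest coefficients of \<open>f(t) g(t) = h(t) f(t + 1)\<close> for monic quadratics \<open>-g\<close>, \<open>-h\<close>.\<close>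

lemma shift_equation:
  fixes f :: "complex poly" and B :: nat
  assumes eq: "f * [:g0, g1, -1:] = [:h0, g1 + of_nat B, -1:] * pcompose f [:1,1:]"
  shows "f = 0 \<or> degree f = B"
    and "B > 0 \<Longrightarrow> coeff f (B - 1)
           + coeff f B * (of_nat B * g1 + of_nat B ^ 2 - of_nat (B * (B - 1)) / 2 + (h0 - g0)) = 0"
proof -
  let ?g = "pcompose f [:1,1:]"
  have eq': "[:g0, g1, -1:] * f = [:h0, g1 + of_nat B, -1:] * ?g"
    using eq by (simp only: mult.commute)
  have co: "g0 * coeff f (Suc (Suc k)) + g1 * coeff f (Suc k) - coeff f k
     = h0 * coeff ?g (Suc (Suc k)) + (g1 + of_nat B) * coeff ?g (Suc k) - coeff ?g k" for k
    using arg_cong[OF eq', of "\<lambda>p. coeff p (Suc (Suc k))"] by (simp add: algebra_simps)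
  have co1: "g0 * coeff f (Suc 0) + g1 * coeff f 0
     = h0 * coeff ?g (Suc 0) + (g1 + of_nat B) * coeff ?g 0"
    using arg_cong[OF eq', of "\<lambda>p. coeff p (Suc 0)"] by simp
  show deg: "f = 0 \<or> degree f = B"
  proof (cases "degree f")
    case 0
    then obtain a where f: "f = [:a:]" by (meson degree_eq_zeroE)
    then show ?thesis using co1 by auto
  next
    case (Suc n)
    then have lc: "coeff f (Suc n) \<noteq> 0" by (metis leading_coeff_0_iff degree_0 nat.simps(3))
    have "coeff f (Suc (Suc n)) = 0" using Suc by (simp add: coeff_eq_0)
    moreover have "degree f \<le> Suc (Suc n)" using Suc by simp
    ultimately have "coeff ?g (Suc (Suc n)) = 0" "coeff ?g (Suc n) = coeff f (Suc n)"
       "coeff ?g n = coeff f n + of_nat (n + 1) * coeff f (Suc n)"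
      using shift_top_coeffs[of f n] by auto
    \<comment> \<open>This is the coefficient one below the top. The terms in
      \<open>coeff f n\<close> cancel, and the leading coefficient survives with the factor B - deg
      f.\<close>
    then have "(of_nat B - of_nat (n + 1)) * coeff f (Suc n) = 0"
      using co[of n] \<open>coeff f (Suc (Suc n)) = 0\<close> by (simp add: algebra_simps)
    then have "of_nat B = (of_nat (n + 1) :: complex)" using lc by simp
    then show ?thesis using Suc by (metis Suc_eq_plus1 of_nat_eq_iff)
  qed
  assume B: "B > 0"
  show "coeff f (B - 1) + coeff f B * (of_nat B * g1 + of_nat B ^ 2 - of_nat (B * (B - 1)) / 2 + (h0 - g0)) = 0"
  proof (cases "f = 0")
    case False
    then have d: "degree f = B" using deg by simp
    show ?thesis
    proof (cases "B = 1")
      case True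
      have "degree f \<le> Suc (Suc 0)" using d True by simp
      moreover have "coeff f (Suc (Suc 0)) = 0" using d True by (simp add: coeff_eq_0)
      ultimately have "coeff ?g (Suc 0) = coeff f (Suc 0)" "coeff ?g 0 = coeff f 0 + coeff f (Suc 0)"
        using shift_top_coeffs[of f 0] by auto
      then have "g0 * coeff f 1 + g1 * coeff f 0 = h0 * coeff f 1 + (g1 + 1) * (coeff f 0 + coeff f 1)"
        using co1 True by simp
      moreover have "coeff f 0 + coeff f 1 * (g1 + 1 + (h0 - g0)) =
          (h0 * coeff f 1 + (g1 + 1) * (coeff f 0 + coeff f 1)) - (g0 * coeff f 1 + g1 * coeff f 0)"
        by (simp add: algebra_simps)
      ultimately have "coeff f 0 + coeff f 1 * (g1 + 1 + (h0 - g0)) = 0" by simp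
      with True show ?thesis by simp
    next
      case False
      then obtain n where n: "B = Suc (Suc n)" using B by (metis One_nat_def not0_implies_Suc less_not_refl)
      have "degree f \<le> Suc (Suc n)" using d n by simp
      note sh = shift_top_coeffs[OF this]
      \<comment> \<open>The coefficient of t^B. Again the terms in \<open>coeff f n\<close> cancel,
        so it relates just the two leading coefficients of f.\<close>
      have "g0 * coeff f B + g1 * coeff f (Suc n) - coeff f n
        = h0 * coeff f B + (g1 + of_nat B) * (coeff f (Suc n) + of_nat B * coeff f B)
          - (coeff f n + of_nat (n + 1) * coeff f (Suc n) + of_nat ((n + 1) * (n + 2)) / 2 * coeff f B)"
        using co[of n] unfolding sh by (simp add: n del: of_nat_Suc)
      moreover have "of_nat (n + 1) = (of_nat B - 1 :: complex)" by (simp add: n)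
      moreover have "(n + 1) * (n + 2) = B * (B - 1)" "B - 1 = Suc n" by (simp_all add: n)
      ultimately show ?thesis
        by (simp only:) (simp add: algebra_simps power2_eq_square del: of_nat_mult)
    qed
  qed simp
qed

lemma poly_eqI_complex: "(\<And>x::complex. poly p x = poly q x) \<Longrightarrow> p = q"
  by (metis poly_eq_poly_eq_iff ext)

lemma poly_periodic_const:
  fixes p :: "complex poly"
  assumes "\<And>s. poly p (s + 1) = poly p s"
  shows "p = [:poly p 0:]"
proof -
  have n: "poly p (of_nat n) = poly p 0" for n
    by (induction n) (simp_all add: assms add.commute[of 1])
  have "range (of_nat :: nat \<Rightarrow> complex) \<subseteq> {s. poly (p - [:poly p 0:]) s = 0}"
    using n by auto
  moreover have "infinite (range (of_nat :: nat \<Rightarrow> complex))"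
    by (simp add: inj_on_def finite_image_iff)
  ultimately have "p - [:poly p 0:] = 0"
    using poly_roots_finite finite_subset by blast
  then show ?thesis by simp
qed

text \<open>Subtracting a quadratic with the same difference leaves a polynomial of period 1, which
  is constant.\<close>

lemma poly_difference_linear:
  fixes p :: "complex poly"
  assumes "\<And>s. poly p (s + 1) - poly p s = K + L * s"
  shows "p = [:poly p 0, K - L / 2, L / 2:]"
proof -
  define M where "M = L / 2"
  have L: "L = 2 * M" by (simp add: M_def)
  let ?q = "p - [:0, K - M, M:]"
  have "poly ?q (s + 1) = poly ?q s" for s
  proof -
    have "poly p (s + 1) = poly p s + K + 2 * M * s"
      using assms[of s] unfolding L by Groebner_Basis.algebra
    then show ?thesis by (simp add: algebra_simps)
  qed
  then have "?q = [:poly ?q 0:]" by (rule poly_periodic_const)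
  then have "p = [:poly p 0:] + [:0, K - M, M:]" by (simp add: diff_eq_eq)
  then show ?thesis by (simp add: M_def)
qed

text \<open>
  \<open>C\<close> and \<open>D\<close> are the restrictions of \<open>f\<^sub>i e\<^sub>i\<close> and \<open>f\<^sub>j e\<^sub>j\<close>, regarded as polynomials, to the lines through
  a point in the directions \<open>\<alpha>\<^sub>j\<close> and \<open>\<alpha>\<^sub>i\<close>; \<open>x\<close> and \<open>y\<close> are the values of the two coroots at the point,
  plus one, and \<open>A = - a\<^sub>i\<^sub>j\<close>, \<open>B = - a\<^sub>j\<^sub>i\<close>.
\<close>

locale root_pair =
  fixes C D :: "complex poly" and x y :: complex and A B :: nat
  assumes rel: "(poly C t - s\<^sup>2 - s * (x - of_nat A * t)) * (poly D s - t\<^sup>2 - t * (y - of_nat B * s))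
    = (poly D (s+1) - t\<^sup>2 - t * (y - of_nat B * (s+1))) * (poly C (t+1) - s\<^sup>2 - s * (x - of_nat A * (t+1)))"
    and zero_iff: "A = 0 \<longleftrightarrow> B = 0"
begin

text \<open>The first factor of \<open>rel\<close> as a polynomial in t with s fixed. In this form
  \<open>rel\<close> becomes an instance of \<open>shift_equation\<close>.\<close>

definition "fs s = C + [: - s\<^sup>2 - s * x, s * of_nat A :]"

lemma fs_eq: "fs s * [: poly D s, - y + of_nat B * s, -1 :] =
   [: poly D (s+1), (- y + of_nat B * s) + of_nat B, -1 :] * pcompose (fs s) [:1,1:]"
proof (rule poly_eqI_complex)
  fix t
  show "poly (fs s * [: poly D s, - y + of_nat B * s, -1 :]) t =
   poly ([: poly D (s+1), (- y + of_nat B * s) + of_nat B, -1 :] * pcompose (fs s) [:1,1:]) t"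
    using rel[of t s] by (simp add: fs_def poly_pcompose algebra_simps power2_eq_square)
qed

lemma swap: "root_pair D C y x B A"
proof
  fix t s
  show "(poly D t - s\<^sup>2 - s * (y - of_nat B * t)) * (poly C s - t\<^sup>2 - t * (x - of_nat A * s))
    = (poly C (s+1) - t\<^sup>2 - t * (x - of_nat A * (s+1))) * (poly D (t+1) - s\<^sup>2 - s * (y - of_nat B * (t+1)))"
    using rel[of s t] by (simp only: mult.commute)
qed (use zero_iff in auto)

lemma degree_fs: "fs s = 0 \<or> degree (fs s) = B"
  using shift_equation(1)[OF fs_eq] .

lemma coeff_fs: "B > 0 \<Longrightarrow> coeff (fs s) (B - 1) + coeff (fs s) B *
    (of_nat B * (- y + of_nat B * s) + of_nat B ^ 2 - of_nat (B * (B - 1)) / 2 + (poly D (s+1) - poly D s)) = 0"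
  using shift_equation(2)[OF fs_eq] .

text \<open>If every \<open>fs s\<close> vanished, its value at 0 would make s^2 + s x independent
  of s; three values of s refute this.\<close>

lemma fs_nonzero: "\<exists>s. fs s \<noteq> 0"
proof (rule ccontr)
  assume "\<not> ?thesis"
  then have z: "\<And>s. fs s = 0" by blast
  have "poly C 0 - s\<^sup>2 - s * x = 0" for s
  proof -
    have "poly (fs s) 0 = 0" by (simp add: z)
    then show ?thesis by (simp add: fs_def diff_diff_eq add_diff_eq)
  qed
  note e = this
  have "poly C 0 = 0" "poly C 0 - 1 - x = 0" "poly C 0 - 4 - 2 * x = 0"
    using e[of 0] e[of 1] e[of 2] by simp_all
  then have "x = -1" "x = -2" by simp_all
  then show False by simp
qed

lemma degree_C: "degree C \<le> max B 1"
proof -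
  obtain s where "fs s \<noteq> 0" using fs_nonzero by blast
  then have d: "degree (fs s) = B" using degree_fs by blast
  have "C = fs s - [: - s\<^sup>2 - s * x, s * of_nat A :]" by (simp add: fs_def)
  moreover have "degree [: - s\<^sup>2 - s * x, s * of_nat A :] \<le> 1" by simp
  ultimately show ?thesis using d degree_diff_le_max[of "fs s" "[: - s\<^sup>2 - s * x, s * of_nat A :]"] by (simp add: max_def split: if_splits)
qed

lemma lead_C: "B \<ge> 2 \<Longrightarrow> coeff C B \<noteq> 0"
proof -
  assume B: "B \<ge> 2"
  obtain s where "fs s \<noteq> 0" using fs_nonzero by blast
  then have d: "degree (fs s) = B" "coeff (fs s) B \<noteq> 0" using degree_fs leading_coeff_neq_0 by blast+
  have "coeff (fs s) B = coeff C B" using B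
    by (simp add: fs_def coeff_pCons split: nat.split)
  then show ?thesis using d by simp
qed

lemma degree_C_0: "B = 0 \<Longrightarrow> degree C = 0"
proof -
  assume B: "B = 0"
  then have A: "A = 0" using zero_iff by simp
  obtain s where "fs s \<noteq> 0" using fs_nonzero by blast
  then have d: "degree (fs s) = 0" using degree_fs B by blast
  then have "degree (fs s - [: - s\<^sup>2 - s * x:]) \<le> 0" by (metis degree_diff_le degree_pCons_0 le_refl)
  moreover have "C = fs s - [: - s\<^sup>2 - s * x :]" unfolding fs_def by (simp add: A)
  ultimately show ?thesis by simp
qed

text \<open>For B at least 3 the two top coefficients of \<open>fs s\<close> do not involve s,
  because \<open>fs s\<close> differs from C by a linear polynomial. Then \<open>coeff_fs\<close>
  makes the difference of D linear in s with slope -B^2, so D is quadratic and A must be 2. The same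
  equation with the roots exchanged now makes C at most quadratic, although its coefficient at B is
  nonzero.\<close>

lemma B_le_2: "B \<le> 2"
proof (rule ccontr)
  assume "\<not> ?thesis"
  then have B: "B \<ge> 3" by simp
  let ?g = "coeff C B" and ?b = "of_nat B :: complex"
  have g: "?g \<noteq> 0" using lead_C B by simp
  have cf: "coeff (fs s) B = ?g" "coeff (fs s) (B - 1) = coeff C (B - 1)" for s
    using B by (auto simp: fs_def coeff_pCons split: nat.split)
  define K where "K = - coeff C (B - 1) / ?g + ?b * y - ?b\<^sup>2 + of_nat (B * (B - 1)) / 2"
  have "poly D (s + 1) - poly D s = K + (- (?b\<^sup>2)) * s" for s
  proof -
    have "coeff C (B - 1) + ?g * (?b * (- y + ?b * s) + ?b\<^sup>2 - of_nat (B * (B - 1)) / 2 + (poly D (s+1) - poly D s)) = 0"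
      using coeff_fs[of s] cf B by simp
    then have "?b * (- y + ?b * s) + ?b\<^sup>2 - of_nat (B * (B - 1)) / 2 + (poly D (s+1) - poly D s) = - coeff C (B - 1) / ?g"
      using g by (simp add: field_simps del: of_nat_mult)
    then show ?thesis unfolding K_def by (simp add: algebra_simps power2_eq_square del: of_nat_mult)
  qed
  then have D: "D = [:poly D 0, K - (- (?b\<^sup>2)) / 2, (- (?b\<^sup>2)) / 2:]" by (rule poly_difference_linear)
  have "- (?b\<^sup>2) / 2 \<noteq> 0" using B by simp
  then obtain d0 d1 d2 where d: "D = [:d0,d1,d2:]" "d2 \<noteq> 0" using D by blast
  then have dD: "degree D = 2" by simp
  then have "A \<ge> 2" using root_pair.degree_C[OF swap] by simp
  then have "coeff D A \<noteq> 0" using root_pair.lead_C[OF swap] by simp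
  then have A: "A = 2" using dD \<open>A \<ge> 2\<close> le_degree[of D A] by simp
  define q1 q2 where q_def: "q1 = d1 / d2" "q2 = ?b / d2"
  then have q: "d1 = d2 * q1" "?b = d2 * q2" using d(2) by simp_all
  have "poly C (t + 1) - poly C t = (2 * x - 3 - q1) + (- 4 - q2) * t" for t
  proof -
    have "(d1 + t * ?b) + d2 * (2 * (- x + 2 * t) + 3 + (poly C (t+1) - poly C t)) = 0"
      using root_pair.coeff_fs[OF swap, of t] unfolding root_pair.fs_def[OF swap]
      by (simp add: A d coeff_pCons numeral_2_eq_2 add_ac)
    then have "d2 * (q1 + t * q2 + (2 * (- x + 2 * t) + 3 + (poly C (t+1) - poly C t))) = 0"
      unfolding q by (simp only: distrib_left mult.left_commute)
    then have "q1 + t * q2 + (2 * (- x + 2 * t) + 3 + (poly C (t+1) - poly C t)) = 0"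
      using d(2) by simp
    then show ?thesis by Groebner_Basis.algebra
  qed
  then have "C = [:poly C 0, (2 * x - 3 - q1) - (- 4 - q2) / 2, (- 4 - q2) / 2:]" by (rule poly_difference_linear)
  moreover have "degree [:a, b, c:] \<le> 2" for a b c :: complex by simp
  ultimately have "degree C \<le> 2" by metis
  then show False using le_degree[of C B] g B by simp
qed

lemma C_quadratic: "C = [:coeff C 0, coeff C 1, coeff C 2:]"
proof (rule poly_eqI)
  fix n
  have "degree C \<le> 2" using degree_C B_le_2 by (simp add: max_def split: if_splits)
  then show "coeff C n = coeff [:coeff C 0, coeff C 1, coeff C 2:] n"
    by (auto simp: coeff_pCons numeral_2_eq_2 coeff_eq_0 split: nat.split)
qed

lemma C_linear: "B = 1 \<Longrightarrow> coeff C 2 = 0"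
  using degree_C by (simp add: coeff_eq_0)

lemma D_diff: "poly D (s + 1) - poly D s = coeff D 2 * (2 * s + 1) + coeff D 1"
  by (subst (1 2) root_pair.C_quadratic[OF swap]) (simp add: algebra_simps)

text \<open>Unlike for larger B, the coefficients of \<open>fs s\<close> depend on s here. Both
  \<open>eq_1\<close> and \<open>eq_2\<close> are polynomial identities in s, and a few values of s
  yield enough equations to determine the unknown coefficients.\<close>

lemma eq_1: "B = 1 \<Longrightarrow> coeff C 0 - s\<^sup>2 - s * x + (coeff C 1 + of_nat A * s) *
     (- y + s + 1 + coeff D 2 * (2 * s + 1) + coeff D 1) = 0"
  using coeff_fs[of s] unfolding D_diff by (simp add: fs_def algebra_simps)

lemma eq_2: "B = 2 \<Longrightarrow> coeff C 1 + of_nat A * s + coeff C 2 *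
     (2 * (- y + 2 * s) + 3 + coeff D 2 * (2 * s + 1) + coeff D 1) = 0"
  using coeff_fs[of s] unfolding D_diff by (simp add: fs_def algebra_simps coeff_pCons numeral_2_eq_2)

lemmas eq_1' = root_pair.eq_1[OF swap] and eq_2' = root_pair.eq_2[OF swap]

text \<open>\<open>poly C 0\<close> is the value of \<open>r i\<close> at the base point. Its
  negative splits into two numbers with sum x, and one of them is the slope of C along the other
  root; this is the origin of \<open>fac\<close>.\<close>

lemma simple_edge:
  assumes "A = 1" "B = 1"
  shows "coeff C 1 + coeff D 1 = x + y - 1"
    and "poly C 0 = - (coeff C 1 * (x - coeff C 1))"
proof -
  obtain c0 c1 d1 where cd: "coeff C 0 = c0" "coeff C 1 = c1" "coeff D 1 = d1" by blast
  have z: "coeff D 2 = 0"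
    using root_pair.C_linear[OF swap] assms by auto
  have e: "c0 - s\<^sup>2 - s * x + (c1 + s) * (- y + s + 1 + d1) = 0" for s
    using eq_1[OF assms(2), of s] by (simp add: z assms cd del: One_nat_def)
  have e0: "c0 + c1 * (- y + 1 + d1) = 0" and e1: "c0 - 1 - x + (c1 + 1) * (- y + 2 + d1) = 0"
    using e[of 0] e[of 1] by (simp_all add: algebra_simps)
  have *: "c1 + d1 = x + y - 1"
    using e0 e1 by Groebner_Basis.algebra
  have "c0 = - (c1 * (x - c1))"
    using e0 * by Groebner_Basis.algebra
  with * show "coeff C 1 + coeff D 1 = x + y - 1" "poly C 0 = - (coeff C 1 * (x - coeff C 1))"
    unfolding poly_0_coeff_0 cd by auto
qed

text \<open>Here D belongs to the longer root. The coefficient of s^2 in \<open>eq_1\<close> is 1 +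
  4 d2, whence the constant -1/4; the values at 0, 1 and -1 encode this. The slope of C is now twice
  one of the two factors, which explains the halves.\<close>

lemma double_edge:
  assumes "A = 2" "B = 1"
  shows "coeff D 2 = - 1 / 4"
    and "coeff C 1 / 2 = x + y - 3 / 2"
    and "poly C 0 = - (coeff C 1 / 2 * (x - coeff C 1 / 2))"
proof -
  obtain c0 c1 d1 d2 where cd: "coeff C 0 = c0" "coeff C 1 = c1" "coeff D 1 = d1" "coeff D 2 = d2"
    by blast
  have z: "coeff C 2 = 0" using C_linear assms by auto
  have e: "c0 - s\<^sup>2 - s * x + (c1 + 2 * s) * (- y + s + 1 + d2 * (2 * s + 1) + d1) = 0" for s
    using eq_1[OF assms(2), of s] by (simp add: assms cd del: One_nat_def)
  have e': "d1 + d2 * (- 2 * x + 3 + c1) = 0"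
    using eq_2'[OF assms(1), of 0] by (simp add: z assms cd del: One_nat_def)
  have e0: "c0 + c1 * (- y + 1 + d2 + d1) = 0"
    and e1: "c0 - 1 - x + (c1 + 2) * (- y + 2 + 3 * d2 + d1) = 0"
    and e2: "c0 - 1 + x + (c1 - 2) * (- y - d2 + d1) = 0"
    using e[of 0] e[of 1] e[of "-1"] by (simp_all add: algebra_simps)
  have "4 * d2 = - 1"
    using e0 e1 e2 by Groebner_Basis.algebra
  then have d: "d2 = - 1 / 4" using nonzero_mult_div_cancel_left[of 4 d2] by simp
  have 1: "4 * d1 = 3 - 2 * x + c1"
    using e' unfolding d by (simp add: field_simps)
  have 2: "- 4 * x + 2 * c1 + 8 * (- y + d1) + 6 = 0"
    using e0 e1 \<open>4 * d2 = - 1\<close> by Groebner_Basis.algebra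
  have 3: "c1 = 2 * x + 2 * y - 3"
    using 1 2 by Groebner_Basis.algebra
  have "4 * c0 = - (c1 * (2 * x - c1))"
    using e0 \<open>4 * d2 = - 1\<close> 1 3 by Groebner_Basis.algebra
  then show "coeff D 2 = - 1 / 4" "coeff C 1 / 2 = x + y - 3 / 2"
    "poly C 0 = - (coeff C 1 / 2 * (x - coeff C 1 / 2))"
    unfolding poly_0_coeff_0 cd by (simp_all add: d 3 field_simps)
qed

text \<open>The affine diagram A_1^(1). As x and y are coroots plus one, the second conclusion says
  that the two coroots add up to zero at the point. The leading coefficients agree and satisfy (c2 +
  1)^2 = 0.\<close>

lemma affine_edge:
  assumes "A = 2" "B = 2"
  shows "coeff C 2 = -1" and "x + y = 2"
proof -
  obtain c1 c2 d1 d2 where cd: "coeff C 1 = c1" "coeff C 2 = c2" "coeff D 1 = d1" "coeff D 2 = d2"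
    by blast
  have e: "c1 + 2 * s + c2 * (2 * (- y + 2 * s) + 3 + d2 * (2 * s + 1) + d1) = 0" for s
    using eq_2[OF assms(2), of s] by (simp add: assms cd del: One_nat_def)
  have e': "d1 + 2 * s + d2 * (2 * (- x + 2 * s) + 3 + c2 * (2 * s + 1) + c1) = 0" for s
    using eq_2'[OF assms(1), of s] by (simp add: assms cd del: One_nat_def)
  have e0: "c1 + c2 * (- 2 * y + 3 + d2 + d1) = 0" and e1: "c1 + 2 + c2 * (- 2 * y + 7 + 3 * d2 + d1) = 0"
    and e0': "d1 + d2 * (- 2 * x + 3 + c2 + c1) = 0" and e1': "d1 + 2 + d2 * (- 2 * x + 7 + 3 * c2 + c1) = 0"
    using e[of 0] e[of 1] e'[of 0] e'[of 1] by (simp_all add: algebra_simps)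
  have 1: "2 + c2 * (4 + 2 * d2) = 0" using e0 e1 by Groebner_Basis.algebra
  have 2: "2 + d2 * (4 + 2 * c2) = 0" using e0' e1' by Groebner_Basis.algebra
  have 3: "c2 = d2" using 1 2 by Groebner_Basis.algebra
  then have "(c2 + 1)\<^sup>2 = (2 + c2 * (4 + 2 * d2)) / 2" by (simp add: power2_eq_square field_simps)
  then have "(c2 + 1)\<^sup>2 = 0" using 1 by simp
  then have 4: "c2 = -1" by (simp add: add_eq_0_iff2)
  have "x + y = 2"
    using e0 e0' 3 4 by Groebner_Basis.algebra
  with 4 show "coeff C 2 = -1" "x + y = 2" unfolding cd by auto
qed

end

lemma quadratic_coeffs_unique:
  fixes a b c a' b' c' :: complex
  assumes "\<And>u. a + b * u + c * u\<^sup>2 = a' + b' * u + c' * u\<^sup>2"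
  shows "a = a'" "b = b'" "c = c'"
proof -
  have "[:a, b, c:] = [:a', b', c':]"
    by (rule poly_eqI_complex) (use assms in \<open>simp add: algebra_simps power2_eq_square\<close>)
  then show "a = a'" "b = b'" "c = c'" by simp_all
qed

text \<open>For use with \<open>r_quadratic_at\<close>: a quadratic coefficient that is a quarter of
  a natural number cannot be -1/4.\<close>

lemma of_nat_nonpos_complex:
  "of_nat m = 4 * (b::complex) \<Longrightarrow> b = 0 \<or> b = -1/4 \<Longrightarrow> m = 0"
proof (elim disjE)
  assume "of_nat m = 4 * b" "b = -1/4"
  then have "(of_nat (Suc m) :: complex) = 0" by simp
  then show "m = 0" using of_nat_neq_0 by blast
qed simp

section \<open>Classification\<close>

text \<open>
  \<open>sh k s c\<close> is the point \<open>c + s \<alpha>\<^sub>k\<close> of the dual of the Cartan subalgebra, \<open>h i\<close> is the \<open>i\<close>-th coroot, and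
  \<open>r i\<close> is the polynomial by which \<open>f\<^sub>i e\<^sub>i\<close> acts.
\<close>

locale root_system_data =
  fixes A :: "int ^ 'n ^ 'n"
    and r :: "'n::finite \<Rightarrow> 'p \<Rightarrow> complex" and h :: "'n \<Rightarrow> 'p \<Rightarrow> complex"
    and sh :: "'n \<Rightarrow> complex \<Rightarrow> 'p \<Rightarrow> 'p"
  assumes gcm: "generalized_cartan_matrix A" and indec: "indecomposable A"
    and sh_sh: "sh k s (sh k t c) = sh k (s + t) c"
    and sh_comm: "sh j t (sh k s c) = sh k s (sh j t c)"
    and sh_0: "sh k 0 c = c"
    and h_sh: "h i (sh k s c) = h i c + s * of_int (A $ i $ k)"
    and poly_r: "\<exists>P. \<forall>s. r i (sh k s c) = poly P s"
    and r_step: "r i (sh i (-1) c) = r i c + h i c"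
    and r_comm: "i \<noteq> j \<Longrightarrow> r i c * r j c = r j (sh i 1 c) * r i (sh j 1 c)"
    and h_indep: "(\<And>c. (\<Sum>i\<in>UNIV. z i * h i c) = 0) \<Longrightarrow> z i = 0"
begin

definition "N i j = nat (- (A $ i $ j))"

lemma A_N: "i \<noteq> j \<Longrightarrow> A $ i $ j = - int (N i j)"
  using gcm by (simp add: N_def generalized_cartan_matrix_def)

lemma A_diag: "A $ i $ i = 2"
  using gcm by (simp add: generalized_cartan_matrix_def)

lemma N_zero_iff: "i \<noteq> j \<Longrightarrow> N i j = 0 \<longleftrightarrow> N j i = 0"
  using gcm A_N[of i j] A_N[of j i] unfolding generalized_cartan_matrix_def by (metis neg_equal_0_iff_equal of_nat_eq_0_iff)

lemma h_sh_N: "i \<noteq> k \<Longrightarrow> h i (sh k s c) = h i c - of_nat (N i k) * s"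
  by (simp add: h_sh A_N)

text \<open>\<open>r_step\<close> is a difference equation along the root itself, where the coroot
  grows by 2 per step. Its solution has leading coefficient -1, and summation contributes the 1 next
  to the coroot.\<close>

lemma r_sh_self: "r i (sh i s c) = r i c - s\<^sup>2 - s * (h i c + 1)"
proof -
  obtain P where P: "\<And>s. r i (sh i s c) = poly P s" using poly_r by meson
  have "poly P (s + 1) - poly P s = (- h i c - 2) + (-2) * s" for s
    using r_step[of i "sh i (s + 1) c"]
    by (simp add: sh_sh h_sh A_diag algebra_simps flip: P)
  then have "P = [:poly P 0, (- h i c - 2) - (-2) / 2, (-2) / 2:]"
    by (rule poly_difference_linear)
  moreover have "(- h i c - 2) - (-2) / 2 = - h i c - 1" "(-2) / 2 = (-1 :: complex)" by simp_all
  ultimately have "P = [:poly P 0, - h i c - 1, -1:]" by (simp only:)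
  then have "poly P s = poly [:poly P 0, - h i c - 1, -1:] s" by (rule arg_cong)
  then show ?thesis using P[of s] P[of 0] by (simp add: sh_0 algebra_simps power2_eq_square)
qed

text \<open>The restriction of \<open>r i\<close> to the plane through c is known from a single
  line: in the direction of its own root \<open>r_sh_self\<close> determines it, so only its values
  C along the other root remain unknown.\<close>

lemma root_pairE:
  assumes "i \<noteq> j"
  obtains C D where "\<And>t. r i (sh j t c) = poly C t" "\<And>s. r j (sh i s c) = poly D s"
    "root_pair C D (h i c + 1) (h j c + 1) (N i j) (N j i)"
proof -
  obtain C where C: "\<And>t. r i (sh j t c) = poly C t" using poly_r by meson
  obtain D where D: "\<And>s. r j (sh i s c) = poly D s" using poly_r by meson
  have ri: "r i (sh i s (sh j t c)) = poly C t - s\<^sup>2 - s * ((h i c + 1) - of_nat (N i j) * t)" for s t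
    using assms by (simp add: r_sh_self C h_sh_N algebra_simps)
  have rj: "r j (sh i s (sh j t c)) = poly D s - t\<^sup>2 - t * ((h j c + 1) - of_nat (N j i) * s)" for s t
    using assms by (simp add: sh_comm[of i s j t] r_sh_self D h_sh_N algebra_simps)
  have "root_pair C D (h i c + 1) (h j c + 1) (N i j) (N j i)"
  proof
    fix t s
    have "r i (sh i s (sh j t c)) * r j (sh i s (sh j t c)) =
       r j (sh i (s + 1) (sh j t c)) * r i (sh i s (sh j (t + 1) c))"
      using r_comm[OF assms, of "sh i s (sh j t c)"]
      by (simp add: sh_sh sh_comm[of j 1 i s] add.commute)
    then show "(poly C t - s\<^sup>2 - s * ((h i c + 1) - of_nat (N i j) * t)) * (poly D s - t\<^sup>2 - t * ((h j c + 1) - of_nat (N j i) * s))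
       = (poly D (s+1) - t\<^sup>2 - t * ((h j c + 1) - of_nat (N j i) * (s+1))) * (poly C (t+1) - s\<^sup>2 - s * ((h i c + 1) - of_nat (N i j) * (t+1)))"
      unfolding ri rj .
  qed (use N_zero_iff[OF assms] in simp)
  with C D show thesis by (rule that)
qed

lemma N_le_2: "i \<noteq> j \<Longrightarrow> N i j \<le> 2"
  by (metis root_pairE root_pair.B_le_2)

lemma N_not_2_2: "i \<noteq> j \<Longrightarrow> N i j = 2 \<Longrightarrow> N j i \<noteq> 2"
proof
  assume ij: "i \<noteq> j" "N i j = 2" "N j i = 2"
  define z where "z = (\<lambda>k. if k = i \<or> k = j then 1 else 0 :: complex)"
  have "(\<Sum>k\<in>UNIV. z k * h k c) = 0" for c
  proof -
    obtain C D where "root_pair C D (h i c + 1) (h j c + 1) (N i j) (N j i)"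
      using root_pairE[OF ij(1), of c] by metis
    then have "(h i c + 1) + (h j c + 1) = 2" using root_pair.affine_edge(2) ij by blast
    then have "h i c + h j c = 0" by (simp add: algebra_simps)
    moreover have "(\<Sum>k\<in>UNIV. z k * h k c) = (\<Sum>k\<in>{i, j}. h k c)"
      by (rule sum.mono_neutral_cong_right) (auto simp: z_def)
    ultimately show ?thesis using ij by simp
  qed
  from h_indep[OF this, of i] show False by (simp add: z_def)
qed

lemma N_cases:
  assumes "i \<noteq> j"
  obtains "N i j = 0" "N j i = 0" | "N i j = 1" "N j i = 1" | "N i j = 1" "N j i = 2" | "N i j = 2" "N j i = 1"
  using assms N_le_2[OF assms] N_le_2[OF assms[symmetric]] N_not_2_2[OF assms] N_zero_iff[OF assms]
  by (metis One_nat_def Suc_1 le_SucE le_zero_eq)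

text \<open>The quadratic coefficient depends on the edge alone and not on the point. Thus
  \<open>r i\<close> is curved along another root only if i is the long end of a double edge, and
  then negatively; most contradictions below produce a positive coefficient instead.\<close>

lemma r_quadratic:
  assumes "i \<noteq> k"
  obtains a b where "\<And>u. r i (sh k u c) = r i c + a * u + b * u\<^sup>2"
    "b = (if N k i = 2 then -1/4 else 0)"
proof -
  obtain C D where CD: "\<And>t. r i (sh k t c) = poly C t" "\<And>s. r k (sh i s c) = poly D s"
    "root_pair C D (h i c + 1) (h k c + 1) (N i k) (N k i)"
    using root_pairE[OF assms, of c] by metis
  have c: "C = [:coeff C 0, coeff C 1, coeff C 2:]" by (rule root_pair.C_quadratic[OF CD(3)])
  have "r i (sh k u c) = r i c + coeff C 1 * u + coeff C 2 * u\<^sup>2" for u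
    using CD(1)[of u] CD(1)[of 0] c
    by (metis (no_types, lifting) sh_0 add.assoc add_cancel_right_right distrib_left lambda_zero mult.commute
        mult.left_commute poly_0 poly_pCons power2_eq_square mult_zero_left)
  moreover have "coeff C 2 = (if N k i = 2 then -1/4 else 0)"
  proof (cases rule: N_cases[OF assms])
    case 1
    then show ?thesis using root_pair.degree_C_0[OF CD(3)] by (simp add: coeff_eq_0)
  next
    case 2
    then show ?thesis using root_pair.C_linear[OF CD(3)] by simp
  next
    case 3
    then show ?thesis using root_pair.double_edge(1)[OF root_pair.swap[OF CD(3)]] by simp
  next
    case 4
    then show ?thesis using root_pair.C_linear[OF CD(3)] by simp
  qed
  ultimately show thesis by (rule that)
qed

text \<open>\<open>fac i j\<close> is one of the two factors of \<open>- r i\<close> along the root \<open>\<alpha>\<^sub>i\<close>, whose sum is \<open>h i + 1\<close>.\<close>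

definition "fac i j c = (r i (sh j 1 c) - r i c) / of_nat (N i j)"

text \<open>\<open>N j i = 1\<close> makes \<open>r i\<close> affine along the root of j, so one
  difference quotient recovers the slope, and the division by \<open>N i j\<close> absorbs the
  factor 2 of a double edge. At a double edge the factor is even determined by the coroots.\<close>

lemma fac_props:
  assumes "i \<noteq> j" "N j i = 1"
  shows "r i (sh j t c) = r i c + of_nat (N i j) * fac i j c * t"
    and "r i c = - (fac i j c * (h i c + 1 - fac i j c))"
    and "N i j = 1 \<Longrightarrow> fac i j c + fac j i c = h i c + h j c + 1"
    and "N i j = 2 \<Longrightarrow> fac i j c = h i c + h j c + 1/2"
proof -
  obtain C D where CD: "\<And>t. r i (sh j t c) = poly C t" "\<And>s. r j (sh i s c) = poly D s"
    "root_pair C D (h i c + 1) (h j c + 1) (N i j) (N j i)"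
    using root_pairE[OF assms(1), of c] by metis
  have N: "N i j = 1 \<or> N i j = 2" by (cases rule: N_cases[OF assms(1)]) (use assms in auto)
  have "C = [:coeff C 0, coeff C 1, 0:]"
    using root_pair.C_quadratic[OF CD(3)] root_pair.C_linear[OF CD(3) assms(2)] by simp
  then have C: "poly C t = coeff C 0 + coeff C 1 * t" for t
    by (metis add_cancel_right_right mult.commute mult_zero_right poly_0 poly_pCons pCons_0_0)
  have C0: "coeff C 0 = r i c" using CD(1)[of 0] by (simp add: sh_0 poly_0_coeff_0)
  have C1: "coeff C 1 = of_nat (N i j) * fac i j c"
    using CD(1)[of 1] CD(1)[of 0] N unfolding fac_def C by (auto simp: sh_0)
  show "r i (sh j t c) = r i c + of_nat (N i j) * fac i j c * t"
    using CD(1)[of t] C C0 C1 by simp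
  show "r i c = - (fac i j c * (h i c + 1 - fac i j c))"
  proof (cases "N i j = 1")
    case True
    then show ?thesis using root_pair.simple_edge(2)[OF CD(3) _ assms(2)] C0 C1 by (simp add: poly_0_coeff_0)
  next
    case False
    then have "N i j = 2" using N by simp
    then show ?thesis using root_pair.double_edge(3)[OF CD(3) _ assms(2)] C0 C1 by (simp add: poly_0_coeff_0)
  qed
  show "fac i j c + fac j i c = h i c + h j c + 1" if "N i j = 1"
  proof -
    have "D = [:coeff D 0, coeff D 1, 0:]"
      using root_pair.C_quadratic[OF root_pair.swap[OF CD(3)]] root_pair.C_linear[OF root_pair.swap[OF CD(3)] that] by simp
    then have D: "poly D t = coeff D 0 + coeff D 1 * t" for t
      by (metis add_cancel_right_right mult.commute mult_zero_right poly_0 poly_pCons pCons_0_0)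
    have "coeff D 1 = fac j i c"
      using CD(2)[of 1] CD(2)[of 0] assms unfolding fac_def D by (auto simp: sh_0)
    then show ?thesis using root_pair.simple_edge(1)[OF CD(3) that assms(2)] C1 that by simp
  qed
  show "fac i j c = h i c + h j c + 1/2" if "N i j = 2"
  proof -
    have "coeff C 1 / 2 = fac i j c" unfolding C1 that by simp
    then have "fac i j c = (h i c + 1) + (h j c + 1) - 3 / 2"
      using root_pair.double_edge(2)[OF CD(3) that assms(2)] by (simp only:)
    then show ?thesis by simp
  qed
qed

text \<open>By \<open>r_quadratic\<close> the quadratic coefficients along the third root agree at c
  and one step further along j, so \<open>fac\<close>, being a difference quotient, moves affinely,
  with slope m. As \<open>h i\<close> has slope -q with q = \<open>N i k\<close>, the product
  formula gives the quadratic coefficient m (q + m). If this is 0 and m is not, then m = -q and the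
  partner \<open>h i + 1 - fac i j\<close> stands still.\<close>

lemma fac_sh:
  assumes "i \<noteq> j" "N j i = 1" "k \<noteq> i" "k \<noteq> j"
  obtains m where "\<And>u. fac i j (sh k u c) = fac i j c + m * u"
    "m * (of_nat (N i k) + m) = (if N k i = 2 then -1/4 else 0)"
    "N k i \<noteq> 2 \<Longrightarrow> m \<noteq> 0 \<Longrightarrow> r i (sh k 1 c) - r i c = of_nat (N i k) * (h i c + 1 - fac i j c)"
proof -
  let ?n = "of_nat (N i j) :: complex"
  have n: "?n \<noteq> 0" using assms N_zero_iff[of i j] by simp
  obtain a b where ab: "\<And>u. r i (sh k u c) = r i c + a * u + b * u\<^sup>2"
    "b = (if N k i = 2 then -1/4 else 0)"
    using r_quadratic[of i k c] assms(3) by metis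
  obtain a' where ab': "\<And>u. r i (sh k u (sh j 1 c)) = r i (sh j 1 c) + a' * u + b * u\<^sup>2"
    using r_quadratic[of i k "sh j 1 c"] assms(3) ab(2) by metis
  define m where "m = (a' - a) / ?n"
  have fm: "fac i j (sh k u c) = fac i j c + m * u" for u
    using n unfolding fac_def m_def sh_comm[of j 1 k u] ab' ab(1) by (simp add: field_simps)
  define R F H q where "R = r i c" "F = fac i j c" "H = h i c + 1" "q = (of_nat (N i k) :: complex)"
  have e: "R + a * u + b * u\<^sup>2 = - (F * (H - F)) + (F * (q + m) - m * (H - F)) * u + m * (q + m) * u\<^sup>2" for u
  proof -
    have "r i (sh k u c) = - ((F + m * u) * ((h i c - q * u) + 1 - (F + m * u)))"
      using fac_props(2)[OF assms(1,2), of "sh k u c"] assms(3) unfolding fm by (simp add: h_sh_N R_F_H_q_def)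
    also have "\<dots> = - (F * (H - F)) + (F * (q + m) - m * (H - F)) * u + m * (q + m) * u\<^sup>2"
      unfolding R_F_H_q_def(3) by (simp add: algebra_simps power2_eq_square)
    finally show ?thesis by (simp only: ab(1) R_F_H_q_def(1))
  qed
  note q = quadratic_coeffs_unique[OF e]
  have "r i (sh k 1 c) - r i c = q * (H - F)" if "N k i \<noteq> 2" "m \<noteq> 0"
  proof -
    have "b = 0" using ab(2) that by simp
    then have "m * (q + m) = 0" using q(3) by simp
    then have "q = - m" using that by (simp add: eq_neg_iff_add_eq_0)
    moreover have "r i (sh k 1 c) - r i c = a" using ab(1)[of 1] \<open>b = 0\<close> by simp
    ultimately show ?thesis using q(2) by simp
  qed
  with fm q(3) ab(2) show thesis using that[of m] unfolding R_F_H_q_def by metis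
qed

lemma r_quadratic_at:
  assumes "i \<noteq> k" and e: "\<And>u. r i (sh k u c) = a + b * u + d * u\<^sup>2"
  shows "d = 0 \<or> d = -1/4"
proof -
  obtain a' b' where "\<And>u. r i (sh k u c) = r i c + a' * u + b' * u\<^sup>2"
    "b' = (if N k i = 2 then -1/4 else 0)"
    using r_quadratic[OF assms(1), of c] by metis
  then show ?thesis using quadratic_coeffs_unique(3)[of a b d] e by (metis (no_types, lifting))
qed

text \<open>Otherwise some \<open>r\<close> would have a positive leading coefficient along the third root.\<close>

lemma fac_other_neighbour:
  assumes "i \<noteq> j" "i \<noteq> k" "j \<noteq> k" "N j i = 1" "N k i = 1"
  shows "fac i j c + fac i k c = h i c + 1"
proof -
  have Nik: "N i k > 0" and Nij: "N i j \<noteq> 0" using N_zero_iff[OF assms(1)] N_zero_iff[OF assms(2)] assms by simp_all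
  obtain m where m0: "\<And>u. fac i j (sh k u c) = fac i j c + m * u"
    "m * (of_nat (N i k) + m) = (if N k i = 2 then -1/4 else 0)"
    "N k i \<noteq> 2 \<Longrightarrow> m \<noteq> 0 \<Longrightarrow> r i (sh k 1 c) - r i c = of_nat (N i k) * (h i c + 1 - fac i j c)"
    using fac_sh[OF assms(1,4) assms(2,3)[symmetric], of c] by blast
  note m = m0[unfolded assms(5), simplified]
  have "m \<noteq> 0"
  proof
    assume "m = 0"
    then have c: "\<And>u. fac i j (sh k u c) = fac i j c" using m(1) by simp
    show False
    proof (cases rule: N_cases[OF assms(1)])
      case 2
      define p q where "p = (of_nat (N i k) :: complex)" "q = (of_nat (N j k) :: complex)"
      \<comment> \<open>At a simple edge the two factors together move like the sum of both coroots;
        if one stands still, the other takes up the whole movement.\<close>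
      have F: "fac j i (sh k u c) = fac j i c - (p + q) * u" for u
      proof -
        have "h i (sh k u c) = h i c - p * u" "h j (sh k u c) = h j c - q * u"
          using assms by (simp_all add: h_sh_N p_q_def)
        then show ?thesis
          using fac_props(3)[OF assms(1) 2(2,1), of "sh k u c"] fac_props(3)[OF assms(1) 2(2,1), of c] c[of u]
          by Groebner_Basis.algebra
      qed
      have "r j (sh k u c) = - (fac j i c * (h j c + 1 - fac j i c))
          + ((p + q) * (h j c + 1 - fac j i c) - fac j i c * p) * u + ((p + q) * p) * u\<^sup>2" for u
        using fac_props(2)[of j i "sh k u c"] 2 assms unfolding F
        by (simp add: h_sh_N p_q_def(2)[symmetric] algebra_simps power2_eq_square)
      from r_quadratic_at[OF assms(3) this] have "(p + q) * p = 0 \<or> (p + q) * p = -1/4" .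
      moreover have "of_nat (4 * ((N i k + N j k) * N i k)) = 4 * ((p + q) * p)" by (simp add: p_q_def)
      ultimately have "4 * ((N i k + N j k) * N i k) = 0"
        using of_nat_nonpos_complex by blast
      then show False using Nik by simp
    next
      case 4
      have "h i (sh k 1 c) = h i c - of_nat (N i k)" "h j (sh k 1 c) = h j c - of_nat (N j k)"
        using assms by (simp_all add: h_sh_N)
      then have "of_nat (N i k) + of_nat (N j k) = (0::complex)"
        using fac_props(4)[OF assms(1) 4(2,1), of "sh k 1 c"] fac_props(4)[OF assms(1) 4(2,1), of c] c[of 1]
        by Groebner_Basis.algebra
      then have "N i k + N j k = 0" by (metis of_nat_add of_nat_eq_0_iff)
      then show False using Nik by simp
    qed (use assms Nij in auto)
  qed
  \<comment> \<open>Along the third root \<open>fac i j\<close> moves and its partner is fixed, so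
    the difference quotient of \<open>r i\<close> in this direction is the partner.\<close>
  from m(3)[OF this] have "fac i k c = h i c + 1 - fac i j c"
    unfolding fac_def using Nik by simp
  then show ?thesis by simp
qed

text \<open>Any two of the three factors add up to \<open>h i + 1\<close>, so each is half of it and
  has slope -\<open>N i k\<close> / 2 along the root of k. But \<open>fac_sh\<close> allows only the
  slopes 0 and -\<open>N i k\<close>.\<close>

lemma not_three_simple_neighbours:
  assumes "i \<noteq> j" "i \<noteq> k" "i \<noteq> m" "j \<noteq> k" "j \<noteq> m" "k \<noteq> m" "N j i = 1" "N k i = 1" "N m i = 1"
  shows False
proof -
  have Nij: "N i j \<noteq> 0" using N_zero_iff[OF assms(1)] assms by simp
  have x: "fac i j c = (h i c + 1) / 2" for c
  proof -
    have "2 * fac i j c = h i c + 1"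
      using fac_other_neighbour[OF assms(1,2,4,7,8), of c] fac_other_neighbour[OF assms(1,3,5,7,9), of c]
        fac_other_neighbour[OF assms(2,3,6,8,9), of c] by Groebner_Basis.algebra
    then have "2 * fac i j c / 2 = (h i c + 1) / 2" by (rule arg_cong)
    then show ?thesis by simp
  qed
  obtain c :: 'p where True by blast
  obtain n where n: "\<And>u. fac i j (sh k u c) = fac i j c + n * u"
    "n * (of_nat (N i k) + n) = (if N k i = 2 then -1/4 else 0)"
    using fac_sh[OF assms(1,7) assms(2,4)[symmetric], of c] by blast
  have "2 * fac i j c = h i c + 1" "2 * fac i j (sh k 1 c) = h i c - of_nat (N i k) + 1"
    using assms(2) unfolding x by (simp_all add: h_sh_N)
  then have "2 * n = - of_nat (N i k)"
    using n(1)[of 1] by Groebner_Basis.algebra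
  moreover have "n * (of_nat (N i k) + n) = 0" using n(2) assms by simp
  ultimately have "of_nat (N i k) = (0 :: complex)" by Groebner_Basis.algebra
  then show False using assms N_zero_iff[of i k] by simp
qed

lemma m_half: "m = - 1/2" if "m * (1 + m) = -1/4" for m :: complex
proof -
  have "(2 * m + 1)\<^sup>2 = 4 * (m * (1 + m)) + 1" by (simp add: power2_eq_square algebra_simps)
  then have "2 * m = - 1" unfolding that by (simp add: add_eq_0_iff2)
  then have "2 * m / 2 = - 1 / 2" by (rule arg_cong)
  then show ?thesis by simp
qed

text \<open>\<open>N i j = 2\<close> makes j the longer root, and both factors of
  \<open>- r j\<close> have slope -1/2 along the root of i. If the edge from j to k is simple, this
  passes to the factors of \<open>- r k\<close> and gives \<open>r k\<close> a positive quadratic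
  coefficient. If k is longer than j, the slope would have to be that of h j + h k, an integer. If k
  is shorter than j, then \<open>r i\<close> acquires the positive coefficient p + 1 along
  k.\<close>

lemma long_root_leaf:
  assumes "i \<noteq> j" "i \<noteq> k" "j \<noteq> k" "N i j = 2"
  shows "N j k = 0"
proof (rule ccontr)
  assume jk0: "N j k \<noteq> 0"
  obtain c :: 'p where True by blast
  have ji: "N j i = 1" by (cases rule: N_cases[OF assms(1)]) (use assms in auto)
  consider "N k j = 1" "N j k = 1" | "N k j = 1" "N j k = 2" | "N k j = 2" "N j k = 1"
    by (cases rule: N_cases[OF assms(3)]) (use jk0 in auto)
  then show False
  proof cases
    case 3
    define p where "p = (of_nat (N i k) :: complex)"
    have "r i (sh k u c) = - ((h i c + h j c + 1/2) * (1/2 - h j c))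
       + ((p + 1) * (1/2 - h j c) - (h i c + h j c + 1/2)) * u + (p + 1) * u\<^sup>2" for u
      using fac_props(2)[OF assms(1) ji, of "sh k u c"] fac_props(4)[OF assms(1) ji assms(4), of "sh k u c"] assms 3
      by (simp add: h_sh_N p_def[symmetric] algebra_simps power2_eq_square)
    from r_quadratic_at[OF assms(2) this] have "p + 1 = 0 \<or> p + 1 = -1/4" .
    moreover have "of_nat (4 * (N i k + 1)) = 4 * (p + 1)" by (simp add: p_def)
    ultimately have "4 * (N i k + 1) = 0" using of_nat_nonpos_complex by blast
    then show False by simp
  next
    case 1
    obtain m where m: "\<And>u. fac j k (sh i u c) = fac j k c + m * u"
      "m * (of_nat (N j i) + m) = (if N i j = 2 then -1/4 else 0)"
      using fac_sh[OF assms(3) 1(1) assms(1,2), of c] by blast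
    have m': "m = - 1/2" using m(2) assms(4) ji by (intro m_half) simp
    define q where "q = (of_nat (N k i) :: complex)"
    have hs: "h j (sh i u c) = h j c - u" "h k (sh i u c) = h k c - q * u" for u
      using assms by (simp_all add: h_sh_N ji q_def)
    have F: "fac k j (sh i u c) = fac k j c - (1 + q + m) * u" for u
      using fac_props(3)[OF assms(3) 1(1,2), of "sh i u c"] fac_props(3)[OF assms(3) 1(1,2), of c] hs[of u] m(1)[of u]
      by Groebner_Basis.algebra
    have "r k (sh i u c) = - (fac k j c * (h k c + 1 - fac k j c))
       + ((1 + q + m) * (h k c + 1 - fac k j c) - fac k j c * (1 + m)) * u + ((1 + q + m) * (1 + m)) * u\<^sup>2" for u
      using fac_props(2)[OF assms(3)[symmetric] 1(2), of "sh i u c"] unfolding F hs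
      by Groebner_Basis.algebra
    from r_quadratic_at[OF assms(2)[symmetric] this]
    have "(1 + q + m) * (1 + m) = 0 \<or> (1 + q + m) * (1 + m) = -1/4" .
    moreover have "of_nat (1 + 2 * N k i) = 4 * ((1 + q + m) * (1 + m))" unfolding m' by (simp add: q_def)
    ultimately have "1 + 2 * N k i = 0"
      using of_nat_nonpos_complex by blast
    then show False by simp
  next
    case 2
    obtain m where m: "\<And>u. fac j k (sh i u c) = fac j k c + m * u"
      "m * (of_nat (N j i) + m) = (if N i j = 2 then -1/4 else 0)"
      using fac_sh[OF assms(3) 2(1) assms(1,2), of c] by blast
    have m': "m = - 1/2" using m(2) assms(4) ji by (intro m_half) simp
    have hs: "h j (sh i 1 c) = h j c - 1" "h k (sh i 1 c) = h k c - of_nat (N k i)"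
      using assms by (simp_all add: h_sh_N ji)
    have "m = - (1 + of_nat (N k i))"
      using fac_props(4)[OF assms(3) 2, of "sh i 1 c"] fac_props(4)[OF assms(3) 2, of c] m(1)[of 1] hs
      by Groebner_Basis.algebra
    then have "1 + of_nat (N k i) = - m" by simp
    then have "2 * (1 + of_nat (N k i)) = 2 * (- m)" by (rule arg_cong)
    also have "\<dots> = 1" unfolding m' by simp
    finally have "2 * (1 + of_nat (N k i)) = (1::complex)" .
    moreover have "of_nat (2 * (1 + N k i)) = (2 * (1 + of_nat (N k i)) :: complex)" by simp
    ultimately have "(of_nat (2 * (1 + N k i)) :: complex) = of_nat 1" by (simp only: of_nat_1)
    then have "2 * (1 + N k i) = 1" unfolding of_nat_eq_iff .
    then show False by simp
  qed
qed

section \<open>The Dynkin diagram as a path through all vertices\<close>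

definition "adj i j \<longleftrightarrow> i \<noteq> j \<and> N i j \<noteq> 0"

lemma adj_sym: "adj i j \<Longrightarrow> adj j i"
  unfolding adj_def using N_zero_iff[of i j] by auto

text \<open>A vertex with a second neighbour is not the long end of an edge, by
  \<open>long_root_leaf\<close>, so all its neighbours satisfy the hypotheses of
  \<open>not_three_simple_neighbours\<close>.\<close>

lemma not_three_neighbours:
  assumes "adj i j" "adj i k" "adj i m" "j \<noteq> k" "j \<noteq> m" "k \<noteq> m"
  shows False
proof -
  have "N l i = 1" if "adj i l" for l
  proof (rule ccontr)
    assume "N l i \<noteq> 1"
    then have "N l i = 2" using that N_cases[of i l] unfolding adj_def by metis
    moreover obtain l' where "adj i l'" "l' \<noteq> l" using assms by metis
    ultimately show False using long_root_leaf[of l i l'] that by (auto simp: adj_def)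
  qed
  then show False using not_three_simple_neighbours[of i j k m] assms by (auto simp: adj_def)
qed

text \<open>Further edges between vertices of the path are allowed at this stage;
  \<open>N_far\<close> excludes them once cycles are ruled out.\<close>

definition simple_path :: "'n list \<Rightarrow> bool" where
  "simple_path vs \<longleftrightarrow> distinct vs \<and> (\<forall>p. Suc p < length vs \<longrightarrow> adj (vs ! p) (vs ! Suc p))"

lemma simple_path_Cons:
  assumes "simple_path vs" "vs \<noteq> []" "j \<notin> set vs" "adj j (vs ! 0)"
  shows "simple_path (j # vs)"
  unfolding simple_path_def
proof (intro conjI allI impI)
  fix p assume "Suc p < length (j # vs)"
  then show "adj ((j # vs) ! p) ((j # vs) ! Suc p)"
    using assms by (cases p) (auto simp: simple_path_def)
qed (use assms in \<open>auto simp: simple_path_def\<close>)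

lemma simple_path_snoc:
  assumes "simple_path vs" "vs \<noteq> []" "j \<notin> set vs" "adj (vs ! (length vs - 1)) j"
  shows "simple_path (vs @ [j])"
  unfolding simple_path_def
proof (intro conjI allI impI)
  fix p assume "Suc p < length (vs @ [j])"
  then consider "Suc p < length vs" | "p = length vs - 1" "Suc p = length vs" by fastforce
  then show "adj ((vs @ [j]) ! p) ((vs @ [j]) ! Suc p)"
    using assms by cases (auto simp: simple_path_def nth_append)
qed (use assms in \<open>auto simp: simple_path_def\<close>)

lemma adj_in_simple_path:
  assumes "simple_path vs" "a < length vs" "adj (vs ! a) j" "0 < a" "Suc a < length vs"
  shows "j = vs ! (a - 1) \<or> j = vs ! Suc a"
proof (rule ccontr)
  assume "\<not> ?thesis"
  moreover have "adj (vs ! a) (vs ! (a - 1))"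
    using assms(1,4,5) adj_sym[of "vs ! (a - 1)" "vs ! a"] unfolding simple_path_def
    by (metis Suc_diff_1 Suc_lessD)
  moreover have "adj (vs ! a) (vs ! Suc a)" using assms by (auto simp: simple_path_def)
  moreover have "vs ! (a - 1) \<noteq> vs ! Suc a"
    using assms by (auto simp: simple_path_def nth_eq_iff_index_eq)
  ultimately show False using not_three_neighbours[of "vs ! a" "vs ! (a - 1)" "vs ! Suc a" j] assms(3) by blast
qed

text \<open>Take a longest path. If it missed a vertex, indecomposability would give an edge leaving
  it. At an end vertex this edge prolongs the path; at an inner vertex it would be a third
  neighbour.\<close>

lemma spanning_simple_path: "\<exists>vs. simple_path vs \<and> set vs = UNIV"
proof -
  have "simple_path []" by (simp add: simple_path_def)
  moreover have "\<forall>vs. simple_path vs \<longrightarrow> length vs < Suc CARD('n)"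
    by (metis simple_path_def distinct_card card_mono finite_UNIV subset_UNIV le_imp_less_Suc finite)
  ultimately obtain vs where vs: "simple_path vs" and mx: "\<And>ws. simple_path ws \<Longrightarrow> length ws \<le> length vs"
    using ex_has_greatest_nat[of simple_path "[]" length] by blast
  have ne: "vs \<noteq> []"
  proof
    assume "vs = []"
    moreover have "simple_path [undefined]" by (simp add: simple_path_def)
    ultimately show False using mx by fastforce
  qed
  have "set vs = UNIV"
  proof (rule ccontr)
    assume "set vs \<noteq> UNIV"
    then have "- set vs \<noteq> {}" "set vs \<noteq> {}" using ne by auto
    then obtain i j where ij: "i \<in> set vs" "j \<notin> set vs" "A $ i $ j \<noteq> 0"
      using indec unfolding indecomposable_def by (metis Compl_disjoint Compl_partition ComplD)
    then have "i \<noteq> j" by blast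
    then have "adj i j" unfolding adj_def using A_N[of i j] ij(3) by auto
    obtain a where a: "a < length vs" "i = vs ! a" using ij by (metis in_set_conv_nth)
    consider "a = 0" | "a = length vs - 1" | "0 < a" "Suc a < length vs" using a by linarith
    then show False
    proof cases
      case 1
      then have "simple_path (j # vs)"
        using simple_path_Cons[OF vs ne ij(2)] \<open>adj i j\<close> a adj_sym by blast
      then show False using mx by fastforce
    next
      case 2
      then have "simple_path (vs @ [j])"
        using simple_path_snoc[OF vs ne ij(2)] \<open>adj i j\<close> a by blast
      then show False using mx by fastforce
    next
      case 3
      then have "j = vs ! (a - 1) \<or> j = vs ! Suc a"
        using adj_in_simple_path[OF vs a(1)] \<open>adj i j\<close> a by simp
      then show False using ij(2) 3 a(1) by (metis nth_mem less_imp_diff_less)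
    qed
  qed
  with vs show ?thesis by blast
qed

lemma N_eq_1:
  assumes "adj i j" "adj j k" "k \<noteq> i"
  shows "N i j = 1"
proof (rule ccontr)
  assume "N i j \<noteq> 1"
  then have "N i j = 2" using assms(1) N_cases[of i j] unfolding adj_def by metis
  then show False using long_root_leaf[of i j k] assms by (auto simp: adj_def)
qed

context
  fixes vs :: "'n list"
  assumes path: "simple_path vs" and spanning: "set vs = UNIV"
begin

abbreviation "l \<equiv> length vs"
abbreviation "v p \<equiv> vs ! p"

lemma adj_Suc: "Suc p < l \<Longrightarrow> adj (v p) (v (Suc p))"
  using path by (simp add: simple_path_def)

lemma v_eq_iff: "p < l \<Longrightarrow> q < l \<Longrightarrow> v p = v q \<longleftrightarrow> p = q"
  using path by (simp add: simple_path_def nth_eq_iff_index_eq)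

lemma bij_v: "bij_betw v {..<l} UNIV"
  using path spanning by (intro bij_betw_nth) (auto simp: simple_path_def)

lemma N_up: "Suc (Suc p) < l \<Longrightarrow> N (v p) (v (Suc p)) = 1"
  using adj_Suc[of p] adj_Suc[of "Suc p"] by (intro N_eq_1[where k = "v (Suc (Suc p))"]) (simp_all add: v_eq_iff)

lemma N_down: "0 < p \<Longrightarrow> Suc p < l \<Longrightarrow> N (v (Suc p)) (v p) = 1"
  using adj_sym[OF adj_Suc[of p]] adj_sym[OF adj_Suc[of "p - 1"]]
  by (intro N_eq_1[where k = "v (p - 1)"]) (simp_all add: v_eq_iff)

lemma sum_h_nonzero: "\<not> (\<forall>c. (\<Sum>p<l. h (v p) c) = 0)"
proof
  assume a: "\<forall>c. (\<Sum>p<l. h (v p) c) = 0"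
  have "(\<Sum>i\<in>UNIV. 1 * h i c) = 0" for c
    using a sum.reindex_bij_betw[OF bij_v, of "\<lambda>i. h i c"] by simp
  from h_indep[OF this] show False by simp
qed

lemma chain_edge:
  assumes "Suc p < l" "N (v p) (v (Suc p)) = 1" "N (v (Suc p)) (v p) = 1"
  shows "fac (v p) (v (Suc p)) c + fac (v (Suc p)) (v p) c = h (v p) c + h (v (Suc p)) c + 1"
  using fac_props(3)[of "v p" "v (Suc p)"] assms by (simp add: v_eq_iff)

lemma chain_vertex:
  assumes "Suc (Suc p) < l"
  shows "fac (v (Suc p)) (v p) c + fac (v (Suc p)) (v (Suc (Suc p))) c = h (v (Suc p)) c + 1"
  using fac_other_neighbour[of "v (Suc p)" "v p" "v (Suc (Suc p))"] N_up[OF assms] N_down[of "Suc p"] assms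
  by (simp add: v_eq_iff)

text \<open>Eliminating the factor that points backwards between the edge relation and the vertex
  relation leaves a recursion, which telescopes along the path into partial sums of coroots.\<close>

lemma chain_step:
  assumes "Suc (Suc p) < l" "N (v (Suc p)) (v p) = 1"
  shows "fac (v (Suc p)) (v (Suc (Suc p))) c = fac (v p) (v (Suc p)) c - h (v p) c"
  using chain_edge[OF _ N_up[OF assms(1)] assms(2), OF Suc_lessD[OF assms(1)], of c] chain_vertex[OF assms(1), of c]
  by Groebner_Basis.algebra

text \<open>The affine diagrams \<open>A\<^sub>l\<^sup>(\<^sup>1\<^sup>)\<close> and \<open>C\<^sub>l\<^sup>(\<^sup>1\<^sup>)\<close>: the sum of the coroots would vanish.\<close>

lemma no_cycle:
  assumes "l \<ge> 3"
  shows "\<not> adj (v (l - 1)) (v 0)"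
proof
  assume ad: "adj (v (l - 1)) (v 0)"
  obtain n where n: "l = Suc (Suc (Suc n))" using assms by (metis Suc_le_D numeral_3_eq_3 le_Suc_ex add_Suc)
  have 0: "N (v (Suc 0)) (v 0) = 1"
    using adj_Suc[of 0] ad n by (intro N_eq_1[where k = "v (l - 1)"]) (auto simp: v_eq_iff intro: adj_sym)
  have e: "N (v (Suc n)) (v (Suc (Suc n))) = 1"
    using adj_Suc[of "Suc n"] ad n by (intro N_eq_1[where k = "v 0"]) (auto simp: v_eq_iff intro: adj_sym)
  have c1: "N (v 0) (v (Suc (Suc n))) = 1"
    using adj_Suc[of "Suc n"] ad n by (intro N_eq_1[where k = "v (Suc n)"]) (auto simp: v_eq_iff intro: adj_sym)
  have c2: "N (v (Suc (Suc n))) (v 0) = 1"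
    using adj_Suc[of 0] ad n by (intro N_eq_1[where k = "v (Suc 0)"]) (auto simp: v_eq_iff intro: adj_sym)
  have "(\<Sum>p<l. h (v p) c) = 0" for c
  proof -
    have F: "fac (v p) (v (Suc p)) c = fac (v 0) (v (Suc 0)) c - (\<Sum>q<p. h (v q) c)" if "p \<le> Suc n" for p
      using that
    proof (induction p)
      case (Suc p)
      have "N (v (Suc p)) (v p) = 1" using 0 N_down[of p] Suc.prems n by (cases p) auto
      then show ?case using chain_step[of p c] Suc n by simp
    qed simp
    have "fac (v (Suc n)) (v (Suc (Suc n))) c + fac (v (Suc (Suc n))) (v (Suc n)) c
        = h (v (Suc n)) c + h (v (Suc (Suc n))) c + 1"
      using chain_edge[of "Suc n" c] e N_down[of "Suc n"] n by simp
    moreover have "fac (v (Suc (Suc n))) (v (Suc n)) c + fac (v (Suc (Suc n))) (v 0) c = h (v (Suc (Suc n))) c + 1"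
      using fac_other_neighbour[of "v (Suc (Suc n))" "v (Suc n)" "v 0" c] e c1 n by (simp add: v_eq_iff)
    moreover have "fac (v 0) (v (Suc (Suc n))) c + fac (v 0) (v (Suc 0)) c = h (v 0) c + 1"
      using fac_other_neighbour[of "v 0" "v (Suc (Suc n))" "v (Suc 0)" c] c2 0 n by (simp add: v_eq_iff)
    moreover have "fac (v 0) (v (Suc (Suc n))) c + fac (v (Suc (Suc n))) (v 0) c = h (v 0) c + h (v (Suc (Suc n))) c + 1"
      using fac_props(3)[of "v 0" "v (Suc (Suc n))" c] c1 c2 n by (simp add: v_eq_iff)
    moreover have "fac (v (Suc n)) (v (Suc (Suc n))) c = fac (v 0) (v (Suc 0)) c - (\<Sum>q<Suc n. h (v q) c)"
      using F[of "Suc n"] by simp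
    \<comment> \<open>On the way around the cycle all factors cancel, the initial one included, and
      only the coroots remain.\<close>
    ultimately have "(\<Sum>q<Suc n. h (v q) c) + h (v (Suc n)) c + h (v (Suc (Suc n))) c = 0"
      by Groebner_Basis.algebra
    then show ?thesis by (simp add: n)
  qed
  with sum_h_nonzero show False by blast
qed

lemma no_two_long_ends:
  assumes "l \<ge> 3" "N (v 1) (v 0) = 2"
  shows "N (v (l - 2)) (v (l - 1)) \<noteq> 2"
proof
  obtain n where n: "l = Suc (Suc (Suc n))" using assms by (metis Suc_le_D numeral_3_eq_3 le_Suc_ex add_Suc)
  assume "N (v (l - 2)) (v (l - 1)) = 2"
  then have e: "N (v (Suc n)) (v (Suc (Suc n))) = 2" by (simp add: n numeral_2_eq_2)
  have e': "N (v (Suc (Suc n))) (v (Suc n)) = 1" using N_down[of "Suc n"] n by simp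
  have 1: "N (v 0) (v (Suc 0)) = 1" using N_up[of 0] n by simp
  have "(\<Sum>p<l. h (v p) c) = 0" for c
  proof -
    \<comment> \<open>The long root at the first end fixes the initial factor, and the recursion
      carries it to the other end, where the second double edge prescribes a value as well.\<close>
    have F: "fac (v (Suc p)) (v (Suc (Suc p))) c = 1/2 - (\<Sum>q<Suc p. h (v q) c)" if "p \<le> n" for p
      using that
    proof (induction p)
      case 0
      have "fac (v (Suc 0)) (v 0) c = h (v (Suc 0)) c + h (v 0) c + 1/2"
        using fac_props(4)[of "v (Suc 0)" "v 0" c] 1 assms n by (simp add: v_eq_iff)
      moreover have "fac (v (Suc 0)) (v 0) c + fac (v (Suc 0)) (v (Suc (Suc 0))) c = h (v (Suc 0)) c + 1"
        using chain_vertex[of 0 c] n by simp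
      ultimately have "fac (v (Suc 0)) (v (Suc (Suc 0))) c = h (v (Suc 0)) c + 1 - (h (v (Suc 0)) c + h (v 0) c + 1/2)"
        by (metis add_diff_cancel_left')
      then show ?case by simp
    next
      case (Suc p)
      have "N (v (Suc (Suc p))) (v (Suc p)) = 1" using N_down[of "Suc p"] Suc.prems n by simp
      then show ?case using chain_step[of "Suc p" c] Suc n by simp
    qed
    have "fac (v (Suc n)) (v (Suc (Suc n))) c = h (v (Suc n)) c + h (v (Suc (Suc n))) c + 1/2"
      using fac_props(4)[of "v (Suc n)" "v (Suc (Suc n))" c] e e' n by (simp add: v_eq_iff)
    moreover have "fac (v (Suc n)) (v (Suc (Suc n))) c = 1/2 - (\<Sum>q<Suc n. h (v q) c)"
      using F[of n] by simp
    ultimately have "(\<Sum>q<Suc n. h (v q) c) + h (v (Suc n)) c + h (v (Suc (Suc n))) c = 0"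
      by Groebner_Basis.algebra
    then show ?thesis by (simp add: n)
  qed
  with sum_h_nonzero show False by blast
qed

text \<open>An inner vertex already has its two neighbours on the path, so a further edge could only
  join the two ends and close a cycle.\<close>

lemma N_far:
  assumes "a < l" "b < l" "a \<noteq> b" "b \<noteq> Suc a" "a \<noteq> Suc b"
  shows "N (v a) (v b) = 0"
proof -
  have "\<not> adj (v a) (v b)" if "a + 2 \<le> b" "b < l" for a b
  proof
    assume ad: "adj (v a) (v b)"
    have "a = 0"
    proof (rule ccontr)
      assume "a \<noteq> 0"
      then have "v b = v (a - 1) \<or> v b = v (Suc a)"
        using adj_in_simple_path[OF path, of a "v b"] ad that by simp
      then have "b = a - 1 \<or> b = Suc a" using v_eq_iff[of b "a - 1"] v_eq_iff[of b "Suc a"] that by auto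
      then show False using that by auto
    qed
    moreover have "b = l - 1"
    proof (rule ccontr)
      assume "b \<noteq> l - 1"
      then have "v a = v (b - 1) \<or> v a = v (Suc b)"
        using adj_in_simple_path[OF path, of b "v a"] adj_sym[OF ad] that by simp
      then have "a = b - 1 \<or> a = Suc b" using v_eq_iff[of a "b - 1"] v_eq_iff[of a "Suc b"] that \<open>b \<noteq> l - 1\<close> by auto
      then show False using that by auto
    qed
    ultimately show False using no_cycle ad adj_sym that by auto
  qed
  note nadj = this
  have "\<not> adj (v a) (v b)"
  proof (cases "a < b")
    case True
    then show ?thesis using nadj[of a b] assms by simp
  next
    case False
    then show ?thesis using nadj[of b a] adj_sym assms by force
  qed
  then show ?thesis using assms by (auto simp: adj_def v_eq_iff)
qed

lemma bij_v_1: "bij_betw (\<lambda>p. v (p - 1)) {1..l} UNIV"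
proof -
  have "bij_betw (\<lambda>p. p - 1) {1..l} {..<l}"
    by (rule bij_betw_byWitness[where f' = Suc]) auto
  from bij_betw_trans[OF this bij_v] show ?thesis by (simp add: comp_def)
qed

lemma A_v:
  assumes "a < l" "b < l"
  shows "A $ v a $ v b = (if a = b then 2 else if b = Suc a \<or> a = Suc b then - int (N (v a) (v b)) else 0)"
proof -
  have "A $ v a $ v b = - int (N (v a) (v b))" if "a \<noteq> b"
    using assms A_N[of "v a" "v b"] that by (simp add: v_eq_iff)
  then show ?thesis using assms N_far[of a b] by (simp add: A_diag)
qed

lemma N_consecutive:
  assumes "a < l" "b < l" "b = Suc a \<or> a = Suc b"
  shows "N (v a) (v b) = 1 \<or> N (v a) (v b) = 2"
proof -
  have "adj (v a) (v b)" using assms adj_Suc adj_sym by blast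
  then show ?thesis using N_cases[of "v a" "v b"] by (metis adj_def)
qed

lemma type_A_if:
  assumes "\<And>a b. a < l \<Longrightarrow> b < l \<Longrightarrow> b = Suc a \<or> a = Suc b \<Longrightarrow> N (v a) (v b) = 1"
  shows "type_A l A"
  unfolding type_A_def matrix_of_type_def
proof (intro exI conjI ballI)
  fix i j assume ij: "i \<in> {1..l}" "j \<in> {1..l}"
  then have e: "i - 1 = j - 1 \<longleftrightarrow> i = j" "j - 1 = Suc (i - 1) \<longleftrightarrow> j = i + 1" "i - 1 = Suc (j - 1) \<longleftrightarrow> i = j + 1"
    and l: "i - 1 < l" "j - 1 < l" by auto
  show "A $ v (i - 1) $ v (j - 1) = cartan_A i j"
    unfolding A_v[OF l] e cartan_A_def using assms[OF l, unfolded e] by simp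
qed (rule bij_v_1)

lemma type_C_if:
  assumes "l \<ge> 2" "N (v (l - 2)) (v (l - 1)) = 2"
    and "\<And>a b. a < l \<Longrightarrow> b < l \<Longrightarrow> b = Suc a \<or> a = Suc b \<Longrightarrow> \<not> (a = l - 2 \<and> b = l - 1) \<Longrightarrow> N (v a) (v b) = 1"
  shows "type_C l A"
  unfolding type_C_def matrix_of_type_def
proof (intro exI conjI ballI)
  fix i j assume ij: "i \<in> {1..l}" "j \<in> {1..l}"
  show "A $ v (i - 1) $ v (j - 1) = cartan_C l i j"
  proof (cases "i + 1 = l \<and> j = l")
    case True
    then have "i - 1 = l - 2" "j - 1 = l - 1" using ij by auto
    then show ?thesis using True assms(1,2) by (subst A_v) (use ij in \<open>auto simp: cartan_C_def\<close>)
  next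
    case False
    then have n: "\<not> (i - 1 = l - 2 \<and> j - 1 = l - 1)" using ij assms(1) by auto
    have e: "i - 1 = j - 1 \<longleftrightarrow> i = j" "j - 1 = Suc (i - 1) \<longleftrightarrow> j = i + 1" "i - 1 = Suc (j - 1) \<longleftrightarrow> i = j + 1"
      and l: "i - 1 < l" "j - 1 < l" using ij by auto
    have "N (v (i - 1)) (v (j - 1)) = 1" if "j = i + 1 \<or> i = j + 1"
      using assms(3)[OF l _ n] that unfolding e .
    then show ?thesis unfolding A_v[OF l] e cartan_C_def cartan_A_def using False by auto
  qed
qed (rule bij_v_1)

end

lemma simple_path_rev: "simple_path vs \<Longrightarrow> simple_path (rev vs)"
  unfolding simple_path_def
proof (intro conjI allI impI; elim conjE)
  fix p assume *: "distinct vs" "\<forall>p. Suc p < length vs \<longrightarrow> adj (vs ! p) (vs ! Suc p)" "Suc p < length (rev vs)"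
  then have "adj (vs ! (length vs - Suc (Suc p))) (vs ! Suc (length vs - Suc (Suc p)))" by simp
  moreover have "Suc (length vs - Suc (Suc p)) = length vs - Suc p" using * by simp
  ultimately show "adj (rev vs ! p) (rev vs ! Suc p)"
    using *(3) by (simp add: rev_nth adj_sym)
qed simp

text \<open>An edge that is not simple must lie at an end of the path with its long root outermost,
  and not at both ends. Reversing the path if necessary puts the long root last, as
  \<open>cartan_C\<close> requires.\<close>

theorem type_A_or_C: "(\<exists>l\<ge>1. type_A l A) \<or> (\<exists>l\<ge>2. type_C l A)"
proof -
  obtain vs where vs: "simple_path vs" "set vs = UNIV" using spanning_simple_path by blast
  then have l1: "length vs \<ge> 1" by (metis One_nat_def Suc_leI UNIV_not_empty length_greater_0_conv set_empty)
  have C: "type_C (length ws) A"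
    if ws: "simple_path ws" "set ws = UNIV" "length ws \<ge> 2"
      and long: "N (ws ! (length ws - 2)) (ws ! (length ws - 1)) = 2" for ws
  proof (rule type_C_if[OF ws(1,2,3) long])
    fix a b assume ab: "a < length ws" "b < length ws" "b = Suc a \<or> a = Suc b" "\<not> (a = length ws - 2 \<and> b = length ws - 1)"
    from ab(3) show "N (ws ! a) (ws ! b) = 1"
    proof
      assume b: "b = Suc a"
      then have "Suc (Suc a) < length ws" using ab by linarith
      then show ?thesis using N_up[OF ws(1,2)] b by simp
    next
      assume a: "a = Suc b"
      show ?thesis
      proof (cases "b = 0")
        case False
        then show ?thesis using N_down[OF ws(1,2), of b] a ab by simp
      next
        case True
        show ?thesis
        proof (rule ccontr)
          assume "N (ws ! a) (ws ! b) \<noteq> 1"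
          then have 2: "N (ws ! a) (ws ! b) = 2" using N_consecutive[OF ws(1,2) ab(1-3)] by simp
          show False
          proof (cases "length ws = 2")
            \<comment> \<open>With two vertices both ends share the single edge, so the excluded
              diagram is the affine edge with two entries -2.\<close>
            case True
            then have "N (ws ! b) (ws ! a) = 2" using long a \<open>b = 0\<close> by simp
            then show False using 2 N_not_2_2[of "ws ! a" "ws ! b"] v_eq_iff[OF ws(1,2) ab(1,2)] a by simp
          next
            case False
            then have "length ws \<ge> 3" using ws(3) by simp
            then show False using no_two_long_ends[OF ws(1,2)] 2 a True long by simp
          qed
        qed
      qed
    qed
  qed
  show ?thesis
  proof (cases "\<forall>a b. a < length vs \<longrightarrow> b < length vs \<longrightarrow> b = Suc a \<or> a = Suc b \<longrightarrow> N (vs ! a) (vs ! b) = 1")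
    case True
    then show ?thesis using type_A_if[OF vs] l1 by blast
  next
    case False
    then obtain a b where ab: "a < length vs" "b < length vs" "b = Suc a \<or> a = Suc b" "N (vs ! a) (vs ! b) \<noteq> 1"
      by blast
    then have 2: "N (vs ! a) (vs ! b) = 2" using N_consecutive[OF vs ab(1-3)] by simp
    have l2: "length vs \<ge> 2" using ab by linarith
    from ab(3) show ?thesis
    proof
      assume b: "b = Suc a"
      then have "\<not> Suc (Suc a) < length vs" using N_up[OF vs] ab(4) by blast
      then have "a = length vs - 2" "b = length vs - 1" using b ab by auto
      then show ?thesis using C[OF vs l2] 2 l2 by blast
    next
      assume a: "a = Suc b"
      then have b: "b = 0" using N_down[OF vs, of b] ab by auto
      have "rev vs ! (length (rev vs) - 2) = vs ! a" "rev vs ! (length (rev vs) - 1) = vs ! b"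
        using a b l2 by (simp_all add: rev_nth Suc_diff_Suc numeral_2_eq_2)
      then show ?thesis using C[of "rev vs"] simple_path_rev[OF vs(1)] vs(2) l2 2 by auto
    qed
  qed
qed

end

section \<open>Congruence of terms\<close>

lemmas alg_cong_trans [trans] = alg_cong.trans

text \<open>Products count as atoms here, so that \<open>linI\<close> decides the linear identities between terms.\<close>

primrec coef :: "'x alg_term \<Rightarrow> 'x alg_term \<Rightarrow> complex" where
  "coef (Gen g) a = (if a = Gen g then 1 else 0)"
| "coef Zero a = 0"
| "coef (Add s t) a = coef s a + coef t a"
| "coef (Scale c s) a = c * coef s a"
| "coef (Prod s t) a = (if a = Prod s t then 1 else 0)"

primrec atoms :: "'x alg_term \<Rightarrow> 'x alg_term list" where
  "atoms (Gen g) = [Gen g]"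
| "atoms Zero = []"
| "atoms (Add s t) = atoms s @ atoms t"
| "atoms (Scale c s) = atoms s"
| "atoms (Prod s t) = [Prod s t]"

primrec lincomb :: "('x alg_term \<Rightarrow> complex) \<Rightarrow> 'x alg_term list \<Rightarrow> 'x alg_term" where
  "lincomb f [] = Zero"
| "lincomb f (a # as) = Add (Scale (f a) a) (lincomb f as)"

context
  fixes R :: "('x alg_term \<times> 'x alg_term) set"
begin

abbreviation ac (infix "\<doteq>" 50) where "s \<doteq> t \<equiv> alg_cong R s t"

lemma Add_Zero_right: "Add s Zero \<doteq> s"
  using alg_cong.Add_comm alg_cong.Add_Zero alg_cong.trans by blast

lemma Scale_0: "Scale 0 s \<doteq> Zero"
proof -
  have "Scale 0 s \<doteq> Add (Scale (-1) s) (Scale 1 s)"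
    using alg_cong.Scale_plus[of R "-1" 1 s] by simp
  also have "\<dots> \<doteq> Add (Scale (-1) s) s" by (intro alg_cong.cong_Add alg_cong.refl alg_cong.Scale_one)
  also have "\<dots> \<doteq> Zero" by (rule alg_cong.Add_neg)
  finally show ?thesis .
qed

lemma Scale_Zero: "Scale c Zero \<doteq> Zero"
proof -
  have "Scale c Zero \<doteq> Scale c (Scale 0 Zero)" by (intro alg_cong.cong_Scale alg_cong.sym[OF Scale_0])
  also have "\<dots> \<doteq> Scale 0 Zero" using alg_cong.Scale_Scale[of R c 0 Zero] by simp
  also have "\<dots> \<doteq> Zero" by (rule Scale_0)
  finally show ?thesis .
qed

lemma Prod_Zero_left: "Prod Zero s \<doteq> Zero"
proof -
  have "Prod Zero s \<doteq> Prod (Scale 0 Zero) s" by (intro alg_cong.cong_Prod alg_cong.refl alg_cong.sym[OF Scale_0])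
  also have "\<dots> \<doteq> Scale 0 (Prod Zero s)" by (rule alg_cong.Prod_Scale_left)
  also have "\<dots> \<doteq> Zero" by (rule Scale_0)
  finally show ?thesis .
qed

lemma Prod_Zero_right: "Prod s Zero \<doteq> Zero"
proof -
  have "Prod s Zero \<doteq> Prod s (Scale 0 Zero)" by (intro alg_cong.cong_Prod alg_cong.refl alg_cong.sym[OF Scale_0])
  also have "\<dots> \<doteq> Scale 0 (Prod s Zero)" by (rule alg_cong.Prod_Scale_right)
  also have "\<dots> \<doteq> Zero" by (rule Scale_0)
  finally show ?thesis .
qed

lemma lincomb_zero: "(\<And>a. a \<in> set as \<Longrightarrow> f a = 0) \<Longrightarrow> lincomb f as \<doteq> Zero"
proof (induction as)
  case (Cons a as)
  have "lincomb f (a # as) \<doteq> Add Zero Zero"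
    using Cons Scale_0[of a] by (auto intro!: alg_cong.cong_Add)
  then show ?case using alg_cong.Add_Zero alg_cong.trans by blast
qed (simp add: alg_cong.refl)

lemma Add_interchange: "Add (Add s t) (Add u v) \<doteq> Add (Add s u) (Add t v)"
proof -
  have "Add (Add s t) (Add u v) \<doteq> Add s (Add t (Add u v))" by (rule alg_cong.Add_assoc)
  also have "\<dots> \<doteq> Add s (Add (Add t u) v)"
    by (intro alg_cong.cong_Add alg_cong.refl alg_cong.sym[OF alg_cong.Add_assoc])
  also have "\<dots> \<doteq> Add s (Add (Add u t) v)"
    by (intro alg_cong.cong_Add alg_cong.refl alg_cong.Add_comm)
  also have "\<dots> \<doteq> Add s (Add u (Add t v))" by (intro alg_cong.cong_Add alg_cong.refl alg_cong.Add_assoc)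
  also have "\<dots> \<doteq> Add (Add s u) (Add t v)" by (rule alg_cong.sym[OF alg_cong.Add_assoc])
  finally show ?thesis .
qed

lemma lincomb_add: "lincomb (\<lambda>a. f a + g a) as \<doteq> Add (lincomb f as) (lincomb g as)"
proof (induction as)
  case (Cons a as)
  have "lincomb (\<lambda>a. f a + g a) (a # as)
      \<doteq> Add (Add (Scale (f a) a) (Scale (g a) a)) (Add (lincomb f as) (lincomb g as))"
    using Cons by (auto intro!: alg_cong.cong_Add alg_cong.Scale_plus)
  also have "\<dots> \<doteq> Add (lincomb f (a # as)) (lincomb g (a # as))" by (simp add: Add_interchange)
  finally show ?case .
qed (simp add: alg_cong.sym[OF alg_cong.Add_Zero])

lemma lincomb_scale: "lincomb (\<lambda>a. c * f a) as \<doteq> Scale c (lincomb f as)"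
proof (induction as)
  case (Cons a as)
  have "lincomb (\<lambda>a. c * f a) (a # as) \<doteq> Add (Scale c (Scale (f a) a)) (Scale c (lincomb f as))"
    using Cons by (auto intro!: alg_cong.cong_Add alg_cong.sym[OF alg_cong.Scale_Scale])
  also have "\<dots> \<doteq> Scale c (lincomb f (a # as))" by (simp add: alg_cong.sym[OF alg_cong.Scale_Add])
  finally show ?case .
qed (simp add: alg_cong.sym[OF Scale_Zero])

lemma lincomb_single:
  "distinct as \<Longrightarrow> b \<in> set as \<Longrightarrow> lincomb (\<lambda>a. if a = b then 1 else 0) as \<doteq> b"
proof (induction as)
  case (Cons a as)
  show ?case
  proof (cases "a = b")
    case True
    have "lincomb (\<lambda>a. if a = b then 1 else 0) as \<doteq> Zero" using Cons.prems True by (intro lincomb_zero) auto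
    then have "lincomb (\<lambda>a. if a = b then 1 else 0) (a # as) \<doteq> Add b Zero"
      using True by (auto intro!: alg_cong.cong_Add alg_cong.Scale_one)
    also have "\<dots> \<doteq> b" by (rule Add_Zero_right)
    finally show ?thesis .
  next
    case False
    then have "lincomb (\<lambda>a. if a = b then 1 else 0) (a # as) \<doteq> Add Zero b"
      using Cons by (auto intro!: alg_cong.cong_Add Scale_0)
    also have "\<dots> \<doteq> b" by (rule alg_cong.Add_Zero)
    finally show ?thesis .
  qed
qed simp

lemma lincomb_coef: "distinct as \<Longrightarrow> set (atoms s) \<subseteq> set as \<Longrightarrow> lincomb (coef s) as \<doteq> s"
proof (induction s)
  case (Gen g)
  then show ?case using lincomb_single[of as "Gen g"] by (simp add: coef.simps(1)[abs_def])
next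
  case Zero
  then show ?case by (auto intro!: lincomb_zero)
next
  case (Add s t)
  then have "Add (lincomb (coef s) as) (lincomb (coef t) as) \<doteq> Add s t" by (auto intro!: alg_cong.cong_Add)
  moreover have "lincomb (coef (Add s t)) as \<doteq> Add (lincomb (coef s) as) (lincomb (coef t) as)"
    using lincomb_add[of "coef s" "coef t" as] by (simp add: coef.simps(3)[abs_def])
  ultimately show ?case using alg_cong.trans by blast
next
  case (Scale c s)
  then have "Scale c (lincomb (coef s) as) \<doteq> Scale c s" by (auto intro!: alg_cong.cong_Scale)
  moreover have "lincomb (coef (Scale c s)) as \<doteq> Scale c (lincomb (coef s) as)"
    using lincomb_scale[of c "coef s" as] by (simp add: coef.simps(4)[abs_def])
  ultimately show ?case using alg_cong.trans by blast
next
  case (Prod s t)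
  then show ?case using lincomb_single[of as "Prod s t"] by (simp add: coef.simps(5)[abs_def])
qed

lemma linI:
  assumes "\<And>a. coef s a = coef t a"
  shows "s \<doteq> t"
proof -
  let ?as = "remdups (atoms s @ atoms t)"
  have "coef s = coef t" using assms by blast
  then have "s \<doteq> lincomb (coef t) ?as" using lincomb_coef[of ?as s] alg_cong.sym by fastforce
  also have "\<dots> \<doteq> t" by (rule lincomb_coef) auto
  finally show ?thesis .
qed

lemma diff_Zero_iff: "Add s (Scale (-1) t) \<doteq> Zero \<longleftrightarrow> s \<doteq> t"
proof
  assume a: "Add s (Scale (-1) t) \<doteq> Zero"
  have "s \<doteq> Add (Add s (Scale (-1) t)) t" by (rule linI) simp
  also have "\<dots> \<doteq> Add Zero t" by (intro alg_cong.cong_Add a alg_cong.refl)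
  also have "\<dots> \<doteq> t" by (rule alg_cong.Add_Zero)
  finally show "s \<doteq> t" .
next
  assume a: "s \<doteq> t"
  have "Add s (Scale (-1) t) \<doteq> Add t (Scale (-1) t)" by (intro alg_cong.cong_Add a alg_cong.refl)
  also have "\<dots> \<doteq> Zero" by (rule linI) simp
  finally show "Add s (Scale (-1) t) \<doteq> Zero" .
qed

end

section \<open>Grading of the algebra of generators and relations\<close>

text \<open>The sign is a boolean so that statements about the \<open>E i\<close> and the
  \<open>F i\<close> can be made and proved once; \<open>True\<close> stands for
  \<open>E\<close>.\<close>

definition sg :: "bool \<Rightarrow> int" where "sg e = (if e then 1 else -1)"

lemma sg_simps [simp]: "sg True = 1" "sg False = -1" "sg (\<not> e) = - sg e" "sg e \<noteq> 0" "sg e * sg e = 1"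
  by (simp_all add: sg_def)

definition cone :: "bool \<Rightarrow> ('n \<Rightarrow> int) \<Rightarrow> bool" where
  "cone e d \<longleftrightarrow> (\<forall>j. sg e * d j \<ge> 0) \<and> (\<exists>j. d j \<noteq> 0)"

definition root_gen :: "bool \<Rightarrow> 'n \<Rightarrow> ('h, 'n) km_gen alg_term" where
  "root_gen e i = Gen (if e then E i else F i)"

locale kac_moody =
  fixes A :: "int ^ 'n ^ 'n" and sc :: "complex \<Rightarrow> 'h::ab_group_add \<Rightarrow> 'h"
    and \<alpha> :: "'n::finite \<Rightarrow> 'h \<Rightarrow> complex" and \<alpha>v :: "'n \<Rightarrow> 'h"
  assumes realization: "realization A sc \<alpha> \<alpha>v"
begin

sublocale V: vector_space sc using realization by (simp add: realization_def)

definition "km_rel = lie_relations \<union> km_relations sc \<alpha> \<alpha>v"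

abbreviation kmc (infix "\<doteq>" 50) where "s \<doteq> t \<equiv> alg_cong km_rel s t"

lemma \<alpha>_linear: "Vector_Spaces.linear sc (*) (\<alpha> i)"
  and \<alpha>_indep: "(\<And>x. (\<Sum>i\<in>UNIV. c i * \<alpha> i x) = 0) \<Longrightarrow> c i = 0"
  and \<alpha>v_indep: "(\<Sum>i\<in>UNIV. sc (c i) (\<alpha>v i)) = 0 \<Longrightarrow> c i = 0"
  and \<alpha>_\<alpha>v: "\<alpha> j (\<alpha>v i) = of_int (A $ i $ j)"
  using realization unfolding realization_def by blast+

lemma rel_Prod_self: "Prod s s \<doteq> Zero"
  by (rule alg_cong.rel) (auto simp: km_rel_def lie_relations_def)

lemma rel_jacobi: "Add (Add (Prod s (Prod t u)) (Prod t (Prod u s))) (Prod u (Prod s t)) \<doteq> Zero"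
  by (rule alg_cong.rel) (auto simp: km_rel_def lie_relations_def)

lemma rel_H_add: "Gen (H (x + y)) \<doteq> Add (Gen (H x)) (Gen (H y))"
  by (rule alg_cong.rel) (auto simp: km_rel_def km_relations_def)

lemma rel_H_scale: "Gen (H (sc c x)) \<doteq> Scale c (Gen (H x))"
  by (rule alg_cong.rel) (auto simp: km_rel_def km_relations_def)

lemma rel_HH: "Prod (Gen (H x)) (Gen (H y)) \<doteq> Zero"
  by (rule alg_cong.rel) (auto simp: km_rel_def km_relations_def)

lemma rel_EF: "Prod (Gen (E i)) (Gen (F j)) \<doteq> (if i = j then Gen (H (\<alpha>v i)) else Zero)"
  by (rule alg_cong.rel) (auto simp: km_rel_def km_relations_def)

lemma rel_HX: "Prod (Gen (H x)) (root_gen e i) \<doteq> Scale (of_int (sg e) * \<alpha> i x) (root_gen e i)"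
  by (rule alg_cong.rel) (auto simp: km_rel_def km_relations_def root_gen_def)

lemma Prod_antisym: "Prod s t \<doteq> Scale (-1) (Prod t s)"
proof -
  have "Prod (Add s t) (Add s t) \<doteq> Add (Prod s (Add s t)) (Prod t (Add s t))" by (rule alg_cong.Prod_Add_left)
  also have "\<dots> \<doteq> Add (Add (Prod s s) (Prod s t)) (Add (Prod t s) (Prod t t))"
    by (intro alg_cong.cong_Add alg_cong.Prod_Add_right)
  also have "\<dots> \<doteq> Add (Add Zero (Prod s t)) (Add (Prod t s) Zero)"
    by (intro alg_cong.cong_Add alg_cong.refl rel_Prod_self)
  also have "\<dots> \<doteq> Add (Prod s t) (Scale (-1) (Scale (-1) (Prod t s)))" by (rule linI) simp
  finally have "Add (Prod s t) (Scale (-1) (Scale (-1) (Prod t s))) \<doteq> Zero"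
    using rel_Prod_self[of "Add s t"] alg_cong.sym alg_cong.trans by blast
  then show ?thesis by (simp only: diff_Zero_iff)
qed

lemma leibniz: "Prod s (Prod t u) \<doteq> Add (Prod (Prod s t) u) (Prod t (Prod s u))"
proof -
  have 1: "Prod t (Prod u s) \<doteq> Scale (-1) (Prod t (Prod s u))"
  proof -
    have "Prod t (Prod u s) \<doteq> Prod t (Scale (-1) (Prod s u))"
      by (intro alg_cong.cong_Prod alg_cong.refl Prod_antisym)
    also have "\<dots> \<doteq> Scale (-1) (Prod t (Prod s u))" by (rule alg_cong.Prod_Scale_right)
    finally show ?thesis .
  qed
  have "Add (Prod s (Prod t u)) (Scale (-1) (Add (Prod (Prod s t) u) (Prod t (Prod s u))))
      \<doteq> Add (Add (Prod s (Prod t u)) (Scale (-1) (Prod t (Prod s u)))) (Scale (-1) (Prod (Prod s t) u))"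
    by (rule linI) simp
  also have "\<dots> \<doteq> Add (Add (Prod s (Prod t u)) (Prod t (Prod u s))) (Prod u (Prod s t))"
    by (intro alg_cong.cong_Add alg_cong.refl alg_cong.sym[OF 1] alg_cong.sym[OF Prod_antisym])
  also have "\<dots> \<doteq> Zero" by (rule rel_jacobi)
  finally show ?thesis by (simp only: diff_Zero_iff)
qed

lemma rel_XX: "Prod (root_gen e i) (root_gen (\<not> e) j)
    \<doteq> (if i = j then Scale (of_int (sg e)) (Gen (H (\<alpha>v i))) else Zero)"
proof (cases e)
  case True
  have "(if i = j then Gen (H (\<alpha>v i)) else Zero) \<doteq> (if i = j then Scale 1 (Gen (H (\<alpha>v i))) else Zero)"
    by (rule linI) simp
  then show ?thesis using True rel_EF[of i j] alg_cong.trans by (fastforce simp: root_gen_def)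
next
  case False
  have "Prod (root_gen e i) (root_gen (\<not> e) j) \<doteq> Scale (-1) (Prod (Gen (E j)) (Gen (F i)))"
    using False Prod_antisym by (simp add: root_gen_def)
  also have "\<dots> \<doteq> Scale (-1) (if j = i then Gen (H (\<alpha>v j)) else Zero)"
    by (intro alg_cong.cong_Scale rel_EF)
  also have "\<dots> \<doteq> (if i = j then Scale (of_int (sg e)) (Gen (H (\<alpha>v i))) else Zero)"
    by (rule linI) (simp add: False)
  finally show ?thesis .
qed

lemma H_zero: "Gen (H 0) \<doteq> Zero"
  using rel_H_scale[of 0 0] Scale_0 alg_cong.trans by fastforce

definition wt :: "('n \<Rightarrow> int) \<Rightarrow> 'h \<Rightarrow> complex" where
  "wt d x = (\<Sum>i\<in>UNIV. of_int (d i) * \<alpha> i x)"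

lemma wt_zero: "wt (\<lambda>_. 0) x = 0"
  by (simp add: wt_def)

lemma wt_upd: "wt (d(i := d i + k)) x = wt d x + of_int k * \<alpha> i x"
proof -
  have "wt (d(i := d i + k)) x = (\<Sum>j\<in>UNIV. of_int (d j) * \<alpha> j x + (if j = i then of_int k * \<alpha> j x else 0))"
    unfolding wt_def by (rule sum.cong) (auto simp: algebra_simps)
  then show ?thesis by (simp add: sum.distrib wt_def)
qed

text \<open>Here the independence of the simple roots enters: degrees in the root lattice can be
  told apart by eigenvalues of \<open>ad h\<close>, on which the splitting of ideals into components
  rests.\<close>

lemma wt_separates:
  assumes "d \<noteq> d'" shows "\<exists>x. wt d x \<noteq> wt d' x"
proof (rule ccontr)
  assume "\<not> ?thesis"
  then have "(\<Sum>i\<in>UNIV. of_int (d i - d' i) * \<alpha> i x) = 0" for x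
    by (simp add: wt_def left_diff_distrib sum_subtractf)
  then have "of_int (d i - d' i) = (0 :: complex)" for i by (rule \<alpha>_indep)
  then have "d = d'" by (simp add: fun_eq_iff)
  with assms show False by blast
qed

text \<open>\<open>gr_P\<close> prolongs an element only by a generator of its own sign, so the
  rules build the positive part, the Cartan part and the negative part separately. This makes the
  component of degree zero visible in \<open>gr_zero\<close>; closure under all generators is then
  the triangular decomposition, proved in \<open>gr_X_closed\<close>.\<close>

inductive gr :: "('n \<Rightarrow> int) \<Rightarrow> ('h, 'n) km_gen alg_term \<Rightarrow> bool" where
  gr_H: "gr (\<lambda>_. 0) (Gen (H x))"
| gr_X: "gr ((\<lambda>_. 0)(i := sg e)) (root_gen e i)"
| gr_P: "gr d t \<Longrightarrow> cone e d \<Longrightarrow> gr (d(i := d i + sg e)) (Prod (root_gen e i) t)"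
| gr_Zero: "gr d Zero"
| gr_Add: "gr d s \<Longrightarrow> gr d t \<Longrightarrow> gr d (Add s t)"
| gr_Scale: "gr d s \<Longrightarrow> gr d (Scale c s)"
| gr_cong: "gr d s \<Longrightarrow> s \<doteq> t \<Longrightarrow> gr d t"

lemma gr_wt: "gr d t \<Longrightarrow> Prod (Gen (H x)) t \<doteq> Scale (wt d x) t"
proof (induction rule: gr.induct)
  case (gr_H y)
  have "Zero \<doteq> Scale (wt (\<lambda>_. 0) x) (Gen (H y))" by (rule linI) (simp add: wt_zero)
  with rel_HH show ?case by (rule alg_cong.trans)
next
  case (gr_X i e)
  have w: "wt ((\<lambda>_. 0)(i := sg e)) x = of_int (sg e) * \<alpha> i x"
    using wt_upd[of "\<lambda>_. 0" i "sg e" x] by (simp add: wt_zero)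
  show ?case unfolding w by (rule rel_HX)
next
  case (gr_P d t e i)
  have "Prod (Gen (H x)) (Prod (root_gen e i) t)
      \<doteq> Add (Prod (Prod (Gen (H x)) (root_gen e i)) t) (Prod (root_gen e i) (Prod (Gen (H x)) t))"
    by (rule leibniz)
  also have "\<dots> \<doteq> Add (Prod (Scale (of_int (sg e) * \<alpha> i x) (root_gen e i)) t) (Prod (root_gen e i) (Scale (wt d x) t))"
    by (intro alg_cong.cong_Add alg_cong.cong_Prod alg_cong.refl rel_HX gr_P.IH)
  also have "\<dots> \<doteq> Add (Scale (of_int (sg e) * \<alpha> i x) (Prod (root_gen e i) t)) (Scale (wt d x) (Prod (root_gen e i) t))"
    by (intro alg_cong.cong_Add alg_cong.Prod_Scale_left alg_cong.Prod_Scale_right)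
  also have "\<dots> \<doteq> Scale (wt (d(i := d i + sg e)) x) (Prod (root_gen e i) t)"
    by (rule linI) (simp add: wt_upd)
  finally show ?case .
next
  case (gr_Zero d)
  have "Zero \<doteq> Scale (wt d x) Zero" by (rule linI) simp
  with Prod_Zero_right show ?case by (rule alg_cong.trans)
next
  case (gr_Add d s t)
  have "Prod (Gen (H x)) (Add s t) \<doteq> Add (Prod (Gen (H x)) s) (Prod (Gen (H x)) t)" by (rule alg_cong.Prod_Add_right)
  also have "\<dots> \<doteq> Add (Scale (wt d x) s) (Scale (wt d x) t)" by (intro alg_cong.cong_Add gr_Add.IH)
  also have "\<dots> \<doteq> Scale (wt d x) (Add s t)" by (rule alg_cong.sym[OF alg_cong.Scale_Add])
  finally show ?case .
next
  case (gr_Scale d s c)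
  have "Prod (Gen (H x)) (Scale c s) \<doteq> Scale c (Prod (Gen (H x)) s)" by (rule alg_cong.Prod_Scale_right)
  also have "\<dots> \<doteq> Scale c (Scale (wt d x) s)" by (intro alg_cong.cong_Scale gr_Scale.IH)
  also have "\<dots> \<doteq> Scale (wt d x) (Scale c s)" by (rule linI) simp
  finally show ?case .
next
  case (gr_cong d s t)
  have "Prod (Gen (H x)) t \<doteq> Prod (Gen (H x)) s" by (intro alg_cong.cong_Prod alg_cong.refl alg_cong.sym[OF gr_cong.hyps(2)])
  also have "\<dots> \<doteq> Scale (wt d x) s" by (rule gr_cong.IH)
  also have "\<dots> \<doteq> Scale (wt d x) t" by (intro alg_cong.cong_Scale gr_cong.hyps(2))
  finally show ?case .
qed

lemma cone_upd: "cone e d \<Longrightarrow> cone e (d(i := d i + sg e))"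
  unfolding cone_def
proof (intro conjI allI; elim conjE)
  assume a: "\<forall>j. 0 \<le> sg e * d j" "\<exists>j. d j \<noteq> 0"
  show "0 \<le> sg e * (d(i := d i + sg e)) j" for j
    using a(1)[rule_format, of j] by (auto simp: distrib_left)
  have "sg e * d i \<ge> 0" using a by blast
  then have "(d(i := d i + sg e)) i \<noteq> 0" by (cases e) auto
  then show "\<exists>j. (d(i := d i + sg e)) j \<noteq> 0" by blast
qed

lemma cone_unit: "cone e ((\<lambda>_. 0)(i := sg e))"
  by (simp add: cone_def exI[of _ i])

lemma gr_cone: "gr d t \<Longrightarrow> d = (\<lambda>_. 0) \<or> (\<exists>e. cone e d) \<or> t \<doteq> Zero"
proof (induction rule: gr.induct)
  case (gr_Add d s t)
  have "Add s t \<doteq> Zero" if "s \<doteq> Zero" "t \<doteq> Zero"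
    using that alg_cong.cong_Add[OF that] alg_cong.Add_Zero alg_cong.trans by blast
  with gr_Add show ?case by blast
next
  case (gr_Scale d s c)
  have "Scale c s \<doteq> Zero" if "s \<doteq> Zero"
    using alg_cong.cong_Scale[OF that] Scale_Zero alg_cong.trans by blast
  with gr_Scale show ?case by blast
next
  case (gr_cong d s t)
  then show ?case using alg_cong.sym alg_cong.trans by blast
next
  case (gr_X i e)
  show ?case by (intro disjI2 disjI1 exI[of _ e] cone_unit)
next
  case (gr_P d t e i)
  show ?case by (intro disjI2 disjI1 exI[of _ e] cone_upd gr_P.hyps)
qed (simp_all add: alg_cong.refl)

lemma gr_zero: "gr d t \<Longrightarrow> d = (\<lambda>_. 0) \<Longrightarrow> \<exists>x. t \<doteq> Gen (H x)"
proof (induction rule: gr.induct)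
  case (gr_X i e)
  then show ?case by (auto dest: fun_cong[where x = i])
next
  case (gr_P d t e i)
  have "cone e (\<lambda>_::'n. 0)" using cone_upd[OF gr_P.hyps(2), of i] unfolding gr_P.prems .
  then show ?case by (simp add: cone_def)
next
  case (gr_Add d s t)
  then obtain x y where "s \<doteq> Gen (H x)" "t \<doteq> Gen (H y)" by blast
  then have "Add s t \<doteq> Add (Gen (H x)) (Gen (H y))" by (rule alg_cong.cong_Add)
  then show ?case using alg_cong.sym[OF rel_H_add] alg_cong.trans by blast
next
  case (gr_Scale d s c)
  then obtain x where "s \<doteq> Gen (H x)" by blast
  then have "Scale c s \<doteq> Scale c (Gen (H x))" by (rule alg_cong.cong_Scale)
  then show ?case using alg_cong.sym[OF rel_H_scale] alg_cong.trans by blast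
next
  case (gr_cong d s t)
  then show ?case using alg_cong.sym alg_cong.trans by blast
next
  case (gr_Zero d)
  then show ?case using alg_cong.sym[OF H_zero] by blast
qed (blast intro: alg_cong.refl)

text \<open>The case with content is a generator of sign opposite to the outermost one. By the
  Leibniz rule it passes inwards; the commutator of the two generators is zero or lies in the Cartan
  part, which acts by a weight, and the remaining term is covered by the induction hypothesis and
  its degree.\<close>

lemma gr_X_closed: "gr d t \<Longrightarrow> gr (d(i := d i + sg e)) (Prod (root_gen e i) t)"
proof (induction rule: gr.induct)
  case (gr_H x)
  have "Scale (- (of_int (sg e) * \<alpha> i x)) (root_gen e i) \<doteq> Scale (-1) (Scale (of_int (sg e) * \<alpha> i x) (root_gen e i))"
    by (rule linI) simp
  also have "\<dots> \<doteq> Scale (-1) (Prod (Gen (H x)) (root_gen e i))"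
    by (intro alg_cong.cong_Scale alg_cong.sym[OF rel_HX])
  also have "\<dots> \<doteq> Prod (root_gen e i) (Gen (H x))" by (rule alg_cong.sym[OF Prod_antisym])
  finally show ?case using gr_cong[OF gr_Scale[OF gr_X]] by (simp only: add_0)
next
  case (gr_X j e')
  show ?case
  proof (cases "e' = e")
    case True
    show ?thesis unfolding True by (rule gr.gr_P[OF gr.gr_X cone_unit])
  next
    case False
    then have e': "e' = (\<not> e)" by blast
    have "gr (((\<lambda>_. 0)(j := sg e'))(i := ((\<lambda>_. 0)(j := sg e')) i + sg e))
        (if i = j then Scale (of_int (sg e)) (Gen (H (\<alpha>v i))) else Zero)"
    proof (cases "i = j")
      case True
      then have "((\<lambda>_. 0)(j := sg e'))(i := ((\<lambda>_. 0)(j := sg e')) i + sg e) = (\<lambda>_. 0)" using e' by auto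
      then show ?thesis using True gr_Scale[OF gr_H] by simp
    qed (simp add: gr_Zero)
    then show ?thesis using gr_cong alg_cong.sym[OF rel_XX] unfolding e' by blast
  qed
next
  case (gr_P d t e' j)
  show ?case
  proof (cases "e' = e")
    case True
    then show ?thesis using gr.gr_P[OF gr.gr_P[OF gr_P.hyps]] cone_upd[OF gr_P.hyps(2), of j] by blast
  next
    case False
    then have e': "e' = (\<not> e)" by blast
    let ?D = "(d(j := d j + sg e'))(i := (d(j := d j + sg e')) i + sg e)"
    have D: "?D = (d(i := d i + sg e))(j := (d(i := d i + sg e)) j + sg e')" by (auto simp: fun_eq_iff)
    have 1: "gr ?D (Prod (Prod (root_gen e i) (root_gen e' j)) t)"
    proof (cases "i = j")
      case True
      then have "?D = d" using e' by (auto simp: fun_eq_iff)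
      moreover have "Scale (of_int (sg e)) (Scale (wt d (\<alpha>v i)) t) \<doteq> Prod (Prod (root_gen e i) (root_gen e' j)) t"
      proof -
        have "Prod (Prod (root_gen e i) (root_gen e' j)) t \<doteq> Prod (Scale (of_int (sg e)) (Gen (H (\<alpha>v i)))) t"
          using rel_XX[of e i j] True unfolding e' by (intro alg_cong.cong_Prod alg_cong.refl) simp
        also have "\<dots> \<doteq> Scale (of_int (sg e)) (Prod (Gen (H (\<alpha>v i))) t)" by (rule alg_cong.Prod_Scale_left)
        also have "\<dots> \<doteq> Scale (of_int (sg e)) (Scale (wt d (\<alpha>v i)) t)"
          by (intro alg_cong.cong_Scale gr_wt gr_P.hyps)
        finally show ?thesis by (rule alg_cong.sym)
      qed
      ultimately show ?thesis using gr_cong[OF gr_Scale[OF gr_Scale[OF gr_P.hyps(1)]]] by simp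
    next
      case False
      have "Prod (Prod (root_gen e i) (root_gen e' j)) t \<doteq> Prod Zero t"
        using rel_XX[of e i j] False unfolding e' by (intro alg_cong.cong_Prod alg_cong.refl) simp
      also have "\<dots> \<doteq> Zero" by (rule Prod_Zero_left)
      finally show ?thesis using gr_cong[OF gr_Zero] alg_cong.sym by blast
    qed
    have 2: "gr ?D (Prod (root_gen e' j) (Prod (root_gen e i) t))"
    proof -
      let ?d = "d(i := d i + sg e)" and ?u = "Prod (root_gen e i) t"
      have u: "gr ?d ?u" by (rule gr_P.IH)
      consider "cone e' ?d" | "?d = (\<lambda>_. 0)" | "?u \<doteq> Zero" | "cone e ?d" "\<not> cone e' ?d"
      proof -
        have "cone e ?d \<or> cone e' ?d" if "cone ea ?d" for ea
          using that e' by (cases ea; cases e) auto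
        then show thesis using gr_cone[OF u] that by blast
      qed
      then show ?thesis
      proof cases
        case 1
        then show ?thesis unfolding D by (rule gr.gr_P[OF u])
      next
        case 2
        then obtain x where x: "?u \<doteq> Gen (H x)" using gr_zero[OF u] by blast
        have "Scale (- (of_int (sg e') * \<alpha> j x)) (root_gen e' j) \<doteq> Scale (-1) (Scale (of_int (sg e') * \<alpha> j x) (root_gen e' j))"
          by (rule linI) simp
        also have "\<dots> \<doteq> Scale (-1) (Prod (Gen (H x)) (root_gen e' j))"
          by (intro alg_cong.cong_Scale alg_cong.sym[OF rel_HX])
        also have "\<dots> \<doteq> Prod (root_gen e' j) (Gen (H x))" by (rule alg_cong.sym[OF Prod_antisym])
        also have "\<dots> \<doteq> Prod (root_gen e' j) ?u" by (intro alg_cong.cong_Prod alg_cong.refl alg_cong.sym[OF x])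
        finally show ?thesis unfolding D 2 using gr_cong[OF gr_Scale[OF gr_X]] by (simp only: add_0)
      next
        case 3
        then have "Prod (root_gen e' j) ?u \<doteq> Prod (root_gen e' j) Zero" by (intro alg_cong.cong_Prod alg_cong.refl)
        also have "\<dots> \<doteq> Zero" by (rule Prod_Zero_right)
        finally show ?thesis using gr_cong[OF gr_Zero] alg_cong.sym by blast
      next
        \<comment> \<open>Changing one coordinate by one unit cannot lead from one cone into the
          other without stopping at degree zero.\<close>
        case 4
        have "?d = (\<lambda>_. 0)"
        proof
          fix k
          have c: "sg e' * d m \<ge> 0" "sg e * ?d m \<ge> 0" for m
            using gr_P.hyps(2) 4(1) by (auto simp: cone_def)
          have o: "d m = 0" if "m \<noteq> i" for m
            using c[of m] that unfolding e' by (cases e) auto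
          have "d i \<noteq> 0" using gr_P.hyps(2) o unfolding cone_def by metis
          then have "?d i = 0" using c[of i] unfolding e' by (cases e) auto
          then show "?d k = 0" using o by auto
        qed
        then show ?thesis using 4(1) by (simp add: cone_def)
      qed
    qed
    show ?thesis
      using gr_cong[OF gr_Add[OF 1 2] alg_cong.sym[OF leibniz]] .
  qed
next
  case (gr_Zero d)
  then show ?case using gr_cong[OF gr.gr_Zero] alg_cong.sym[OF Prod_Zero_right] by blast
next
  case (gr_Add d s t)
  then show ?case using gr_cong[OF gr.gr_Add] alg_cong.sym[OF alg_cong.Prod_Add_right] by blast
next
  case (gr_Scale d s c)
  then show ?case using gr_cong[OF gr.gr_Scale] alg_cong.sym[OF alg_cong.Prod_Scale_right] by blast
next
  case (gr_cong d s t)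
  then show ?case using gr.gr_cong alg_cong.cong_Prod[OF alg_cong.refl gr_cong.hyps(2)] by blast
qed

subsection \<open>Homogeneous components of ideals\<close>

text \<open>The number counts homogeneous summands, whose degrees may coincide; it is the induction
  measure in \<open>ideal_graded\<close>.\<close>

inductive gsum :: "nat \<Rightarrow> ('h, 'n) km_gen alg_term \<Rightarrow> bool" where
  gsum_0: "t \<doteq> Zero \<Longrightarrow> gsum 0 t"
| gsum_Suc: "gr d s \<Longrightarrow> gsum n u \<Longrightarrow> t \<doteq> Add s u \<Longrightarrow> gsum (Suc n) t"

lemma gsum_cong:
  assumes "gsum n s" "s \<doteq> t"
  shows "gsum n t"
  using assms(1)
proof cases
  case gsum_0
  then have "t \<doteq> Zero" using assms(2) alg_cong.sym alg_cong.trans by blast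
  then show ?thesis using gsum.gsum_0 gsum_0(1) by simp
next
  case (gsum_Suc d u m v)
  then have "t \<doteq> Add u v" using assms(2) alg_cong.sym alg_cong.trans by blast
  then show ?thesis using gsum.gsum_Suc[OF gsum_Suc(2,3)] gsum_Suc(1) by simp
qed

lemma gsum_gr: "gr d t \<Longrightarrow> gsum (Suc 0) t"
  by (rule gsum_Suc[OF _ gsum_0[OF alg_cong.refl] alg_cong.sym[OF Add_Zero_right]])

lemma gsum_Add: "gsum n s \<Longrightarrow> gsum m t \<Longrightarrow> gsum (n + m) (Add s t)"
proof (induction arbitrary: t rule: gsum.induct)
  case (gsum_0 s)
  have "Add s t \<doteq> Add Zero t" by (intro alg_cong.cong_Add gsum_0 alg_cong.refl)
  also have "\<dots> \<doteq> t" by (rule alg_cong.Add_Zero)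
  finally have e: "Add s t \<doteq> t" .
  show ?case using gsum_cong[OF gsum_0.prems alg_cong.sym[OF e]] by simp
next
  case (gsum_Suc d s n u v)
  have "Add v t \<doteq> Add (Add s u) t" by (intro alg_cong.cong_Add gsum_Suc.hyps alg_cong.refl)
  also have "\<dots> \<doteq> Add s (Add u t)" by (rule alg_cong.Add_assoc)
  finally have e: "Add v t \<doteq> Add s (Add u t)" .
  show ?case using gsum.gsum_Suc[OF gsum_Suc.hyps(1) gsum_Suc.IH[OF gsum_Suc.prems] e] by simp
qed

lemma gsum_map:
  assumes "gsum n t" and add: "\<And>s t. f (Add s t) \<doteq> Add (f s) (f t)"
    and cong: "\<And>s t. s \<doteq> t \<Longrightarrow> f s \<doteq> f t" and zero: "f Zero \<doteq> Zero"
    and gr: "\<And>d s. gr d s \<Longrightarrow> gr d (f s)"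
  shows "gsum n (f t)"
  using assms(1)
proof (induction rule: gsum.induct)
  case (gsum_0 t)
  then show ?case using cong zero alg_cong.trans gsum.gsum_0 by blast
next
  case (gsum_Suc d s n u t)
  then show ?case using gsum.gsum_Suc[OF gr] cong add alg_cong.trans by blast
qed

lemma gsum_Scale: "gsum n t \<Longrightarrow> gsum n (Scale c t)"
  by (erule gsum_map[of n t "Scale c"]) (auto intro: alg_cong.Scale_Add alg_cong.cong_Scale gr_Scale Scale_Zero)

lemma gsum_Prod:
  assumes "gsum n t" "\<And>d t. gr d t \<Longrightarrow> \<exists>m. gsum m (Prod u t)"
  shows "\<exists>m. gsum m (Prod u t)"
  using assms(1)
proof (induction rule: gsum.induct)
  case (gsum_0 t)
  have "Prod u t \<doteq> Prod u Zero" by (intro alg_cong.cong_Prod gsum_0 alg_cong.refl)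
  also have "\<dots> \<doteq> Zero" by (rule Prod_Zero_right)
  finally show ?case using gsum.gsum_0 by blast
next
  case (gsum_Suc d s n v t)
  have "Prod u t \<doteq> Prod u (Add s v)" by (intro alg_cong.cong_Prod gsum_Suc.hyps alg_cong.refl)
  also have "\<dots> \<doteq> Add (Prod u s) (Prod u v)" by (rule alg_cong.Prod_Add_right)
  finally have e: "Add (Prod u s) (Prod u v) \<doteq> Prod u t" by (rule alg_cong.sym)
  then show ?case using assms(2)[OF gsum_Suc.hyps(1)] gsum_Suc.IH gsum_Add gsum_cong by meson
qed

text \<open>The Jacobi identity expresses [[u, v], t] by [u, [v, t]] and [v, [u, t]], so homogeneity
  has to be checked only for multiplication by generators.\<close>

lemma gsum_Prod_any: "gsum n t \<Longrightarrow> \<exists>m. gsum m (Prod u t)"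
proof (induction u arbitrary: n t)
  case (Gen g)
  show ?case
  proof (rule gsum_Prod[OF Gen])
    fix d t assume t: "gr d t"
    consider x where "g = H x" | e i where "Gen g = root_gen e i"
      by (cases g) (auto simp: root_gen_def, (metis (full_types))+)
    then show "\<exists>m. gsum m (Prod (Gen g) t)"
    proof cases
      case 1
      then show ?thesis using gsum_gr[OF gr_cong[OF gr_Scale[OF t] alg_cong.sym[OF gr_wt[OF t]]]] by blast
    next
      case 2
      then show ?thesis using gsum_gr[OF gr_X_closed[OF t]] by metis
    qed
  qed
next
  case Zero
  then show ?case using gsum_0[OF Prod_Zero_left] by blast
next
  case (Add u v)
  then show ?case using gsum_cong[OF gsum_Add alg_cong.sym[OF alg_cong.Prod_Add_left]] by meson
next
  case (Scale c u)
  then show ?case using gsum_cong[OF gsum_Scale alg_cong.sym[OF alg_cong.Prod_Scale_left]] by meson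
next
  case (Prod u v)
  have "Add (Prod u (Prod v t)) (Scale (-1) (Prod v (Prod u t))) \<doteq>
      Add (Add (Prod (Prod u v) t) (Prod v (Prod u t))) (Scale (-1) (Prod v (Prod u t)))"
    by (intro alg_cong.cong_Add alg_cong.refl leibniz)
  also have "\<dots> \<doteq> Prod (Prod u v) t" by (rule linI) simp
  finally show ?case using Prod gsum_cong[OF gsum_Add[OF _ gsum_Scale]] by meson
qed

lemma gsum_any: "\<exists>n. gsum n t"
proof (induction t)
  case (Gen g)
  consider x where "g = H x" | e i where "Gen g = root_gen e i"
    by (cases g) (auto simp: root_gen_def, (metis (full_types))+)
  then show ?case using gsum_gr gr_H gr_X by cases metis+
qed (blast intro: gsum_0 alg_cong.refl gsum_Add gsum_Scale gsum_Prod_any)+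

text \<open>Ideals are treated as sets of terms closed under the congruence, which avoids choosing
  representatives of classes. \<open>lie_ideal_image\<close> and \<open>lie_ideal_terms\<close>
  translate between the two pictures.\<close>

definition term_ideal :: "('h, 'n) km_gen alg_term set \<Rightarrow> bool" where
  "term_ideal T \<longleftrightarrow> Zero \<in> T \<and> (\<forall>s\<in>T. \<forall>t\<in>T. Add s t \<in> T) \<and> (\<forall>c. \<forall>s\<in>T. Scale c s \<in> T) \<and>
     (\<forall>s. \<forall>t\<in>T. Prod s t \<in> T) \<and> (\<forall>s\<in>T. \<forall>t. s \<doteq> t \<longrightarrow> t \<in> T)"

lemma term_idealD:
  assumes "term_ideal T"
  shows "Zero \<in> T" "s \<in> T \<Longrightarrow> t \<in> T \<Longrightarrow> Add s t \<in> T" "s \<in> T \<Longrightarrow> Scale c s \<in> T"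
    "t \<in> T \<Longrightarrow> Prod s t \<in> T" "s \<in> T \<Longrightarrow> s \<doteq> t \<Longrightarrow> t \<in> T"
  using assms unfolding term_ideal_def by blast+

inductive hspan :: "(('h, 'n) km_gen alg_term \<Rightarrow> bool) \<Rightarrow> ('h, 'n) km_gen alg_term \<Rightarrow> bool" for P where
  hspan_base: "P s \<Longrightarrow> hspan P s"
| hspan_Zero: "hspan P Zero"
| hspan_Add: "hspan P s \<Longrightarrow> hspan P t \<Longrightarrow> hspan P (Add s t)"
| hspan_Scale: "hspan P s \<Longrightarrow> hspan P (Scale c s)"
| hspan_cong: "hspan P s \<Longrightarrow> s \<doteq> t \<Longrightarrow> hspan P t"

lemma hspan_mono: "hspan P s \<Longrightarrow> (\<And>s. P s \<Longrightarrow> Q s) \<Longrightarrow> hspan Q s"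
proof (induction rule: hspan.induct)
  case (hspan_cong s t)
  then show ?case by (blast intro: hspan.hspan_cong)
qed (blast intro: hspan_base hspan_Zero hspan_Add hspan_Scale)+

definition shifted_ad where
  "shifted_ad x w u = Add (Prod (Gen (H x)) u) (Scale (- w) u)"

lemma shifted_ad_Add: "shifted_ad x w (Add s t) \<doteq> Add (shifted_ad x w s) (shifted_ad x w t)"
proof -
  have "shifted_ad x w (Add s t) \<doteq> Add (Add (Prod (Gen (H x)) s) (Prod (Gen (H x)) t)) (Scale (- w) (Add s t))"
    unfolding shifted_ad_def by (intro alg_cong.cong_Add alg_cong.refl alg_cong.Prod_Add_right)
  also have "\<dots> \<doteq> Add (shifted_ad x w s) (shifted_ad x w t)" unfolding shifted_ad_def by (rule linI) (simp add: algebra_simps)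
  finally show ?thesis .
qed

lemma shifted_ad_cong: "s \<doteq> t \<Longrightarrow> shifted_ad x w s \<doteq> shifted_ad x w t"
  unfolding shifted_ad_def by (intro alg_cong.cong_Add alg_cong.cong_Prod alg_cong.cong_Scale alg_cong.refl)

lemma shifted_ad_gr:
  assumes "gr d s"
  shows "shifted_ad x w s \<doteq> Scale (wt d x - w) s"
proof -
  have "shifted_ad x w s \<doteq> Add (Scale (wt d x) s) (Scale (- w) s)"
    unfolding shifted_ad_def by (intro alg_cong.cong_Add alg_cong.refl gr_wt[OF assms])
  also have "\<dots> \<doteq> Scale (wt d x - w) s" by (rule linI) (simp add: algebra_simps)
  finally show ?thesis .
qed

lemma gsum_shifted_ad: "gsum n t \<Longrightarrow> gsum n (shifted_ad x w t)"
proof (rule gsum_map[of n t "shifted_ad x w"])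
  have "shifted_ad x w Zero \<doteq> Scale (wt (\<lambda>_. 0) x - w) Zero" by (rule shifted_ad_gr[OF gr_Zero])
  then show "shifted_ad x w Zero \<doteq> Zero" using Scale_Zero alg_cong.trans by blast
next
  fix d s assume "gr d s"
  then show "gr d (shifted_ad x w s)" using gr_cong[OF gr_Scale alg_cong.sym[OF shifted_ad_gr]] by blast
qed (auto intro: shifted_ad_Add shifted_ad_cong)

lemma shifted_ad_eigen: "gr d s \<Longrightarrow> shifted_ad x (wt d x) s \<doteq> Zero"
  using shifted_ad_gr[of d s x "wt d x"] Scale_0 alg_cong.trans by fastforce

text \<open>
  Applying \<open>ad h - w\<close> for the weights \<open>w\<close> of two different components eliminates each of them in turn,
  and the original element is a combination of the two results.
\<close>

lemma ideal_graded:
  assumes T: "term_ideal T"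
  shows "gsum n t \<Longrightarrow> t \<in> T \<Longrightarrow> hspan (\<lambda>s. s \<in> T \<and> (\<exists>d. gr d s)) t"
proof (induction n arbitrary: t rule: less_induct)
  case (less n)
  let ?P = "\<lambda>s. s \<in> T \<and> (\<exists>d. gr d s)"
  from less.prems(1) show ?case
  proof cases
    case gsum_0
    then show ?thesis using hspan_cong[OF hspan_Zero] alg_cong.sym by blast
  next
    case (gsum_Suc d0 s0 m u)
    note t = gsum_Suc
    from t(3) show ?thesis
    proof cases
      case gsum_0
      have "t \<doteq> Add s0 Zero" using t(4) alg_cong.cong_Add[OF alg_cong.refl gsum_0(2)] alg_cong.trans by blast
      then have "s0 \<doteq> t" using Add_Zero_right alg_cong.trans alg_cong.sym by blast
      then have "gr d0 t" using gr_cong[OF t(2)] by blast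
      then show ?thesis using less.prems(2) hspan_base[of ?P t] by blast
    next
      case (gsum_Suc d1 s1 k u')
      have t': "t \<doteq> Add s0 (Add s1 u')" using t(4) alg_cong.cong_Add[OF alg_cong.refl gsum_Suc(4)] alg_cong.trans by blast
      show ?thesis
      proof (cases "d0 = d1")
        case True
        have "t \<doteq> Add (Add s0 s1) u'" using t' alg_cong.sym[OF alg_cong.Add_assoc] alg_cong.trans by blast
        then have "gsum (Suc k) t" using gsum.gsum_Suc[OF gr_Add gsum_Suc(3)] t(2) gsum_Suc(2) True by blast
        then show ?thesis using less.IH[of "Suc k"] less.prems(2) t(1) gsum_Suc(1) by simp
      next
        case False
        then obtain x where x: "wt d0 x \<noteq> wt d1 x" using wt_separates by blast
        define w0 w1 where "w0 = wt d0 x" "w1 = wt d1 x"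
        let ?y = "shifted_ad x w0 t" and ?z = "shifted_ad x w1 t"
        have "?y \<doteq> Add (shifted_ad x w0 s0) (shifted_ad x w0 u)"
          using shifted_ad_cong[OF t(4)] shifted_ad_Add alg_cong.trans by blast
        also have "\<dots> \<doteq> Add Zero (shifted_ad x w0 u)"
          unfolding w0_w1_def by (intro alg_cong.cong_Add alg_cong.refl shifted_ad_eigen[OF t(2)])
        also have "\<dots> \<doteq> shifted_ad x w0 u" by (rule alg_cong.Add_Zero)
        finally have y: "gsum m ?y" using gsum_cong[OF gsum_shifted_ad[OF t(3)]] alg_cong.sym by blast
        have "?z \<doteq> Add (shifted_ad x w1 s0) (shifted_ad x w1 (Add s1 u'))"
          using shifted_ad_cong[OF t'] shifted_ad_Add alg_cong.trans by blast
        also have "\<dots> \<doteq> Add (shifted_ad x w1 s0) (Add (shifted_ad x w1 s1) (shifted_ad x w1 u'))"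
          by (intro alg_cong.cong_Add alg_cong.refl shifted_ad_Add)
        also have "\<dots> \<doteq> Add (shifted_ad x w1 s0) (Add Zero (shifted_ad x w1 u'))"
          unfolding w0_w1_def by (intro alg_cong.cong_Add alg_cong.refl shifted_ad_eigen[OF gsum_Suc(2)])
        also have "\<dots> \<doteq> Add (shifted_ad x w1 s0) (shifted_ad x w1 u')" by (rule linI) simp
        finally have z': "?z \<doteq> Add (shifted_ad x w1 s0) (shifted_ad x w1 u')" .
        have "gr d0 (shifted_ad x w1 s0)"
          using gr_cong[OF gr_Scale alg_cong.sym[OF shifted_ad_gr]] t(2) by blast
        then have z: "gsum m ?z" using gsum.gsum_Suc[OF _ gsum_shifted_ad[OF gsum_Suc(3)] z'] gsum_Suc(1) by blast
        have yz: "?y \<in> T" "?z \<in> T" using less.prems(2) term_idealD[OF T] unfolding shifted_ad_def by blast+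
        have "hspan ?P ?y" "hspan ?P ?z" using less.IH y z yz t(1) by blast+
        \<comment> \<open>In the difference of \<open>?y\<close> and \<open>?z\<close> the brackets
          cancel, and (w1 - w0) times t remains.\<close>
        then have "hspan ?P (Scale (1 / (w1 - w0)) (Add ?y (Scale (-1) ?z)))" by (intro hspan_Scale hspan_Add)
        moreover have "Scale (1 / (w1 - w0)) (Add ?y (Scale (-1) ?z)) \<doteq> t"
        proof (rule linI)
          fix a
          have "w1 - w0 \<noteq> 0" using x by (simp add: w0_w1_def)
          moreover have "coef (Add ?y (Scale (-1) ?z)) a = (w1 - w0) * coef t a"
            by (simp add: shifted_ad_def left_diff_distrib)
          ultimately show "coef (Scale (1 / (w1 - w0)) (Add ?y (Scale (-1) ?z))) a = coef t a"
            unfolding coef.simps(4) by simp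
        qed
        ultimately show ?thesis by (rule hspan_cong)
      qed
    qed
  qed
qed

end

section \<open>Representations of generators and relations\<close>

definition fun_linear :: "(('a \<Rightarrow> complex) \<Rightarrow> ('a \<Rightarrow> complex)) \<Rightarrow> bool" where
  "fun_linear T \<longleftrightarrow> (\<forall>\<phi> \<psi>. T (\<lambda>a. \<phi> a + \<psi> a) = (\<lambda>a. T \<phi> a + T \<psi> a)) \<and> (\<forall>k \<phi>. T (\<lambda>a. k * \<phi> a) = (\<lambda>a. k * T \<phi> a))"

lemma fun_linearD:
  assumes "fun_linear T"
  shows "T (\<lambda>a. \<phi> a + \<psi> a) = (\<lambda>a. T \<phi> a + T \<psi> a)" "T (\<lambda>a. k * \<phi> a) = (\<lambda>a. k * T \<phi> a)"
    "T (\<lambda>a. 0) = (\<lambda>a. 0)" "T (\<lambda>a. \<phi> a - \<psi> a) = (\<lambda>a. T \<phi> a - T \<psi> a)"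
proof -
  show a: "T (\<lambda>a. \<phi> a + \<psi> a) = (\<lambda>a. T \<phi> a + T \<psi> a)" for \<phi> \<psi> using assms by (simp add: fun_linear_def)
  show s: "T (\<lambda>a. k * \<phi> a) = (\<lambda>a. k * T \<phi> a)" for k \<phi> using assms by (simp add: fun_linear_def)
  show "T (\<lambda>a. 0) = (\<lambda>a. 0)" using s[of 0 "\<lambda>_. 0"] by simp
  show "T (\<lambda>a. \<phi> a - \<psi> a) = (\<lambda>a. T \<phi> a - T \<psi> a)"
    using a[of \<phi> "\<lambda>a. (-1) * \<psi> a"] s[of "-1" \<psi>] by simp
qed

text \<open>Products become commutators of operators, so for linear operators antisymmetry and the
  Jacobi identity hold automatically and only the relations between generators have to be
  verified.\<close>

primrec interp :: "('g \<Rightarrow> ('a \<Rightarrow> complex) \<Rightarrow> 'a \<Rightarrow> complex) \<Rightarrow> 'g alg_term \<Rightarrow> ('a \<Rightarrow> complex) \<Rightarrow> 'a \<Rightarrow> complex" where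
  "interp \<omega> (Gen g) = \<omega> g"
| "interp \<omega> Zero = (\<lambda>\<phi> a. 0)"
| "interp \<omega> (Add s t) = (\<lambda>\<phi> a. interp \<omega> s \<phi> a + interp \<omega> t \<phi> a)"
| "interp \<omega> (Scale k s) = (\<lambda>\<phi> a. k * interp \<omega> s \<phi> a)"
| "interp \<omega> (Prod s t) = (\<lambda>\<phi> a. interp \<omega> s (interp \<omega> t \<phi>) a - interp \<omega> t (interp \<omega> s \<phi>) a)"

lemma interp_linear:
  assumes "\<And>g. fun_linear (\<omega> g)"
  shows "fun_linear (interp \<omega> t)"
proof (induction t)
  case (Prod s t)
  note st = fun_linearD[OF Prod.IH(1)] fun_linearD[OF Prod.IH(2)]
  show ?case by (auto simp: fun_linear_def st algebra_simps intro!: ext)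
qed (use assms in \<open>auto simp: fun_linear_def fun_eq_iff algebra_simps\<close>)

context kac_moody
begin

definition gen_op where
  "gen_op hop xop g = (case g of H x \<Rightarrow> hop x | E i \<Rightarrow> xop True i | F i \<Rightarrow> xop False i)"

end

locale km_representation = kac_moody A sc \<alpha> \<alpha>v
  for A :: "int ^ 'n ^ 'n" and sc :: "complex \<Rightarrow> 'h::ab_group_add \<Rightarrow> 'h"
    and \<alpha> :: "'n::finite \<Rightarrow> 'h \<Rightarrow> complex" and \<alpha>v :: "'n \<Rightarrow> 'h" +
  fixes hop :: "'h \<Rightarrow> ('a \<Rightarrow> complex) \<Rightarrow> 'a \<Rightarrow> complex"
    and xop :: "bool \<Rightarrow> 'n \<Rightarrow> ('a \<Rightarrow> complex) \<Rightarrow> 'a \<Rightarrow> complex"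
  assumes hop_linear: "fun_linear (hop x)" and xop_linear: "fun_linear (xop e i)"
    and hop_add: "hop (x + y) \<phi> a = hop x \<phi> a + hop y \<phi> a"
    and hop_scale: "hop (sc k x) \<phi> a = k * hop x \<phi> a"
    and hop_hop: "hop x (hop y \<phi>) a = hop y (hop x \<phi>) a"
    and hop_xop: "hop x (xop e i \<phi>) a = xop e i (hop x \<phi>) a + of_int (sg e) * \<alpha> i x * xop e i \<phi> a"
    and xop_xop: "xop True i (xop False j \<phi>) a - xop False j (xop True i \<phi>) a = (if i = j then hop (\<alpha>v i) \<phi> a else 0)"
begin

abbreviation "act \<equiv> interp (gen_op hop xop)"

lemma act_linear: "fun_linear (act t)"
  by (rule interp_linear) (auto simp: gen_op_def hop_linear xop_linear split: km_gen.split)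

lemma act_Gen: "act (Gen (H x)) = hop x" "act (root_gen e i) = xop e i"
  by (auto simp: gen_op_def root_gen_def)

lemma act_rel:
  assumes a: "(s, t) \<in> km_rel"
  shows "act s = act t"
proof -
  have hh: "hop x (hop y \<phi>) a - hop y (hop x \<phi>) a = 0" for x y \<phi> a
    using hop_hop[of x y \<phi> a] by simp
  have hx: "hop x (xop True i \<phi>) a - xop True i (hop x \<phi>) a = \<alpha> i x * xop True i \<phi> a"
    "hop x (xop False i \<phi>) a - xop False i (hop x \<phi>) a = - (\<alpha> i x * xop False i \<phi> a)" for x i \<phi> a
    using hop_xop[of x True i \<phi> a] hop_xop[of x False i \<phi> a] by simp_all
  have xx: "xop True i (xop False i \<phi>) a - xop False i (xop True i \<phi>) a = hop (\<alpha>v i) \<phi> a"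
    "i \<noteq> j \<Longrightarrow> xop True i (xop False j \<phi>) a - xop False j (xop True i \<phi>) a = 0" for i j \<phi> a
    using xop_xop[of i j \<phi> a] xop_xop[of i i \<phi> a] by simp_all
  show ?thesis
    using a unfolding km_rel_def lie_relations_def km_relations_def
    by (auto intro!: ext simp: gen_op_def hop_add hop_scale hh hx xx fun_linearD(4)[OF act_linear])
qed

lemma act_cong: "s \<doteq> t \<Longrightarrow> act s = act t"
proof (induction rule: alg_cong.induct)
  case (rel s t)
  then show ?case by (rule act_rel)
qed (auto simp: algebra_simps fun_linearD[OF act_linear] intro!: ext)

end

section \<open>A basis of the Cartan subalgebra\<close>

context kac_moody
begin

definition "basis = (SOME B. V.independent B \<and> V.span B = UNIV \<and> finite B)"

text \<open>The rank is at most \<open>CARD('n)\<close>, so the prescribed dimension is positive,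
  whereas an infinite basis would have \<open>card\<close> equal to 0.\<close>

lemma basis: "V.independent basis" "V.span basis = UNIV" "finite basis"
proof -
  obtain B where B: "V.independent B" "UNIV \<subseteq> V.span B" "card B = V.dim UNIV"
    using V.basis_exists by blast
  have rows: "rows M = range (\<lambda>i. row i M)" for M :: "complex ^ 'n ^ 'n"
    by (auto simp: rows_def)
  have "rank (map_matrix of_int A :: complex ^ 'n ^ 'n) \<le> card (rows (map_matrix of_int A :: complex ^ 'n ^ 'n))"
    unfolding row_rank_def_gen by (rule vec.dim_le_card') (simp add: rows)
  also have "\<dots> \<le> CARD('n)" unfolding rows by (rule card_image_le) simp
  finally have "rank (map_matrix of_int A :: complex ^ 'n ^ 'n) \<le> CARD('n)" .
  moreover have "CARD('n) > 0" by simp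
  ultimately have "rank (map_matrix of_int A :: complex ^ 'n ^ 'n) < 2 * CARD('n)" by linarith
  then have "card B > 0" using realization B(3) by (simp add: realization_def)
  then have "finite B" using card_gt_0_iff by blast
  with B have "\<exists>B. V.independent B \<and> V.span B = UNIV \<and> finite B" by blast
  from someI_ex[OF this] show "V.independent basis" "V.span basis = UNIV" "finite basis"
    by (auto simp: basis_def)
qed

text \<open>A point \<open>c\<close> gives the linear functional with the values \<open>c\<close> on the basis.\<close>

definition lam :: "('h \<Rightarrow> complex) \<Rightarrow> 'h \<Rightarrow> complex" where
  "lam c x = (\<Sum>b\<in>basis. V.representation basis x b * c b)"

lemma lam_add: "lam c (x + y) = lam c x + lam c y"
  using basis by (simp add: lam_def V.representation_add sum.distrib distrib_right)

lemma lam_scale: "lam c (sc k x) = k * lam c x"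
  using basis by (simp add: lam_def V.representation_scale sum_distrib_left mult.assoc)

lemma lam_diff: "lam c (x - y) = lam c x - lam c y"
  using lam_add[of c x "sc (-1) y"] lam_scale[of c "-1" y] by simp

lemma lam_zero: "lam c 0 = 0"
  using lam_scale[of c 0 0] by simp

lemma lam_plus_scale: "lam (\<lambda>x. c x + s * f x) x = lam c x + s * lam f x"
  by (simp add: lam_def distrib_left sum.distrib sum_distrib_left mult.left_commute)

lemma lam_basis: "b \<in> basis \<Longrightarrow> lam c b = c b"
  using basis by (simp add: lam_def V.representation_basis if_distrib[of "\<lambda>x. x * _"] sum.delta' cong: if_cong)

lemma lam_linear:
  assumes "Vector_Spaces.linear sc (*) f"
  shows "lam f = f"
proof
  fix x
  interpret f: Vector_Spaces.linear sc "(*)" f by (rule assms)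
  have "x = (\<Sum>b\<in>basis. sc (V.representation basis x b) b)"
    using V.sum_representation_eq[OF basis(1) _ basis(3) order_refl, of x] basis(2) by simp
  then have "f x = (\<Sum>b\<in>basis. f (sc (V.representation basis x b) b))" using f.sum by metis
  then show "lam f x = f x" by (simp add: lam_def f.scale)
qed

lemma lam_\<alpha>: "lam (\<lambda>x. c x + s * \<alpha> i x) y = lam c y + s * \<alpha> i y"
  using lam_plus_scale[of c s "\<alpha> i"] by (simp add: lam_linear[OF \<alpha>_linear])

lemma lam_separates: "(\<And>c. lam c x = 0) \<Longrightarrow> x = 0"
proof -
  assume z: "\<And>c. lam c x = 0"
  have "V.representation basis x b = 0" if "b \<in> basis" for b
  proof -
    have "lam (\<lambda>b'. if b' = b then 1 else 0) x = V.representation basis x b"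
      using that basis(3) by (simp add: lam_def if_distrib[of "\<lambda>y. _ * y"] cong: if_cong)
    then show ?thesis using z by simp
  qed
  moreover have "x = (\<Sum>b\<in>basis. sc (V.representation basis x b) b)"
    using V.sum_representation_eq[OF basis(1) _ basis(3) order_refl, of x] basis(2) by simp
  ultimately show "x = 0" by (metis (no_types, lifting) V.scale_zero_left sum.neutral)
qed

lemma \<alpha>_scale: "\<alpha> i (sc k x) = k * \<alpha> i x"
  and \<alpha>_add: "\<alpha> i (x + y) = \<alpha> i x + \<alpha> i y"
  by (metis lam_linear[OF \<alpha>_linear] lam_scale, metis lam_linear[OF \<alpha>_linear] lam_add)

text \<open>
  The dual of the Verma module over the algebra without Serre relations, with highest weight \<open>lam c\<close>:
  functions on words, where \<open>e\<^sub>i\<close> removes a letter and \<open>f\<^sub>i\<close> inserts one.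
\<close>

primrec weight :: "('h \<Rightarrow> complex) \<Rightarrow> 'n list \<Rightarrow> 'h \<Rightarrow> complex" where
  "weight c [] x = lam c x"
| "weight c (i # w) x = weight c w x - \<alpha> i x"

primrec word_f :: "('h \<Rightarrow> complex) \<Rightarrow> 'n \<Rightarrow> 'n list \<Rightarrow> ('n list \<Rightarrow> complex) \<Rightarrow> complex" where
  "word_f c i [] \<phi> = 0"
| "word_f c i (j # w) \<phi> = (if i = j then weight c w (\<alpha>v i) * \<phi> w else 0) + word_f c i w (\<lambda>u. \<phi> (j # u))"

definition word_x :: "('h \<Rightarrow> complex) \<Rightarrow> bool \<Rightarrow> 'n \<Rightarrow> ('n list \<Rightarrow> complex) \<Rightarrow> 'n list \<Rightarrow> complex" where
  "word_x c e i \<phi> w = (if e then \<phi> (i # w) else word_f c i w \<phi>)"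

definition word_h :: "('h \<Rightarrow> complex) \<Rightarrow> 'h \<Rightarrow> ('n list \<Rightarrow> complex) \<Rightarrow> 'n list \<Rightarrow> complex" where
  "word_h c x \<phi> w = weight c w x * \<phi> w"

lemma weight_add: "weight c w (x + y) = weight c w x + weight c w y"
  by (induction w) (simp_all add: lam_add \<alpha>_add)

lemma weight_scale: "weight c w (sc k x) = k * weight c w x"
  by (induction w) (simp_all add: lam_scale \<alpha>_scale right_diff_distrib)

lemma word_f_add: "word_f c i w (\<lambda>u. \<phi> u + \<psi> u) = word_f c i w \<phi> + word_f c i w \<psi>"
  by (induction w arbitrary: \<phi> \<psi>) (simp_all add: algebra_simps)

lemma word_f_scale: "word_f c i w (\<lambda>u. k * \<phi> u) = k * word_f c i w \<phi>"
  by (induction w arbitrary: \<phi>) (simp_all add: algebra_simps)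

text \<open>The constant m makes the induction work: passing a letter j changes the weight by the
  root of j, and this is absorbed into m.\<close>

lemma word_f_weight:
  "word_f c i w (\<lambda>u. (weight c u x + m) * \<phi> u) = (weight c w x + m + \<alpha> i x) * word_f c i w \<phi>"
proof (induction w arbitrary: \<phi> m)
  case (Cons j w)
  have "word_f c i w (\<lambda>u. (weight c (j # u) x + m) * \<phi> (j # u))
      = word_f c i w (\<lambda>u. (weight c u x + (m - \<alpha> j x)) * \<phi> (j # u))"
    by (simp add: algebra_simps)
  also have "\<dots> = (weight c w x + (m - \<alpha> j x) + \<alpha> i x) * word_f c i w (\<lambda>u. \<phi> (j # u))"
    by (rule Cons)
  finally have e: "word_f c i w (\<lambda>u. (weight c (j # u) x + m) * \<phi> (j # u)) = \<dots>" .
  show ?case unfolding word_f.simps e by (simp add: algebra_simps)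
qed simp

lemma word_representation: "km_representation A sc \<alpha> \<alpha>v (word_h c) (word_x c)"
proof
  show "fun_linear (word_h c x)" for x
    by (simp add: fun_linear_def word_h_def fun_eq_iff algebra_simps)
  show "fun_linear (word_x c e i)" for e i
    by (simp add: fun_linear_def word_x_def[abs_def] fun_eq_iff word_f_add word_f_scale)
  show "word_h c (x + y) \<phi> a = word_h c x \<phi> a + word_h c y \<phi> a" for x y \<phi> a
    by (simp add: word_h_def weight_add algebra_simps)
  show "word_h c (sc k x) \<phi> a = k * word_h c x \<phi> a" for k x \<phi> a
    by (simp add: word_h_def weight_scale)
  show "word_h c x (word_h c y \<phi>) a = word_h c y (word_h c x \<phi>) a" for x y \<phi> a
    by (simp add: word_h_def)
  show "word_h c x (word_x c e i \<phi>) a = word_x c e i (word_h c x \<phi>) a + of_int (sg e) * \<alpha> i x * word_x c e i \<phi> a" for x e i \<phi> a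
    using word_f_weight[of c i a x 0 \<phi>]
    by (cases e) (simp_all add: word_h_def[abs_def] word_x_def algebra_simps)
  show "word_x c True i (word_x c False j \<phi>) a - word_x c False j (word_x c True i \<phi>) a = (if i = j then word_h c (\<alpha>v i) \<phi> a else 0)" for i j \<phi> a
    by (simp add: word_h_def word_x_def[abs_def])
qed

text \<open>At the empty word \<open>H x\<close> acts by the scalar \<open>lam c x\<close>, and c is
  arbitrary.\<close>

lemma H_injective:
  assumes "Gen (H x) \<doteq> Gen (H y)"
  shows "x = y"
proof -
  have "lam c (x - y) = 0" for c
  proof -
    interpret km_representation A sc \<alpha> \<alpha>v "word_h c" "word_x c" by (rule word_representation)
    have "word_h c x (\<lambda>_. 1) [] = word_h c y (\<lambda>_. 1) []" using act_cong[OF assms] by (simp add: act_Gen(1) del: interp.simps)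
    then show ?thesis by (simp add: word_h_def lam_diff)
  qed
  then have "x - y = 0" by (rule lam_separates)
  then show "x = y" by simp
qed

subsection \<open>The radical\<close>

definition trivial_term_ideal :: "('h, 'n) km_gen alg_term set \<Rightarrow> bool" where
  "trivial_term_ideal T \<longleftrightarrow> term_ideal T \<and> (\<forall>x. Gen (H x) \<in> T \<longrightarrow> x = 0)"

text \<open>The sum of all ideals that meet the Cartan subalgebra trivially. That the sum still does
  so is \<open>rad_trivial\<close>, and this makes it the unique maximal one.\<close>

inductive_set rad :: "('h, 'n) km_gen alg_term set" where
  rad_base: "t \<in> T \<Longrightarrow> trivial_term_ideal T \<Longrightarrow> t \<in> rad"
| rad_Add: "s \<in> rad \<Longrightarrow> t \<in> rad \<Longrightarrow> Add s t \<in> rad"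
| rad_cong: "s \<in> rad \<Longrightarrow> s \<doteq> t \<Longrightarrow> t \<in> rad"

lemma term_ideal_Zero: "term_ideal {t. t \<doteq> Zero}"
  unfolding term_ideal_def
proof (intro conjI ballI allI impI; clarsimp)
  show "Zero \<doteq> Zero" by (rule alg_cong.refl)
  show "Add s t \<doteq> Zero" if "s \<doteq> Zero" "t \<doteq> Zero" for s t
    using alg_cong.trans[OF alg_cong.cong_Add[OF that] alg_cong.Add_Zero] .
  show "Scale k s \<doteq> Zero" if "s \<doteq> Zero" for k s
    using alg_cong.trans[OF alg_cong.cong_Scale[OF that] Scale_Zero] .
  show "Prod s t \<doteq> Zero" if "t \<doteq> Zero" for s t
    using alg_cong.trans[OF alg_cong.cong_Prod[OF alg_cong.refl that] Prod_Zero_right] .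
  show "t \<doteq> Zero" if "s \<doteq> Zero" "s \<doteq> t" for s t
    using alg_cong.trans[OF alg_cong.sym[OF that(2)] that(1)] .
qed

lemma trivial_Zero: "trivial_term_ideal {t. t \<doteq> Zero}"
  unfolding trivial_term_ideal_def using term_ideal_Zero H_injective[of _ 0] alg_cong.trans[OF _ alg_cong.sym[OF H_zero]]
  by blast

lemma rad_Scale: "s \<in> rad \<Longrightarrow> Scale k s \<in> rad"
proof (induction rule: rad.induct)
  case (rad_base t T)
  then show ?case using rad.rad_base term_idealD(3) unfolding trivial_term_ideal_def by blast
next
  case (rad_Add s t)
  then show ?case using rad.rad_cong[OF rad.rad_Add alg_cong.sym[OF alg_cong.Scale_Add]] by blast
next
  case (rad_cong s t)
  then show ?case using rad.rad_cong alg_cong.cong_Scale by blast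
qed

lemma rad_Prod: "t \<in> rad \<Longrightarrow> Prod s t \<in> rad"
proof (induction rule: rad.induct)
  case (rad_base t T)
  then show ?case using rad.rad_base term_idealD(4) unfolding trivial_term_ideal_def by blast
next
  case (rad_Add t u)
  then show ?case using rad.rad_cong[OF rad.rad_Add alg_cong.sym[OF alg_cong.Prod_Add_right]] by blast
next
  case (rad_cong t u)
  then show ?case using rad.rad_cong alg_cong.cong_Prod[OF alg_cong.refl] by blast
qed

lemma rad_Zero: "Zero \<in> rad"
  using rad_base[OF _ trivial_Zero] alg_cong.refl by blast

lemma rad_term_ideal: "term_ideal rad"
  unfolding term_ideal_def using rad_Zero rad_Scale rad_Prod rad_Add rad_cong by blast

lemma rad_hspan:
  "t \<in> rad \<Longrightarrow> hspan (\<lambda>s. \<exists>T d. trivial_term_ideal T \<and> s \<in> T \<and> gr d s) t"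
proof (induction rule: rad.induct)
  case (rad_base t T)
  obtain n where "gsum n t" using gsum_any by blast
  then have "hspan (\<lambda>s. s \<in> T \<and> (\<exists>d. gr d s)) t"
    using ideal_graded rad_base unfolding trivial_term_ideal_def by blast
  then show ?case by (rule hspan_mono) (use rad_base in blast)
qed (blast intro: hspan_Add hspan_cong)+

lemma trivial_gr_zero:
  assumes "trivial_term_ideal T" "s \<in> T" "gr (\<lambda>_. 0) s"
  shows "s \<doteq> Zero"
proof -
  obtain x where x: "s \<doteq> Gen (H x)" using gr_zero[OF assms(3)] by blast
  then have "x = 0" using assms unfolding trivial_term_ideal_def using term_idealD(5) by blast
  then show ?thesis using x H_zero alg_cong.trans by blast
qed

text \<open>A sum of trivial ideals is spanned by their homogeneous elements. Those of degree zero
  vanish, and those of any other degree have no diagonal coefficient at the highest weight, where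
  \<open>H x\<close> has the coefficient \<open>lam c x\<close>.\<close>

lemma rad_trivial: "trivial_term_ideal rad"
  unfolding trivial_term_ideal_def
proof (intro conjI allI impI rad_term_ideal)
  fix x assume x: "Gen (H x) \<in> rad"
  have "lam c x = 0" for c
  proof -
    interpret km_representation A sc \<alpha> \<alpha>v "word_h c" "word_x c" by (rule word_representation)
    \<comment> \<open>The function supported on the empty word has weight \<open>lam c\<close>,
      which is also the eigenvalue at the empty word, so an element of nonzero weight has
      coefficient zero there.\<close>
    let ?\<delta> = "\<lambda>w. if w = [] then 1 else 0 :: complex"
    have "act s ?\<delta> [] = 0" if "trivial_term_ideal T" "s \<in> T" "gr d s" for T d s
    proof (cases "d = (\<lambda>_. 0)")
      case True
      then have "act s = act Zero" using act_cong[OF trivial_gr_zero] that by blast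
      then show ?thesis by simp
    next
      case False
      then obtain y where y: "wt d y \<noteq> 0" using wt_separates[of d "\<lambda>_. 0"] wt_zero by auto
      have \<delta>: "word_h c y ?\<delta> = (\<lambda>w. lam c y * ?\<delta> w)" by (auto simp: word_h_def fun_eq_iff)
      have "act (Prod (Gen (H y)) s) ?\<delta> [] = act (Scale (wt d y) s) ?\<delta> []"
        using act_cong[OF gr_wt[OF that(3)]] by simp
      then have "word_h c y (act s ?\<delta>) [] - act s (word_h c y ?\<delta>) [] = wt d y * act s ?\<delta> []"
        by (simp add: act_Gen(1)[symmetric])
      moreover have "word_h c y (act s ?\<delta>) [] = lam c y * act s ?\<delta> []" by (simp add: word_h_def)
      moreover have "act s (word_h c y ?\<delta>) [] = lam c y * act s ?\<delta> []"
        unfolding \<delta> using fun_linearD(2)[OF act_linear, of s "lam c y" ?\<delta>] by metis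
      ultimately show ?thesis using y by simp
    qed
    note a = this
    have "act t ?\<delta> [] = 0" if "t \<in> rad" for t
      using rad_hspan[OF that]
    proof (induction rule: hspan.induct)
      case (hspan_base s)
      then show ?case using a by blast
    next
      case (hspan_cong s t)
      then show ?case using act_cong[OF hspan_cong.hyps(2)] by simp
    qed simp_all
    then have "act (Gen (H x)) ?\<delta> [] = 0" using x by blast
    then show ?thesis by (simp add: act_Gen(1) word_h_def del: interp.simps)
  qed
  then show "x = 0" by (rule lam_separates)
qed

end

section \<open>The Kac-Moody algebra\<close>

text \<open>Both the algebra of generators and relations and its quotient by the radical are images
  of the set of terms under a map compatible with the congruence. The Lie algebra axioms are
  therefore checked only once.\<close>

locale term_lie_algebra =
  fixes R :: "('x alg_term \<times> 'x alg_term) set" and q :: "'x alg_term \<Rightarrow> 'b" and L :: "(complex, 'b) module"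
  assumes lie: "lie_relations \<subseteq> R"
    and q_cong: "alg_cong R s t \<Longrightarrow> q s = q t"
    and carrier_q: "carrier L = range q"
    and zero_q: "\<zero>\<^bsub>L\<^esub> = q Zero"
    and add_q: "q s \<oplus>\<^bsub>L\<^esub> q t = q (Add s t)"
    and mult_q: "q s \<otimes>\<^bsub>L\<^esub> q t = q (Prod s t)"
    and smult_q: "k \<odot>\<^bsub>L\<^esub> q t = q (Scale k t)"
begin

lemma module_L: "Module.module Cring L"
proof (rule moduleI)
  show "cring Cring" by (rule cring_from_type_algebra)
  show "abelian_group L"
  proof (rule abelian_groupI)
    show "\<exists>y\<in>carrier L. y \<oplus>\<^bsub>L\<^esub> x = \<zero>\<^bsub>L\<^esub>" if x: "x \<in> carrier L" for x
    proof -
      obtain t where "x = q t" using x carrier_q by blast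
      then have "q (Scale (-1) t) \<oplus>\<^bsub>L\<^esub> x = \<zero>\<^bsub>L\<^esub>"
        by (simp add: add_q zero_q q_cong alg_cong.Add_neg)
      then show ?thesis using carrier_q by blast
    qed
    show "x \<oplus>\<^bsub>L\<^esub> y \<oplus>\<^bsub>L\<^esub> z = x \<oplus>\<^bsub>L\<^esub> (y \<oplus>\<^bsub>L\<^esub> z)" if "x \<in> carrier L" "y \<in> carrier L" "z \<in> carrier L" for x y z
      using that by (auto simp: carrier_q add_q intro!: q_cong alg_cong.Add_assoc)
    show "x \<oplus>\<^bsub>L\<^esub> y = y \<oplus>\<^bsub>L\<^esub> x" if "x \<in> carrier L" "y \<in> carrier L" for x y
      using that by (auto simp: carrier_q add_q intro!: q_cong alg_cong.Add_comm)
    show "\<zero>\<^bsub>L\<^esub> \<oplus>\<^bsub>L\<^esub> x = x" if "x \<in> carrier L" for x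
      using that by (auto simp: carrier_q add_q zero_q intro!: q_cong alg_cong.Add_Zero)
  qed (auto simp: carrier_q zero_q add_q)
  show "\<one>\<^bsub>Cring\<^esub> \<odot>\<^bsub>L\<^esub> x = x" if "x \<in> carrier L" for x
    using that by (auto simp: ring_of_type_algebra_def carrier_q smult_q intro!: q_cong alg_cong.Scale_one)
  show "(a \<oplus>\<^bsub>Cring\<^esub> b) \<odot>\<^bsub>L\<^esub> x = a \<odot>\<^bsub>L\<^esub> x \<oplus>\<^bsub>L\<^esub> b \<odot>\<^bsub>L\<^esub> x" if "x \<in> carrier L" for a b x
    using that by (auto simp: ring_of_type_algebra_def carrier_q smult_q add_q intro!: q_cong alg_cong.Scale_plus)
  show "a \<odot>\<^bsub>L\<^esub> (x \<oplus>\<^bsub>L\<^esub> y) = a \<odot>\<^bsub>L\<^esub> x \<oplus>\<^bsub>L\<^esub> a \<odot>\<^bsub>L\<^esub> y" if "x \<in> carrier L" "y \<in> carrier L" for a x y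
    using that by (auto simp: carrier_q smult_q add_q intro!: q_cong alg_cong.Scale_Add)
  show "(a \<otimes>\<^bsub>Cring\<^esub> b) \<odot>\<^bsub>L\<^esub> x = a \<odot>\<^bsub>L\<^esub> (b \<odot>\<^bsub>L\<^esub> x)" if "x \<in> carrier L" for a b x
    using that by (auto simp: ring_of_type_algebra_def carrier_q smult_q intro!: q_cong alg_cong.sym[OF alg_cong.Scale_Scale])
qed (auto simp: carrier_q smult_q)

lemma lie_algebra_L: "lie_algebra L"
proof -
  interpret Module.module Cring L by (rule module_L)
  have self: "alg_cong R (Prod s s) Zero" for s
    using lie by (intro alg_cong.rel) (auto simp: lie_relations_def)
  have jac: "alg_cong R (Add (Add (Prod s (Prod t u)) (Prod t (Prod u s))) (Prod u (Prod s t))) Zero" for s t u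
    using lie by (intro alg_cong.rel) (auto simp: lie_relations_def)
  show ?thesis
  proof
    show "x \<otimes>\<^bsub>L\<^esub> y \<in> carrier L" if "x \<in> carrier L" "y \<in> carrier L" for x y
      using that by (auto simp: carrier_q mult_q)
    show "(x \<oplus>\<^bsub>L\<^esub> y) \<otimes>\<^bsub>L\<^esub> z = x \<otimes>\<^bsub>L\<^esub> z \<oplus>\<^bsub>L\<^esub> y \<otimes>\<^bsub>L\<^esub> z" if "x \<in> carrier L" "y \<in> carrier L" "z \<in> carrier L" for x y z
      using that by (auto simp: carrier_q mult_q add_q intro!: q_cong alg_cong.Prod_Add_left)
    show "x \<otimes>\<^bsub>L\<^esub> (y \<oplus>\<^bsub>L\<^esub> z) = x \<otimes>\<^bsub>L\<^esub> y \<oplus>\<^bsub>L\<^esub> x \<otimes>\<^bsub>L\<^esub> z" if "x \<in> carrier L" "y \<in> carrier L" "z \<in> carrier L" for x y z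
      using that by (auto simp: carrier_q mult_q add_q intro!: q_cong alg_cong.Prod_Add_right)
    show "(k \<odot>\<^bsub>L\<^esub> x) \<otimes>\<^bsub>L\<^esub> y = k \<odot>\<^bsub>L\<^esub> (x \<otimes>\<^bsub>L\<^esub> y)" if "x \<in> carrier L" "y \<in> carrier L" for k x y
      using that by (auto simp: carrier_q mult_q smult_q intro!: q_cong alg_cong.Prod_Scale_left)
    show "x \<otimes>\<^bsub>L\<^esub> (k \<odot>\<^bsub>L\<^esub> y) = k \<odot>\<^bsub>L\<^esub> (x \<otimes>\<^bsub>L\<^esub> y)" if "x \<in> carrier L" "y \<in> carrier L" for k x y
      using that by (auto simp: carrier_q mult_q smult_q intro!: q_cong alg_cong.Prod_Scale_right)
    show "x \<otimes>\<^bsub>L\<^esub> x = \<zero>\<^bsub>L\<^esub>" if "x \<in> carrier L" for x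
      using that by (auto simp: carrier_q mult_q zero_q intro!: q_cong self)
    show "x \<otimes>\<^bsub>L\<^esub> (y \<otimes>\<^bsub>L\<^esub> z) \<oplus>\<^bsub>L\<^esub> y \<otimes>\<^bsub>L\<^esub> (z \<otimes>\<^bsub>L\<^esub> x) \<oplus>\<^bsub>L\<^esub> z \<otimes>\<^bsub>L\<^esub> (x \<otimes>\<^bsub>L\<^esub> y) = \<zero>\<^bsub>L\<^esub>"
      if "x \<in> carrier L" "y \<in> carrier L" "z \<in> carrier L" for x y z
      using that by (auto simp: carrier_q mult_q add_q zero_q intro!: q_cong jac)
  qed
qed

end

section \<open>Ideals and radical on the level of congruence classes\<close>

lemma alg_class_UNIV: "alg_class UNIV R t = {s. alg_cong R s t}"
  by (simp add: alg_class_def)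

lemma alg_class_eq_iff: "alg_class UNIV R s = alg_class UNIV R t \<longleftrightarrow> alg_cong R s t"
proof
  assume "alg_class UNIV R s = alg_class UNIV R t"
  moreover have "s \<in> alg_class UNIV R s" by (simp add: alg_class_UNIV alg_cong.refl)
  ultimately show "alg_cong R s t" by (simp add: alg_class_UNIV)
next
  assume a: "alg_cong R s t"
  show "alg_class UNIV R s = alg_class UNIV R t"
    unfolding alg_class_UNIV using alg_cong.trans[OF _ a] alg_cong.trans[OF _ alg_cong.sym[OF a]] by blast
qed

lemma presented_UN:
  assumes "\<And>s'. alg_cong R s' s \<Longrightarrow> alg_cong R (f s') (f s)"
  shows "(\<Union>s'\<in>alg_class UNIV R s. alg_class UNIV R (f s')) = alg_class UNIV R (f s)"
proof -
  have "alg_class UNIV R (f s') = alg_class UNIV R (f s)" if "s' \<in> alg_class UNIV R s" for s'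
    using that assms by (simp add: alg_class_eq_iff) (simp add: alg_class_UNIV)
  moreover have "s \<in> alg_class UNIV R s" by (simp add: alg_class_UNIV alg_cong.refl)
  ultimately show ?thesis by blast
qed

lemma presented_UN2:
  assumes "\<And>s' t'. alg_cong R s' s \<Longrightarrow> alg_cong R t' t \<Longrightarrow> alg_cong R (f s' t') (f s t)"
  shows "(\<Union>s'\<in>alg_class UNIV R s. \<Union>t'\<in>alg_class UNIV R t. alg_class UNIV R (f s' t')) = alg_class UNIV R (f s t)"
proof -
  have "alg_class UNIV R (f s' t') = alg_class UNIV R (f s t)" if "s' \<in> alg_class UNIV R s" "t' \<in> alg_class UNIV R t" for s' t'
    using that assms by (simp add: alg_class_eq_iff) (simp add: alg_class_UNIV)
  moreover have "s \<in> alg_class UNIV R s" "t \<in> alg_class UNIV R t" by (simp_all add: alg_class_UNIV alg_cong.refl)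
  ultimately show ?thesis by blast
qed

context kac_moody
begin

abbreviation "cl \<equiv> alg_class UNIV km_rel"
abbreviation "\<gg>\<tt> \<equiv> km_tilde sc \<alpha> \<alpha>v"

lemma tilde_eqs:
  "carrier \<gg>\<tt> = range cl" "\<zero>\<^bsub>\<gg>\<tt>\<^esub> = cl Zero" "cl s \<oplus>\<^bsub>\<gg>\<tt>\<^esub> cl t = cl (Add s t)"
  "cl s \<otimes>\<^bsub>\<gg>\<tt>\<^esub> cl t = cl (Prod s t)" "k \<odot>\<^bsub>\<gg>\<tt>\<^esub> cl t = cl (Scale k t)"
  unfolding km_tilde_def presented_algebra_def km_rel_def[symmetric]
  using presented_UN2[of km_rel s t Add, OF alg_cong.cong_Add] presented_UN2[of km_rel s t Prod, OF alg_cong.cong_Prod]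
    presented_UN[of km_rel t "Scale k", OF alg_cong.cong_Scale]
  by simp_all

sublocale tilde: term_lie_algebra km_rel cl \<gg>\<tt>
proof
  show "lie_relations \<subseteq> km_rel" by (simp add: km_rel_def)
  show "cl s = cl t" if "s \<doteq> t" for s t using that by (simp add: alg_class_eq_iff)
qed (simp_all add: tilde_eqs)

lemma cl_in_image: "term_ideal T \<Longrightarrow> cl t \<in> cl ` T \<longleftrightarrow> t \<in> T"
proof
  assume T: "term_ideal T" and "cl t \<in> cl ` T"
  then obtain s where "s \<in> T" "cl t = cl s" by blast
  then show "t \<in> T" using term_idealD(5)[OF T] alg_class_eq_iff[of km_rel s t] by metis
qed blast

lemma lie_ideal_image:
  assumes T: "term_ideal T"
  shows "lie_ideal \<gg>\<tt> (cl ` T)"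
  unfolding lie_ideal_def
proof (intro conjI ballI)
  interpret Module.module Cring \<gg>\<tt> by (rule tilde.module_L)
  show "submodule (cl ` T) Cring \<gg>\<tt>"
  proof (rule submoduleI)
    show sm: "k \<odot>\<^bsub>\<gg>\<tt>\<^esub> x \<in> cl ` T" if "x \<in> cl ` T" for k x
      using that term_idealD(3)[OF T] by (auto simp: tilde_eqs)
    show "\<ominus>\<^bsub>\<gg>\<tt>\<^esub> x \<in> cl ` T" if "x \<in> cl ` T" for x
    proof -
      obtain t where t: "x = cl t" "t \<in> T" using \<open>x \<in> cl ` T\<close> by blast
      have "cl (Scale (-1) t) \<oplus>\<^bsub>\<gg>\<tt>\<^esub> x = \<zero>\<^bsub>\<gg>\<tt>\<^esub>"
        by (simp add: t tilde_eqs alg_class_eq_iff alg_cong.Add_neg)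
      then have "\<ominus>\<^bsub>\<gg>\<tt>\<^esub> x = cl (Scale (-1) t)" by (rule minus_equality) (auto simp: t tilde_eqs)
      then show ?thesis using t term_idealD(3)[OF T] by auto
    qed
  qed (use term_idealD[OF T] in \<open>auto simp: tilde_eqs\<close>)
  show "x \<otimes>\<^bsub>\<gg>\<tt>\<^esub> y \<in> cl ` T" if "x \<in> carrier \<gg>\<tt>" "y \<in> cl ` T" for x y
    using that term_idealD(4)[OF T] by (auto simp: tilde_eqs)
qed

lemma lie_ideal_terms:
  assumes I: "lie_ideal \<gg>\<tt> I"
  shows "term_ideal {t. cl t \<in> I}" "I = cl ` {t. cl t \<in> I}"
proof -
  interpret submodule I Cring \<gg>\<tt> using I by (simp add: lie_ideal_def)
  have sub: "I \<subseteq> carrier \<gg>\<tt>" using subset by simp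
  show "I = cl ` {t. cl t \<in> I}" using sub unfolding tilde_eqs by auto
  show "term_ideal {t. cl t \<in> I}"
    unfolding term_ideal_def
  proof (intro conjI ballI allI impI; clarsimp)
    show "cl Zero \<in> I" using one_closed by (simp add: tilde_eqs)
    show "cl (Add s t) \<in> I" if "cl s \<in> I" "cl t \<in> I" for s t
      using m_closed[OF that] by (simp add: tilde_eqs)
    show "cl (Scale k s) \<in> I" if "cl s \<in> I" for k s
      using smult_closed[OF _ that, of k] by (simp add: tilde_eqs ring_of_type_algebra_def)
    show "cl (Prod s t) \<in> I" if "cl t \<in> I" for s t
      using I that unfolding lie_ideal_def tilde_eqs by (metis rangeI tilde_eqs(4))
    show "cl t \<in> I" if "cl s \<in> I" "s \<doteq> t" for s t
      using that alg_class_eq_iff[of km_rel s t] by simp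
  qed
qed

lemma cartan_tilde_eq: "cartan_tilde sc \<alpha> \<alpha>v = range (\<lambda>x. cl (Gen (H x)))"
  by (simp add: cartan_tilde_def km_rel_def)

lemma cl_H_eq_zero: "cl (Gen (H x)) = cl Zero \<longleftrightarrow> x = 0"
  unfolding alg_class_eq_iff
proof
  assume "Gen (H x) \<doteq> Zero"
  then show "x = 0" using H_injective[of x 0] alg_cong.trans[OF _ alg_cong.sym[OF H_zero]] by blast
qed (simp add: H_zero)

lemma trivial_ideal_image:
  assumes "trivial_term_ideal T"
  shows "trivial_ideal sc \<alpha> \<alpha>v (cl ` T)"
  unfolding trivial_ideal_def
proof
  have T: "term_ideal T" using assms by (simp add: trivial_term_ideal_def)
  show "lie_ideal \<gg>\<tt> (cl ` T)" by (rule lie_ideal_image[OF T])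
  show "cl ` T \<inter> cartan_tilde sc \<alpha> \<alpha>v = {\<zero>\<^bsub>\<gg>\<tt>\<^esub>}"
  proof (intro equalityI subsetI)
    fix y assume "y \<in> cl ` T \<inter> cartan_tilde sc \<alpha> \<alpha>v"
    then obtain x where x: "y = cl (Gen (H x))" "cl (Gen (H x)) \<in> cl ` T" by (auto simp: cartan_tilde_eq)
    then have "x = 0" using assms cl_in_image[OF T] by (simp add: trivial_term_ideal_def)
    then show "y \<in> {\<zero>\<^bsub>\<gg>\<tt>\<^esub>}" using x cl_H_eq_zero[of x] by (simp add: tilde_eqs)
  next
    fix y assume "y \<in> {\<zero>\<^bsub>\<gg>\<tt>\<^esub>}"
    then have "y = cl Zero" by (simp add: tilde_eqs)
    moreover have "cl Zero \<in> cl ` T" using term_idealD(1)[OF T] by blast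
    moreover have "cl Zero \<in> cartan_tilde sc \<alpha> \<alpha>v"
      using cl_H_eq_zero[of 0] unfolding cartan_tilde_eq by (metis rangeI)
    ultimately show "y \<in> cl ` T \<inter> cartan_tilde sc \<alpha> \<alpha>v" by blast
  qed
qed

lemma trivial_ideal_subset:
  assumes "trivial_ideal sc \<alpha> \<alpha>v I"
  shows "I \<subseteq> cl ` rad"
proof -
  have I: "lie_ideal \<gg>\<tt> I" "I \<inter> cartan_tilde sc \<alpha> \<alpha>v = {\<zero>\<^bsub>\<gg>\<tt>\<^esub>}"
    using assms by (auto simp: trivial_ideal_def)
  have "x = 0" if "cl (Gen (H x)) \<in> I" for x
  proof -
    have "cl (Gen (H x)) \<in> I \<inter> cartan_tilde sc \<alpha> \<alpha>v" using that by (auto simp: cartan_tilde_eq)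
    then show ?thesis unfolding I(2) using cl_H_eq_zero by (simp add: tilde_eqs)
  qed
  then have "trivial_term_ideal {t. cl t \<in> I}"
    unfolding trivial_term_ideal_def using lie_ideal_terms[OF I(1)] by blast
  then have "{t. cl t \<in> I} \<subseteq> rad" using rad_base[of _ "{t. cl t \<in> I}"] by blast
  then show ?thesis using lie_ideal_terms(2)[OF I(1)] by blast
qed

text \<open>The definite description is meaningful because the image of \<open>rad\<close> is
  trivial and contains every trivial ideal, so no other one can be maximal.\<close>

lemma km_radical_eq: "km_radical sc \<alpha> \<alpha>v = cl ` rad"
  unfolding km_radical_def
proof (rule the_equality)
  show "trivial_ideal sc \<alpha> \<alpha>v (cl ` rad) \<and> (\<forall>J. trivial_ideal sc \<alpha> \<alpha>v J \<longrightarrow> cl ` rad \<subseteq> J \<longrightarrow> J = cl ` rad)"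
    using trivial_ideal_image[OF rad_trivial] trivial_ideal_subset by blast
  show "I = cl ` rad" if "trivial_ideal sc \<alpha> \<alpha>v I \<and> (\<forall>J. trivial_ideal sc \<alpha> \<alpha>v J \<longrightarrow> I \<subseteq> J \<longrightarrow> J = I)" for I
    using that trivial_ideal_image[OF rad_trivial] trivial_ideal_subset[of I] by blast
qed

subsection \<open>The quotient by the radical\<close>

abbreviation "\<gg> \<equiv> kac_moody_algebra sc \<alpha> \<alpha>v"

text \<open>This is the coset of \<open>cl t\<close>, as \<open>coset_eq_proj\<close> confirms,
  written so that equality of cosets becomes membership of a difference of terms in
  \<open>rad\<close>.\<close>

definition proj :: "('h, 'n) km_gen alg_term \<Rightarrow> ('h, 'n) km_gen alg_term set set" where
  "proj t = cl ` {s. Add s (Scale (-1) t) \<in> rad}"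

lemma rad_diff_refl: "Add t (Scale (-1) t) \<in> rad"
  by (rule rad_cong[OF rad_Zero linI]) simp

lemma rad_diff_cong: "s \<doteq> t \<Longrightarrow> Add s (Scale (-1) t) \<in> rad"
  by (rule rad_cong[OF rad_Zero alg_cong.sym]) (simp only: diff_Zero_iff)

lemma rad_diff_sym:
  assumes "Add s (Scale (-1) t) \<in> rad"
  shows "Add t (Scale (-1) s) \<in> rad"
  by (rule rad_cong[OF rad_Scale[OF assms, of "-1"] linI]) simp

lemma rad_diff_trans:
  assumes "Add s (Scale (-1) t) \<in> rad" "Add t (Scale (-1) u) \<in> rad"
  shows "Add s (Scale (-1) u) \<in> rad"
  by (rule rad_cong[OF rad_Add[OF assms] linI]) simp

lemma proj_eq_iff: "proj s = proj t \<longleftrightarrow> Add s (Scale (-1) t) \<in> rad"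
proof
  assume "proj s = proj t"
  then have "cl s \<in> proj t" using rad_diff_refl unfolding proj_def by blast
  then obtain u where u: "s \<doteq> u" "Add u (Scale (-1) t) \<in> rad" unfolding proj_def by (auto simp: alg_class_eq_iff)
  then show "Add s (Scale (-1) t) \<in> rad" using rad_diff_trans[OF rad_diff_cong] by blast
next
  assume "Add s (Scale (-1) t) \<in> rad"
  then show "proj s = proj t"
    unfolding proj_def using rad_diff_trans rad_diff_sym by blast
qed

lemma coset_eq_proj: "km_radical sc \<alpha> \<alpha>v +>\<^bsub>\<gg>\<tt>\<^esub> cl t = proj t"
proof -
  have "km_radical sc \<alpha> \<alpha>v +>\<^bsub>\<gg>\<tt>\<^esub> cl t = (\<lambda>r. cl (Add r t)) ` rad"
    unfolding a_r_coset_def' km_radical_eq by (auto simp: tilde_eqs)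
  also have "\<dots> = proj t"
  proof (intro equalityI subsetI)
    fix y assume "y \<in> (\<lambda>r. cl (Add r t)) ` rad"
    then obtain r where r: "y = cl (Add r t)" "r \<in> rad" by blast
    have "Add (Add r t) (Scale (-1) t) \<in> rad" by (rule rad_cong[OF r(2) linI]) simp
    then show "y \<in> proj t" using r(1) by (auto simp: proj_def)
  next
    fix y assume "y \<in> proj t"
    then obtain s where s: "y = cl s" "Add s (Scale (-1) t) \<in> rad" by (auto simp: proj_def)
    have "s \<doteq> Add (Add s (Scale (-1) t)) t" by (rule linI) simp
    then have "y = cl (Add (Add s (Scale (-1) t)) t)" using s(1) by (simp add: alg_class_eq_iff)
    then show "y \<in> (\<lambda>r. cl (Add r t)) ` rad" using s(2) by blast
  qed
  finally show ?thesis .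
qed

lemma in_proj: "cl s \<in> proj s"
  using rad_diff_refl unfolding proj_def by blast

lemma proj_cases:
  assumes "x \<in> proj t"
  obtains s where "x = cl s" "proj s = proj t"
proof -
  obtain s where s: "x = cl s" "Add s (Scale (-1) t) \<in> rad" using assms unfolding proj_def by blast
  show thesis by (rule that[OF s(1)]) (simp only: proj_eq_iff s(2))
qed

lemma proj_cong: "s \<doteq> t \<Longrightarrow> proj s = proj t"
  using proj_eq_iff rad_diff_cong by blast

lemma proj_Scale: "proj s = proj t \<Longrightarrow> proj (Scale k s) = proj (Scale k t)"
proof -
  assume "proj s = proj t"
  then have "Add s (Scale (-1) t) \<in> rad" by (simp only: proj_eq_iff)
  from rad_Scale[OF this, of k] show "proj (Scale k s) = proj (Scale k t)"
    unfolding proj_eq_iff by (rule rad_cong[OF _ linI]) (simp add: right_diff_distrib)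
qed

lemma proj_Add: "proj s = proj s' \<Longrightarrow> proj t = proj t' \<Longrightarrow> proj (Add s t) = proj (Add s' t')"
proof -
  assume "proj s = proj s'" "proj t = proj t'"
  then have "Add s (Scale (-1) s') \<in> rad" "Add t (Scale (-1) t') \<in> rad" by (simp_all add: proj_eq_iff)
  from rad_Add[OF this] show "proj (Add s t) = proj (Add s' t')"
    unfolding proj_eq_iff by (rule rad_cong[OF _ linI]) simp
qed

lemma proj_Prod:
  assumes "proj s = proj s'" "proj t = proj t'"
  shows "proj (Prod s t) = proj (Prod s' t')"
proof -
  have right: "proj (Prod u t) = proj (Prod u t')" if "proj t = proj t'" for u t t'
  proof -
    have "Prod u (Add t (Scale (-1) t')) \<doteq> Add (Prod u t) (Prod u (Scale (-1) t'))" by (rule alg_cong.Prod_Add_right)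
    also have "\<dots> \<doteq> Add (Prod u t) (Scale (-1) (Prod u t'))"
      by (intro alg_cong.cong_Add alg_cong.refl alg_cong.Prod_Scale_right)
    finally show ?thesis using that rad_cong[OF rad_Prod] unfolding proj_eq_iff by blast
  qed
  have "proj (Prod s t) = proj (Prod s t')" by (rule right[OF assms(2)])
  also have "\<dots> = proj (Scale (-1) (Prod t' s))" by (rule proj_cong[OF Prod_antisym])
  also have "\<dots> = proj (Scale (-1) (Prod t' s'))" by (rule proj_Scale[OF right[OF assms(1)]])
  also have "\<dots> = proj (Prod s' t')" by (rule proj_cong[OF alg_cong.sym[OF Prod_antisym]])
  finally show ?thesis .
qed

lemma carrier_km: "carrier \<gg> = range proj"
  unfolding kac_moody_algebra_def lie_quotient_def FactRing_def ring.extend_def ring.fields_def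
  by (simp add: A_RCOSETS_def' tilde_eqs(1) coset_eq_proj UNION_singleton_eq_range image_image)

lemma zero_km: "\<zero>\<^bsub>\<gg>\<^esub> = proj Zero"
proof -
  have "\<zero>\<^bsub>\<gg>\<^esub> = cl ` rad"
    unfolding kac_moody_algebra_def lie_quotient_def FactRing_def ring.extend_def ring.fields_def
    by (simp add: km_radical_eq)
  also have "\<dots> = proj Zero"
  proof -
    have "Add s (Scale (-1) Zero) \<in> rad \<longleftrightarrow> s \<in> rad" for s
      using rad_cong[OF _ linI, of "Add s (Scale (-1) Zero)" s] rad_cong[OF _ linI, of s "Add s (Scale (-1) Zero)"] by auto
    then show ?thesis by (simp add: proj_def)
  qed
  finally show ?thesis .
qed

lemma add_km: "proj s \<oplus>\<^bsub>\<gg>\<^esub> proj t = proj (Add s t)"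
proof -
  have "proj s \<oplus>\<^bsub>\<gg>\<^esub> proj t = (\<Union>x\<in>proj s. \<Union>y\<in>proj t. {x \<oplus>\<^bsub>\<gg>\<tt>\<^esub> y})"
    unfolding kac_moody_algebra_def lie_quotient_def FactRing_def ring.extend_def ring.fields_def
    by (simp add: set_add_def')
  also have "\<dots> = proj (Add s t)"
  proof (intro equalityI subsetI)
    fix z assume "z \<in> (\<Union>x\<in>proj s. \<Union>y\<in>proj t. {x \<oplus>\<^bsub>\<gg>\<tt>\<^esub> y})"
    then obtain x y where xy: "x \<in> proj s" "y \<in> proj t" "z = x \<oplus>\<^bsub>\<gg>\<tt>\<^esub> y" by blast
    obtain s' where s': "x = cl s'" "proj s' = proj s" using proj_cases[OF xy(1)] .
    obtain t' where t': "y = cl t'" "proj t' = proj t" using proj_cases[OF xy(2)] .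
    have "z = cl (Add s' t')" using xy(3) s' t' by (simp add: tilde_eqs)
    then show "z \<in> proj (Add s t)" using in_proj proj_Add[OF s'(2) t'(2)] by metis
  next
    fix z assume "z \<in> proj (Add s t)"
    then obtain u where u: "z = cl u" "proj u = proj (Add s t)" by (rule proj_cases)
    have "Add s (Add u (Scale (-1) s)) \<doteq> u" by (rule linI) simp
    then have "z = cl s \<oplus>\<^bsub>\<gg>\<tt>\<^esub> cl (Add u (Scale (-1) s))" using u by (simp add: tilde_eqs alg_class_eq_iff alg_cong.sym)
    moreover have "proj (Add u (Scale (-1) s)) = proj (Add (Add s t) (Scale (-1) s))" by (rule proj_Add[OF u(2) HOL.refl])
    moreover have "\<dots> = proj t" by (rule proj_cong[OF linI]) simp
    ultimately show "z \<in> (\<Union>x\<in>proj s. \<Union>y\<in>proj t. {x \<oplus>\<^bsub>\<gg>\<tt>\<^esub> y})" using in_proj by blast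
  qed
  finally show ?thesis .
qed

lemma mult_km: "proj s \<otimes>\<^bsub>\<gg>\<^esub> proj t = proj (Prod s t)"
proof -
  have "proj s \<otimes>\<^bsub>\<gg>\<^esub> proj t = (\<Union>x\<in>proj s. \<Union>y\<in>proj t. km_radical sc \<alpha> \<alpha>v +>\<^bsub>\<gg>\<tt>\<^esub> (x \<otimes>\<^bsub>\<gg>\<tt>\<^esub> y))"
    unfolding kac_moody_algebra_def lie_quotient_def FactRing_def ring.extend_def ring.fields_def
    by (simp add: rcoset_mult_def)
  moreover have "km_radical sc \<alpha> \<alpha>v +>\<^bsub>\<gg>\<tt>\<^esub> (x \<otimes>\<^bsub>\<gg>\<tt>\<^esub> y) = proj (Prod s t)" if xs: "x \<in> proj s" and yt: "y \<in> proj t" for x y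
  proof -
    obtain s' where s': "x = cl s'" "proj s' = proj s" using xs by (rule proj_cases)
    obtain t' where t': "y = cl t'" "proj t' = proj t" using yt by (rule proj_cases)
    show ?thesis unfolding s'(1) t'(1) tilde_eqs coset_eq_proj by (rule proj_Prod[OF s'(2) t'(2)])
  qed
  ultimately show ?thesis using in_proj by blast
qed

lemma smult_km: "k \<odot>\<^bsub>\<gg>\<^esub> proj t = proj (Scale k t)"
proof -
  have "k \<odot>\<^bsub>\<gg>\<^esub> proj t = (\<Union>x\<in>proj t. km_radical sc \<alpha> \<alpha>v +>\<^bsub>\<gg>\<tt>\<^esub> (k \<odot>\<^bsub>\<gg>\<tt>\<^esub> x))"
    unfolding kac_moody_algebra_def lie_quotient_def FactRing_def ring.extend_def ring.fields_def
    by simp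
  moreover have "km_radical sc \<alpha> \<alpha>v +>\<^bsub>\<gg>\<tt>\<^esub> (k \<odot>\<^bsub>\<gg>\<tt>\<^esub> x) = proj (Scale k t)" if xt: "x \<in> proj t" for x
  proof -
    obtain s where s: "x = cl s" "proj s = proj t" using xt by (rule proj_cases)
    show ?thesis unfolding s(1) tilde_eqs coset_eq_proj by (rule proj_Scale[OF s(2)])
  qed
  ultimately show ?thesis using in_proj by blast
qed

sublocale km: term_lie_algebra km_rel proj \<gg>
proof
  show "lie_relations \<subseteq> km_rel" by (rule tilde.lie)
qed (fact proj_cong carrier_km zero_km add_km mult_km smult_km)+

definition cart :: "'h \<Rightarrow> ('h, 'n) km_gen alg_term set set" where
  "cart x = proj (Gen (H x))"

lemma cartan_subalgebra_eq: "cartan_subalgebra sc \<alpha> \<alpha>v = range cart"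
  unfolding cartan_subalgebra_def cartan_tilde_eq cart_def by (simp add: image_image coset_eq_proj)

text \<open>The radical meets the Cartan subalgebra trivially, so the latter embeds into the
  quotient.\<close>

lemma cart_inj: "inj cart"
proof (rule injI)
  fix x y assume "cart x = cart y"
  then have "Add (Gen (H x)) (Scale (-1) (Gen (H y))) \<in> rad" unfolding cart_def proj_eq_iff .
  moreover have "Add (Gen (H x)) (Scale (-1) (Gen (H y))) \<doteq> Gen (H (x + sc (-1) y))"
    using alg_cong.trans[OF alg_cong.cong_Add[OF alg_cong.refl alg_cong.sym[OF rel_H_scale]] alg_cong.sym[OF rel_H_add]] .
  ultimately have "Gen (H (x + sc (-1) y)) \<in> rad" by (rule rad_cong)
  then have "x + sc (-1) y = 0" using rad_trivial unfolding trivial_term_ideal_def by blast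
  then show "x = y" by simp
qed

lemma cart_ops: "cart (x + y) = cart x \<oplus>\<^bsub>\<gg>\<^esub> cart y" "cart (sc k x) = k \<odot>\<^bsub>\<gg>\<^esub> cart x"
  "cart x \<otimes>\<^bsub>\<gg>\<^esub> cart y = cart 0" "cart x \<in> carrier \<gg>"
proof -
  show "cart (x + y) = cart x \<oplus>\<^bsub>\<gg>\<^esub> cart y" unfolding cart_def add_km by (rule proj_cong[OF rel_H_add])
  show "cart (sc k x) = k \<odot>\<^bsub>\<gg>\<^esub> cart x" unfolding cart_def smult_km by (rule proj_cong[OF rel_H_scale])
  show "cart x \<otimes>\<^bsub>\<gg>\<^esub> cart y = cart 0"
    unfolding cart_def mult_km by (rule proj_cong[OF alg_cong.trans[OF rel_HH alg_cong.sym[OF H_zero]]])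
  show "cart x \<in> carrier \<gg>" by (simp add: cart_def carrier_km)
qed

end

section \<open>The enveloping algebra of the Cartan subalgebra\<close>

context kac_moody
begin

abbreviation "\<hh> \<equiv> \<gg>\<lparr>carrier := range cart\<rparr>"
definition "env_gens = insert None (Some ` range cart)"
definition "env_rel = env_relations \<hh>"

lemma env_generators_eq: "env_generators \<hh> = env_gens"
  by (simp add: env_generators_def env_gens_def)

abbreviation envc (infix "\<asymp>" 50) where "s \<asymp> t \<equiv> alg_cong env_rel s t"
abbreviation "hgen x \<equiv> Gen (Some (cart x))"

lemma env_assoc: "Prod (Prod s t) u \<asymp> Prod s (Prod t u)"
  and env_unit_left: "Prod (Gen None) s \<asymp> s"
  and env_unit_right: "Prod s (Gen None) \<asymp> s"
  by (auto intro!: alg_cong.rel simp: env_rel_def env_relations_def)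

lemma env_add: "hgen (x + y) \<asymp> Add (hgen x) (hgen y)"
  by (rule alg_cong.rel) (auto simp: env_rel_def env_relations_def cart_ops)

lemma env_scale: "hgen (sc k x) \<asymp> Scale k (hgen x)"
  by (rule alg_cong.rel) (auto simp: env_rel_def env_relations_def cart_ops)

lemma env_zero: "hgen 0 \<asymp> Zero"
  using alg_cong.trans[OF env_scale[of 0 0] Scale_0] by simp

lemma env_gen_comm: "Prod (hgen x) (hgen y) \<asymp> Prod (hgen y) (hgen x)"
proof -
  have "hgen 0 \<asymp> Add (Prod (hgen x) (hgen y)) (Scale (-1) (Prod (hgen y) (hgen x)))"
    by (rule alg_cong.rel) (auto simp: env_rel_def env_relations_def cart_ops(3)[symmetric])
  then have "Add (Prod (hgen x) (hgen y)) (Scale (-1) (Prod (hgen y) (hgen x))) \<asymp> Zero"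
    using alg_cong.trans[OF alg_cong.sym env_zero] by blast
  then show ?thesis by (simp only: diff_Zero_iff)
qed

definition env_term where "env_term t \<longleftrightarrow> set_alg_term t \<subseteq> env_gens"

lemma env_term_simps [simp]:
  "env_term (Gen None)" "env_term (hgen x)" "env_term Zero"
  "env_term (Add s t) \<longleftrightarrow> env_term s \<and> env_term t" "env_term (Prod s t) \<longleftrightarrow> env_term s \<and> env_term t"
  "env_term (Scale k s) \<longleftrightarrow> env_term s"
  by (auto simp: env_term_def env_gens_def)

lemma env_term_cases:
  assumes "env_term (Gen g)" obtains "g = None" | x where "g = Some (cart x)"
  using assms by (auto simp: env_term_def env_gens_def)

text \<open>Extends commutation from generators to terms in one argument; \<open>env_comm\<close>
  applies it once for each argument.\<close>

lemma comm_closure: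
  assumes "\<And>g. env_term (Gen g) \<Longrightarrow> Prod s (Gen g) \<asymp> Prod (Gen g) s"
  shows "env_term t \<Longrightarrow> Prod s t \<asymp> Prod t s"
proof (induction t)
  case Zero
  show ?case by (rule alg_cong.trans[OF Prod_Zero_right alg_cong.sym[OF Prod_Zero_left]])
next
  case (Add t u)
  have "Prod s (Add t u) \<asymp> Add (Prod s t) (Prod s u)" by (rule alg_cong.Prod_Add_right)
  also have "\<dots> \<asymp> Add (Prod t s) (Prod u s)" using Add by (intro alg_cong.cong_Add) auto
  also have "\<dots> \<asymp> Prod (Add t u) s" by (rule alg_cong.sym[OF alg_cong.Prod_Add_left])
  finally show ?case .
next
  case (Scale k t)
  have "Prod s (Scale k t) \<asymp> Scale k (Prod s t)" by (rule alg_cong.Prod_Scale_right)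
  also have "\<dots> \<asymp> Scale k (Prod t s)" using Scale by (intro alg_cong.cong_Scale) auto
  also have "\<dots> \<asymp> Prod (Scale k t) s" by (rule alg_cong.sym[OF alg_cong.Prod_Scale_left])
  finally show ?case .
next
  case (Prod t u)
  have "alg_term.Prod s (alg_term.Prod t u) \<asymp> alg_term.Prod (alg_term.Prod s t) u" by (rule alg_cong.sym[OF env_assoc])
  also have "\<dots> \<asymp> alg_term.Prod (alg_term.Prod t s) u" using Prod by (intro alg_cong.cong_Prod[OF _ alg_cong.refl]) auto
  also have "\<dots> \<asymp> alg_term.Prod t (alg_term.Prod s u)" by (rule env_assoc)
  also have "\<dots> \<asymp> alg_term.Prod t (alg_term.Prod u s)" using Prod by (intro alg_cong.cong_Prod[OF alg_cong.refl]) auto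
  also have "\<dots> \<asymp> alg_term.Prod (alg_term.Prod t u) s" by (rule alg_cong.sym[OF env_assoc])
  finally show ?case .
qed (use assms in auto)

lemma env_comm:
  assumes "env_term s" "env_term t"
  shows "Prod s t \<asymp> Prod t s"
proof (rule comm_closure[OF _ assms(2)])
  fix g :: "('h, 'n) km_gen alg_term set set option"
  assume g: "env_term (Gen g)"
  have "Prod (Gen g) s \<asymp> Prod s (Gen g)"
  proof (rule comm_closure[OF _ assms(1)])
    fix g' :: "('h, 'n) km_gen alg_term set set option"
    assume g': "env_term (Gen g')"
    show "Prod (Gen g) (Gen g') \<asymp> Prod (Gen g') (Gen g)"
      using env_term_cases[OF g] env_term_cases[OF g'] env_gen_comm
        alg_cong.trans[OF env_unit_left alg_cong.sym[OF env_unit_right]]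
        alg_cong.trans[OF env_unit_right alg_cong.sym[OF env_unit_left]] by metis
  qed
  then show "Prod s (Gen g) \<asymp> Prod (Gen g) s" by (rule alg_cong.sym)
qed

text \<open>Identifies the enveloping algebra with polynomial functions on the dual space. A
  congruence may pass through terms with generators outside the Cartan subalgebra, because the
  relations for associativity and unit range over all terms; such generators are sent to 0.\<close>

primrec ev :: "('h, 'n) km_gen alg_term set set option alg_term \<Rightarrow> ('h \<Rightarrow> complex) \<Rightarrow> complex" where
  "ev (Gen g) c = (case g of None \<Rightarrow> 1 | Some y \<Rightarrow> if y \<in> range cart then lam c (inv_into UNIV cart y) else 0)"
| "ev Zero c = 0"
| "ev (Add s t) c = ev s c + ev t c"
| "ev (Scale k s) c = k * ev s c"
| "ev (Prod s t) c = ev s c * ev t c"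

lemma ev_hgen: "ev (hgen x) c = lam c x"
  by (simp add: inv_f_f[OF cart_inj])

lemma ev_rel:
  assumes "(s, t) \<in> env_rel" shows "ev s c = ev t c"
proof -
  show ?thesis using assms unfolding env_rel_def env_relations_def
    by (auto simp: cart_ops(1,2)[symmetric] cart_ops(3) inj_eq[OF cart_inj] inv_f_f[OF cart_inj] lam_add lam_scale lam_zero)
qed

lemma ev_cong: "s \<asymp> t \<Longrightarrow> ev s c = ev t c"
  by (induction rule: alg_cong.induct) (simp_all add: ev_rel algebra_simps)

subsection \<open>Faithfulness of the evaluation\<close>

text \<open>Vanishing at points with natural coordinates suffices; this is what makes a free module small.\<close>

definition nat_points :: "('h \<Rightarrow> complex) set" where
  "nat_points = {c. (\<forall>b\<in>basis. c b \<in> \<nat>) \<and> (\<forall>b. b \<notin> basis \<longrightarrow> c b = 0)}"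

definition terms_over :: "'h set \<Rightarrow> ('h, 'n) km_gen alg_term set set option alg_term set" where
  "terms_over B = {t. set_alg_term t \<subseteq> insert None (Some ` cart ` B)}"

lemma terms_over_simps [simp]:
  "Gen None \<in> terms_over B" "Zero \<in> terms_over B"
  "Add s t \<in> terms_over B \<longleftrightarrow> s \<in> terms_over B \<and> t \<in> terms_over B"
  "Prod s t \<in> terms_over B \<longleftrightarrow> s \<in> terms_over B \<and> t \<in> terms_over B"
  "Scale k s \<in> terms_over B \<longleftrightarrow> s \<in> terms_over B"
  "hgen x \<in> terms_over B \<longleftrightarrow> x \<in> B"
  using cart_inj by (auto simp: terms_over_def inj_eq)

lemma terms_over_env_term: "t \<in> terms_over B \<Longrightarrow> env_term t"
  by (auto simp: terms_over_def env_term_def env_gens_def)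

lemma terms_over_cases:
  assumes "Gen g \<in> terms_over B" obtains "g = None" | b where "g = Some (cart b)" "b \<in> B"
  using assms by (auto simp: terms_over_def)

lemma terms_over_basis: "env_term t \<Longrightarrow> \<exists>s\<in>terms_over basis. t \<asymp> s"
proof (induction t)
  case (Gen g)
  have h: "\<exists>s\<in>terms_over basis. hgen x \<asymp> s" for x
  proof -
    have "x \<in> V.span basis" using basis by simp
    then show ?thesis
    proof (induction rule: V.span_induct_alt)
      case base
      show ?case using env_zero by (intro bexI[of _ Zero]) auto
    next
      case (step k b y)
      then obtain s where s: "s \<in> terms_over basis" "hgen y \<asymp> s" by blast
      have "hgen (sc k b + y) \<asymp> Add (Scale k (hgen b)) s"
        by (rule alg_cong.trans[OF env_add alg_cong.cong_Add[OF env_scale s(2)]])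
      then show ?case using s step by (intro bexI[of _ "Add (Scale k (hgen b)) s"]) auto
    qed
  qed
  from Gen show ?case
  proof (rule env_term_cases)
    assume "g = None"
    then show ?thesis using alg_cong.refl terms_over_simps(1) by blast
  qed (use h in blast)
next
  case Zero
  show ?case using alg_cong.refl terms_over_simps(2) by blast
next
  case (Add s t)
  then obtain s' t' where "s' \<in> terms_over basis" "t' \<in> terms_over basis" "s \<asymp> s'" "t \<asymp> t'" by auto
  then show ?case using alg_cong.cong_Add by (intro bexI[of _ "Add s' t'"]) auto
next
  case (Scale k s)
  then obtain s' where "s' \<in> terms_over basis" "s \<asymp> s'" by auto
  then show ?case using alg_cong.cong_Scale by (intro bexI[of _ "Scale k s'"]) auto
next
  case (Prod s t)
  then obtain s' t' where "s' \<in> terms_over basis" "t' \<in> terms_over basis" "s \<asymp> s'" "t \<asymp> t'" by auto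
  then show ?case using alg_cong.cong_Prod by (intro bexI[of _ "alg_term.Prod s' t'"]) auto
qed

text \<open>Polynomials in one generator b whose coefficients are terms in the other
  generators.\<close>

primrec horner where
  "horner b [] = Zero"
| "horner b (t # ts) = Add t (Prod (hgen b) (horner b ts))"

lemma horner_Zero: "(\<And>t. t \<in> set ts \<Longrightarrow> t \<asymp> Zero) \<Longrightarrow> horner b ts \<asymp> Zero"
proof (induction ts)
  case (Cons t ts)
  have "horner b (t # ts) \<asymp> Add Zero (Prod (hgen b) Zero)"
    using Cons by (auto intro!: alg_cong.cong_Add alg_cong.cong_Prod alg_cong.refl)
  also have "\<dots> \<asymp> Zero" by (rule alg_cong.trans[OF alg_cong.Add_Zero Prod_Zero_right])
  finally show ?case .
qed (simp add: alg_cong.refl)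

lemma horner_Add: "set ts \<subseteq> terms_over B \<Longrightarrow> set us \<subseteq> terms_over B \<Longrightarrow>
  \<exists>vs. set vs \<subseteq> terms_over B \<and> Add (horner b ts) (horner b us) \<asymp> horner b vs"
proof (induction ts us rule: list_induct2')
  case 1
  show ?case by (intro exI[of _ "[]"]) (simp add: alg_cong.Add_Zero)
next
  case (2 t ts)
  then show ?case by (intro exI[of _ "t # ts"]) (simp add: Add_Zero_right)
next
  case (3 u us)
  then show ?case by (intro exI[of _ "u # us"]) (simp add: alg_cong.Add_Zero)
next
  case (4 t ts u us)
  then obtain vs where vs: "set vs \<subseteq> terms_over B" "Add (horner b ts) (horner b us) \<asymp> horner b vs" by auto
  have "Add (horner b (t # ts)) (horner b (u # us))
      \<asymp> Add (Add t u) (Add (Prod (hgen b) (horner b ts)) (Prod (hgen b) (horner b us)))"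
    by (simp add: Add_interchange)
  also have "\<dots> \<asymp> Add (Add t u) (Prod (hgen b) (Add (horner b ts) (horner b us)))"
    by (intro alg_cong.cong_Add alg_cong.refl alg_cong.sym[OF alg_cong.Prod_Add_right])
  also have "\<dots> \<asymp> horner b (Add t u # vs)"
    using vs(2) by (auto intro!: alg_cong.cong_Add alg_cong.cong_Prod alg_cong.refl)
  finally show ?case using vs 4(2,3) by (intro exI[of _ "Add t u # vs"]) auto
qed

lemma horner_Scale: "Scale k (horner b ts) \<asymp> horner b (map (Scale k) ts)"
proof (induction ts)
  case (Cons t ts)
  have "Scale k (horner b (t # ts)) \<asymp> Add (Scale k t) (Scale k (Prod (hgen b) (horner b ts)))"
    by (simp add: alg_cong.Scale_Add)
  also have "\<dots> \<asymp> Add (Scale k t) (Prod (hgen b) (Scale k (horner b ts)))"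
    by (intro alg_cong.cong_Add alg_cong.refl alg_cong.sym[OF alg_cong.Prod_Scale_right])
  also have "\<dots> \<asymp> horner b (map (Scale k) (t # ts))"
    using Cons by (auto intro!: alg_cong.cong_Add alg_cong.cong_Prod alg_cong.refl)
  finally show ?case .
qed (simp add: Scale_Zero)

lemma horner_mult: "env_term s \<Longrightarrow> Prod s (horner b ts) \<asymp> horner b (map (Prod s) ts)"
proof (induction ts)
  case (Cons t ts)
  have "Prod s (horner b (t # ts)) \<asymp> Add (Prod s t) (Prod s (Prod (hgen b) (horner b ts)))"
    by (simp add: alg_cong.Prod_Add_right)
  also have "\<dots> \<asymp> Add (Prod s t) (Prod (Prod s (hgen b)) (horner b ts))"
    by (intro alg_cong.cong_Add alg_cong.refl alg_cong.sym[OF env_assoc])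
  also have "\<dots> \<asymp> Add (Prod s t) (Prod (Prod (hgen b) s) (horner b ts))"
    using Cons.prems by (intro alg_cong.cong_Add alg_cong.cong_Prod alg_cong.refl env_comm) auto
  also have "\<dots> \<asymp> Add (Prod s t) (Prod (hgen b) (Prod s (horner b ts)))"
    by (intro alg_cong.cong_Add alg_cong.refl env_assoc)
  also have "\<dots> \<asymp> horner b (map (Prod s) (t # ts))"
    using Cons by (auto intro!: alg_cong.cong_Add alg_cong.cong_Prod alg_cong.refl)
  finally show ?case .
qed (simp add: Prod_Zero_right)

lemma horner_Prod: "set ts \<subseteq> terms_over B \<Longrightarrow> set us \<subseteq> terms_over B \<Longrightarrow>
  \<exists>vs. set vs \<subseteq> terms_over B \<and> Prod (horner b ts) (horner b us) \<asymp> horner b vs"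
proof (induction ts)
  case Nil
  show ?case by (intro exI[of _ "[]"]) (simp add: Prod_Zero_left)
next
  case (Cons t ts)
  then obtain vs where vs: "set vs \<subseteq> terms_over B" "Prod (horner b ts) (horner b us) \<asymp> horner b vs" by auto
  have t: "t \<in> terms_over B" using Cons.prems by simp
  have "Prod (horner b (t # ts)) (horner b us) \<asymp> Add (Prod t (horner b us)) (Prod (Prod (hgen b) (horner b ts)) (horner b us))"
    by (simp add: alg_cong.Prod_Add_left)
  also have "\<dots> \<asymp> Add (horner b (map (Prod t) us)) (Prod (hgen b) (Prod (horner b ts) (horner b us)))"
    by (intro alg_cong.cong_Add horner_mult terms_over_env_term[OF t] env_assoc)
  also have "\<dots> \<asymp> Add (horner b (map (Prod t) us)) (Prod (hgen b) (horner b vs))"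
    by (intro alg_cong.cong_Add alg_cong.cong_Prod alg_cong.refl vs(2))
  also have "\<dots> \<asymp> Add (horner b (map (Prod t) us)) (horner b (Zero # vs))"
    by (auto intro!: alg_cong.cong_Add alg_cong.refl alg_cong.sym[OF alg_cong.Add_Zero])
  finally have e: "Prod (horner b (t # ts)) (horner b us) \<asymp> Add (horner b (map (Prod t) us)) (horner b (Zero # vs))" .
  have "set (map (Prod t) us) \<subseteq> terms_over B" "set (Zero # vs) \<subseteq> terms_over B" using Cons.prems vs t by auto
  from horner_Add[OF this, of b] obtain ws where
    "set ws \<subseteq> terms_over B" "Add (horner b (map (Prod t) us)) (horner b (Zero # vs)) \<asymp> horner b ws" by blast
  then show ?case using alg_cong.trans[OF e] by blast
qed

lemma horner_form:
  "t \<in> terms_over (insert b B) \<Longrightarrow> \<exists>ts. set ts \<subseteq> terms_over B \<and> t \<asymp> horner b ts"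
proof (induction t)
  case (Gen g)
  have one: "\<exists>ts. set ts \<subseteq> terms_over B \<and> Gen g \<asymp> horner b ts" if "Gen g \<in> terms_over B"
  proof -
    have "Gen g \<asymp> Add (Gen g) Zero" by (rule alg_cong.sym[OF Add_Zero_right])
    also have "\<dots> \<asymp> horner b [Gen g]"
      by (auto intro!: alg_cong.cong_Add alg_cong.refl alg_cong.sym[OF Prod_Zero_right])
    finally show ?thesis using that by (intro exI[of _ "[Gen g]"]) auto
  qed
  from Gen show ?case
  proof (rule terms_over_cases)
    assume "g = None"
    then show ?thesis using one by simp
  next
    fix b' assume b': "g = Some (cart b')" "b' \<in> insert b B"
    show ?thesis
    proof (cases "b' = b")
      case True
      have "hgen b \<asymp> Prod (hgen b) (Gen None)" by (rule alg_cong.sym[OF env_unit_right])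
      also have "\<dots> \<asymp> Prod (hgen b) (horner b [Gen None])"
        by (auto intro!: alg_cong.cong_Prod alg_cong.refl alg_cong.sym[OF alg_cong.trans[OF alg_cong.cong_Add[OF alg_cong.refl Prod_Zero_right] Add_Zero_right]])
      also have "\<dots> \<asymp> horner b [Zero, Gen None]" by (simp add: alg_cong.sym[OF alg_cong.Add_Zero])
      finally show ?thesis using b' True by (intro exI[of _ "[Zero, Gen None]"]) auto
    next
      case False
      then show ?thesis using one b' by simp
    qed
  qed
next
  case Zero
  show ?case by (intro exI[of _ "[]"]) (simp add: alg_cong.refl)
next
  case (Add s t)
  then obtain ts us where "set ts \<subseteq> terms_over B" "s \<asymp> horner b ts" "set us \<subseteq> terms_over B" "t \<asymp> horner b us" by auto
  then show ?case using horner_Add[of ts B us b] alg_cong.trans[OF alg_cong.cong_Add] by meson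
next
  case (Scale k s)
  then obtain ts where "set ts \<subseteq> terms_over B" "s \<asymp> horner b ts" by auto
  then show ?case using alg_cong.trans[OF alg_cong.cong_Scale horner_Scale]
    by (intro exI[of _ "map (Scale k) ts"]) auto
next
  case (Prod s t)
  then obtain ts us where "set ts \<subseteq> terms_over B" "s \<asymp> horner b ts" "set us \<subseteq> terms_over B" "t \<asymp> horner b us" by auto
  then show ?case using horner_Prod[of ts B us b] alg_cong.trans[OF alg_cong.cong_Prod] by meson
qed

lemma ev_horner: "b \<in> basis \<Longrightarrow> ev (horner b ts) c = poly (Poly (map (\<lambda>t. ev t c) ts)) (c b)"
  by (induction ts) (simp_all add: ev_hgen lam_basis del: ev.simps(1))

lemma ev_terms_over_cong:
  "t \<in> terms_over B \<Longrightarrow> B \<subseteq> basis \<Longrightarrow> (\<And>b. b \<in> B \<Longrightarrow> c b = c' b) \<Longrightarrow> ev t c = ev t c'"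
proof (induction t)
  case (Gen g)
  from Gen(1) show ?case
  proof (rule terms_over_cases)
    fix b assume "g = Some (cart b)" "b \<in> B"
    then show ?thesis using Gen(2,3) by (simp add: ev_hgen lam_basis subset_iff del: ev.simps(1))
  qed simp
qed auto

text \<open>Generators are removed one at a time. In Horner form with respect to b the coefficients
  do not see the coordinate \<open>c b\<close>; letting it run through the natural numbers gives a
  polynomial in one variable with infinitely many zeros, so every coefficient vanishes at c and the
  induction hypothesis applies to it.\<close>

lemma ev_faithful_over:
  assumes "finite B" "B \<subseteq> basis" "t \<in> terms_over B" "\<And>c. c \<in> nat_points \<Longrightarrow> ev t c = 0"
  shows "t \<asymp> Zero"
  using assms
proof (induction B arbitrary: t rule: finite_induct)
  case empty
  have k: "u \<in> terms_over {} \<Longrightarrow> u \<asymp> Scale (ev u (\<lambda>_. 0)) (Gen None)" for u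
  proof (induction u)
    case (Gen g)
    then have "g = None" by (auto simp: terms_over_def)
    then show ?case by (simp add: alg_cong.sym[OF alg_cong.Scale_one])
  next
    case Zero
    show ?case by (simp add: alg_cong.sym[OF Scale_0])
  next
    case (Add s t)
    then have "Add s t \<asymp> Add (Scale (ev s (\<lambda>_. 0)) (Gen None)) (Scale (ev t (\<lambda>_. 0)) (Gen None))"
      by (intro alg_cong.cong_Add) auto
    also have "\<dots> \<asymp> Scale (ev (Add s t) (\<lambda>_. 0)) (Gen None)" by (rule linI) simp
    finally show ?case .
  next
    case (Scale k s)
    then have "Scale k s \<asymp> Scale k (Scale (ev s (\<lambda>_. 0)) (Gen None))" by (intro alg_cong.cong_Scale) auto
    also have "\<dots> \<asymp> Scale (ev (Scale k s) (\<lambda>_. 0)) (Gen None)" by (rule linI) simp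
    finally show ?case .
  next
    case (Prod s t)
    let ?a = "ev s (\<lambda>_. 0)" and ?b = "ev t (\<lambda>_. 0)"
    have "alg_term.Prod s t \<asymp> alg_term.Prod (Scale ?a (Gen None)) (Scale ?b (Gen None))"
      using Prod by (intro alg_cong.cong_Prod) auto
    also have "\<dots> \<asymp> Scale ?a (alg_term.Prod (Gen None) (Scale ?b (Gen None)))" by (rule alg_cong.Prod_Scale_left)
    also have "\<dots> \<asymp> Scale ?a (Scale ?b (Gen None))" by (intro alg_cong.cong_Scale env_unit_left)
    also have "\<dots> \<asymp> Scale (ev (alg_term.Prod s t) (\<lambda>_. 0)) (Gen None)" by (rule linI) simp
    finally show ?case .
  qed
  have "(\<lambda>_. 0) \<in> nat_points" by (simp add: nat_points_def)
  then have "ev t (\<lambda>_. 0) = 0" using empty.prems by blast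
  then have "t \<asymp> Scale 0 (Gen None)" using k[OF empty.prems(2)] by simp
  then show ?case using Scale_0 alg_cong.trans by blast
next
  case (insert b B)
  obtain ts where ts: "set ts \<subseteq> terms_over B" "t \<asymp> horner b ts" using horner_form[OF insert.prems(2)] by blast
  have b: "b \<in> basis" "B \<subseteq> basis" using insert.prems by auto
  have "ev s c = 0" if c: "c \<in> nat_points" and s: "s \<in> set ts" for s c
  proof -
    let ?p = "Poly (map (\<lambda>t. ev t c) ts)"
    have "poly ?p (of_nat m) = 0" for m
    proof -
      let ?c = "c(b := of_nat m)"
      have "?c \<in> nat_points" using c b by (auto simp: nat_points_def)
      then have "ev (horner b ts) ?c = 0" using insert.prems(3) ev_cong[OF ts(2)] by metis
      moreover have "map (\<lambda>t. ev t ?c) ts = map (\<lambda>t. ev t c) ts"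
        using ts(1) insert.hyps(2) by (intro map_cong HOL.refl ev_terms_over_cong[OF _ b(2)]) auto
      ultimately show ?thesis using ev_horner[OF b(1), of ts ?c] by simp
    qed
    then have "range (of_nat :: nat \<Rightarrow> complex) \<subseteq> {z. poly ?p z = 0}" by auto
    moreover have "infinite (range (of_nat :: nat \<Rightarrow> complex))" by (simp add: inj_on_def finite_image_iff)
    ultimately have "?p = 0" using poly_roots_finite finite_subset by blast
    obtain k where k: "k < length ts" "s = ts ! k" using s by (metis in_set_conv_nth)
    have "coeff ?p k = ev s c" using k by (simp add: coeff_Poly_eq nth_default_def)
    then show ?thesis using \<open>?p = 0\<close> by simp
  qed
  then have "s \<asymp> Zero" if "s \<in> set ts" for s using insert.IH[OF b(2)] ts(1) that by blast
  then have "horner b ts \<asymp> Zero" by (rule horner_Zero)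
  then show ?case using ts(2) alg_cong.trans by blast
qed

lemma ev_faithful:
  assumes "env_term s" "env_term t" "\<And>c. c \<in> nat_points \<Longrightarrow> ev s c = ev t c"
  shows "s \<asymp> t"
proof -
  let ?d = "Add s (Scale (-1) t)"
  obtain u where u: "u \<in> terms_over basis" "?d \<asymp> u" using terms_over_basis[of ?d] assms by auto
  have "ev u c = 0" if "c \<in> nat_points" for c
    using ev_cong[OF u(2), of c] assms(3)[OF that] by simp
  then have "u \<asymp> Zero" by (rule ev_faithful_over[OF basis(3) order_refl u(1)])
  then have "?d \<asymp> Zero" using u alg_cong.trans by blast
  then show ?thesis by (simp only: diff_Zero_iff)
qed

lemma ev_polynomial: "\<exists>P. \<forall>s. ev t (\<lambda>x. c x + s * f x) = poly P s"
proof (induction t)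
  case (Gen g)
  show ?case
  proof (cases g)
    case None
    then show ?thesis by (intro exI[of _ 1]) simp
  next
    case (Some y)
    show ?thesis
    proof (cases "y \<in> range cart")
      case True
      then obtain x where "y = cart x" by blast
      then show ?thesis using Some
        by (intro exI[of _ "[:lam c x, lam f x:]"]) (simp add: ev_hgen lam_plus_scale del: ev.simps(1))
    next
      case False
      then show ?thesis using Some by (intro exI[of _ 0]) simp
    qed
  qed
next
  case Zero
  show ?case by (intro exI[of _ 0]) simp
next
  case (Add s t)
  then obtain p q where "\<forall>z. ev s (\<lambda>x. c x + z * f x) = poly p z" "\<forall>z. ev t (\<lambda>x. c x + z * f x) = poly q z" by blast
  then show ?case by (intro exI[of _ "p + q"]) simp
next
  case (Scale k s)
  then obtain p where "\<forall>z. ev s (\<lambda>x. c x + z * f x) = poly p z" by blast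
  then show ?case by (intro exI[of _ "smult k p"]) simp
next
  case (Prod s t)
  then obtain p q where "\<forall>z. ev s (\<lambda>x. c x + z * f x) = poly p z" "\<forall>z. ev t (\<lambda>x. c x + z * f x) = poly q z" by blast
  then show ?case by (intro exI[of _ "p * q"]) simp
qed

end

section \<open>Modules that are free of rank one over the Cartan subalgebra\<close>

locale km_module = kac_moody A sc \<alpha> \<alpha>v + Mod: lie_module "kac_moody_algebra sc \<alpha> \<alpha>v" V \<rho>
  for A :: "int ^ 'n ^ 'n" and sc :: "complex \<Rightarrow> 'h::ab_group_add \<Rightarrow> 'h"
    and \<alpha> :: "'n::finite \<Rightarrow> 'h \<Rightarrow> complex" and \<alpha>v :: "'n \<Rightarrow> 'h"
    and V :: "(complex, 'v) module" and \<rho>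
begin

lemma V_abelian: "abelian_group V"
  using Mod.V.module_axioms by (rule Module.module.axioms(2))

lemmas V_monoid = abelian_group.axioms(1)[OF V_abelian]
lemmas V_assoc = abelian_monoid.a_assoc[OF V_monoid] and V_lcomm = abelian_monoid.a_lcomm[OF V_monoid]
  and V_comm = abelian_monoid.a_comm[OF V_monoid]
lemmas V_neg = abelian_group.l_neg[OF V_abelian] abelian_group.r_neg[OF V_abelian]
  abelian_group.minus_add[OF V_abelian] abelian_group.minus_minus[OF V_abelian]
  abelian_group.a_inv_closed[OF V_abelian]
  abelian_monoid.zero_closed[OF V_monoid] abelian_monoid.a_closed[OF V_monoid]
  abelian_monoid.l_zero[OF V_monoid] abelian_monoid.r_zero[OF V_monoid]

lemma sm:
  assumes "v \<in> carrier V" "w \<in> carrier V"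
  shows "k \<odot>\<^bsub>V\<^esub> v \<in> carrier V" "(k + m) \<odot>\<^bsub>V\<^esub> v = k \<odot>\<^bsub>V\<^esub> v \<oplus>\<^bsub>V\<^esub> m \<odot>\<^bsub>V\<^esub> v"
    "k \<odot>\<^bsub>V\<^esub> (v \<oplus>\<^bsub>V\<^esub> w) = k \<odot>\<^bsub>V\<^esub> v \<oplus>\<^bsub>V\<^esub> k \<odot>\<^bsub>V\<^esub> w" "k \<odot>\<^bsub>V\<^esub> (m \<odot>\<^bsub>V\<^esub> v) = (k * m) \<odot>\<^bsub>V\<^esub> v"
    "1 \<odot>\<^bsub>V\<^esub> v = v" "0 \<odot>\<^bsub>V\<^esub> v = \<zero>\<^bsub>V\<^esub>" "(-1) \<odot>\<^bsub>V\<^esub> v = \<ominus>\<^bsub>V\<^esub> v"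
proof -
  have c: "carrier Cring = UNIV" "a \<oplus>\<^bsub>Cring\<^esub> b = a + b" "a \<otimes>\<^bsub>Cring\<^esub> b = a * b" "\<one>\<^bsub>Cring\<^esub> = 1" "\<zero>\<^bsub>Cring\<^esub> = 0"
    for a b :: complex by (simp_all add: ring_of_type_algebra_def)
  show cl: "k \<odot>\<^bsub>V\<^esub> v \<in> carrier V" for k using Mod.V.smult_closed assms by (simp add: c)
  show d: "(k + m) \<odot>\<^bsub>V\<^esub> v = k \<odot>\<^bsub>V\<^esub> v \<oplus>\<^bsub>V\<^esub> m \<odot>\<^bsub>V\<^esub> v" for k m
    using Mod.V.smult_l_distr[of k m v] assms by (simp add: c)
  show "k \<odot>\<^bsub>V\<^esub> (v \<oplus>\<^bsub>V\<^esub> w) = k \<odot>\<^bsub>V\<^esub> v \<oplus>\<^bsub>V\<^esub> k \<odot>\<^bsub>V\<^esub> w"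
    using Mod.V.smult_r_distr[of k v w] assms by (simp add: c)
  show "k \<odot>\<^bsub>V\<^esub> (m \<odot>\<^bsub>V\<^esub> v) = (k * m) \<odot>\<^bsub>V\<^esub> v"
    using Mod.V.smult_assoc1[of k m v] assms by (simp add: c)
  show o: "1 \<odot>\<^bsub>V\<^esub> v = v" using Mod.V.smult_one[of v] assms by (simp add: c)
  show z: "0 \<odot>\<^bsub>V\<^esub> v = \<zero>\<^bsub>V\<^esub>" using Mod.V.smult_l_null[of v] assms by (simp add: c)
  have "(-1) \<odot>\<^bsub>V\<^esub> v \<oplus>\<^bsub>V\<^esub> v = \<zero>\<^bsub>V\<^esub>" using d[of "-1" 1] o z by simp
  then show "(-1) \<odot>\<^bsub>V\<^esub> v = \<ominus>\<^bsub>V\<^esub> v"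
    using abelian_group.minus_equality[OF V_abelian _ assms(1) cl] by metis
qed

lemma smult_zero: "k \<odot>\<^bsub>V\<^esub> \<zero>\<^bsub>V\<^esub> = \<zero>\<^bsub>V\<^esub>"
  using Mod.V.smult_r_null[of k] by (simp add: ring_of_type_algebra_def)

text \<open>Unlike \<open>env_term_act\<close> it annihilates vectors under generators outside the
  Cartan subalgebra: for these \<rho> need not obey any law, yet a congruence between two terms over
  the Cartan subalgebra may pass through them.\<close>

primrec eact :: "('h, 'n) km_gen alg_term set set option alg_term \<Rightarrow> 'v \<Rightarrow> 'v" where
  "eact (Gen g) v = (case g of None \<Rightarrow> v | Some y \<Rightarrow> if y \<in> range cart then \<rho> y v else \<zero>\<^bsub>V\<^esub>)"
| "eact Zero v = \<zero>\<^bsub>V\<^esub>"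
| "eact (Add s t) v = eact s v \<oplus>\<^bsub>V\<^esub> eact t v"
| "eact (Scale k s) v = k \<odot>\<^bsub>V\<^esub> eact s v"
| "eact (Prod s t) v = eact s (eact t v)"

lemma cart_closed: "y \<in> range cart \<Longrightarrow> y \<in> carrier \<gg>"
  using cart_ops(4) by blast

lemma eact_env_term: "env_term t \<Longrightarrow> env_term_act V \<rho> t v = eact t v"
proof (induction t arbitrary: v)
  case (Gen g)
  then show ?case by (auto elim!: env_term_cases)
qed auto

lemma eact_closed: "v \<in> carrier V \<Longrightarrow> eact t v \<in> carrier V"
  by (induction t arbitrary: v) (auto simp: sm(1) Mod.act_closed cart_closed split: option.split)

lemma act_zero: "y \<in> carrier \<gg> \<Longrightarrow> \<rho> y \<zero>\<^bsub>V\<^esub> = \<zero>\<^bsub>V\<^esub>"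
  using Mod.act_smult[of y "\<zero>\<^bsub>V\<^esub>" 0] smult_zero[of 0] sm(6)[of "\<rho> y \<zero>\<^bsub>V\<^esub>" "\<rho> y \<zero>\<^bsub>V\<^esub>"]
  by (simp add: Mod.act_closed)

lemma eact_add: "v \<in> carrier V \<Longrightarrow> w \<in> carrier V \<Longrightarrow> eact t (v \<oplus>\<^bsub>V\<^esub> w) = eact t v \<oplus>\<^bsub>V\<^esub> eact t w"
proof (induction t arbitrary: v w)
  case (Gen g)
  then show ?case by (auto simp: Mod.act_add cart_closed split: option.split)
next
  case (Add s t)
  then show ?case using eact_closed[of v] eact_closed[of w]
    by (simp add: V_assoc V_lcomm)
qed (auto simp: sm eact_closed)

lemma eact_smult: "v \<in> carrier V \<Longrightarrow> eact t (k \<odot>\<^bsub>V\<^esub> v) = k \<odot>\<^bsub>V\<^esub> eact t v"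
proof (induction t arbitrary: v)
  case (Gen g)
  then show ?case by (auto simp: Mod.act_smult cart_closed smult_zero split: option.split)
next
  case (Scale m t)
  then show ?case using eact_closed[of v t] by (simp add: sm(4) mult.commute)
qed (auto simp: sm eact_closed smult_zero)

lemma eact_rel:
  assumes "(s, t) \<in> env_rel" "v \<in> carrier V"
  shows "eact s v = eact t v"
proof -
  have neg: "(-1) \<odot>\<^bsub>V\<^esub> w = \<ominus>\<^bsub>V\<^esub> w" if "w \<in> carrier V" for w using sm(7)[OF that that] .
  have br: "\<rho> (cart x) (\<rho> (cart y) v) \<oplus>\<^bsub>V\<^esub> \<ominus>\<^bsub>V\<^esub> \<rho> (cart y) (\<rho> (cart x) v) = \<rho> (cart 0) v" for x y
    using Mod.bracket_act[of "cart x" "cart y" v] assms(2) by (simp add: cart_ops(3,4) a_minus_def)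
  show ?thesis
    using assms unfolding env_rel_def env_relations_def
    by (auto simp: cart_ops(1,2)[symmetric] cart_ops(3))
      (auto simp: cart_ops(4) neg Mod.add_act Mod.smult_act Mod.act_closed br cart_ops(1,2))
qed

lemma eact_cong: "s \<asymp> t \<Longrightarrow> v \<in> carrier V \<Longrightarrow> eact s v = eact t v"
proof (induction arbitrary: v rule: alg_cong.induct)
  case (rel s t)
  then show ?case by (rule eact_rel)
next
  case (Add_neg s)
  then show ?case using eact_closed[OF Add_neg, of s] by (simp add: sm(7) V_neg)
qed (auto simp: eact_closed sm eact_add eact_smult V_assoc V_comm V_lcomm)

lemma env_class_eq:
  assumes "env_term s" "env_term t"
  shows "alg_class env_gens env_rel s = alg_class env_gens env_rel t \<longleftrightarrow> s \<asymp> t"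
proof
  assume "alg_class env_gens env_rel s = alg_class env_gens env_rel t"
  moreover have "s \<in> alg_class env_gens env_rel s" using assms by (simp add: alg_class_def env_term_def alg_cong.refl)
  ultimately show "s \<asymp> t" by (simp add: alg_class_def)
next
  assume a: "s \<asymp> t"
  show "alg_class env_gens env_rel s = alg_class env_gens env_rel t"
    unfolding alg_class_def using alg_cong.trans[OF _ a] alg_cong.trans[OF _ alg_cong.sym[OF a]] by blast
qed

lemma carrier_env: "carrier (enveloping_algebra \<hh>) = alg_class env_gens env_rel ` {t. env_term t}"
  unfolding enveloping_algebra_def presented_algebra_def env_generators_eq env_rel_def env_term_def by simp

lemma env_smult:
  assumes "env_term t" "v \<in> carrier V"
  shows "alg_class env_gens env_rel t \<odot>\<^bsub>env_module V \<rho>\<^esub> v = eact t v"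
proof -
  have "(\<lambda>s. env_term_act V \<rho> s v) ` alg_class env_gens env_rel t = {eact t v}"
  proof (intro equalityI subsetI)
    fix w assume "w \<in> (\<lambda>s. env_term_act V \<rho> s v) ` alg_class env_gens env_rel t"
    then obtain s where "w = env_term_act V \<rho> s v" "env_term s" "s \<asymp> t" by (auto simp: alg_class_def env_term_def)
    then show "w \<in> {eact t v}" using eact_env_term eact_cong assms(2) by auto
  next
    fix w assume "w \<in> {eact t v}"
    then have "w = env_term_act V \<rho> t v" using eact_env_term[OF assms(1)] by simp
    moreover have "t \<in> alg_class env_gens env_rel t" using assms(1) by (simp add: alg_class_def env_term_def alg_cong.refl)
    ultimately show "w \<in> (\<lambda>s. env_term_act V \<rho> s v) ` alg_class env_gens env_rel t" by blast
  qed
  then show ?thesis by (simp add: env_module_def)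
qed

lemma free_iff:
  "free_of_rank_one (enveloping_algebra \<hh>) (env_module V \<rho>) \<longleftrightarrow>
    (\<exists>b\<in>carrier V. (\<forall>v\<in>carrier V. \<exists>t. env_term t \<and> v = eact t b) \<and>
       (\<forall>s t. env_term s \<longrightarrow> env_term t \<longrightarrow> eact s b = eact t b \<longrightarrow> s \<asymp> t))"
  (is "_ \<longleftrightarrow> (\<exists>b\<in>carrier V. ?P b)")
proof -
  have "(\<forall>v\<in>carrier V. \<exists>!r. r \<in> carrier (enveloping_algebra \<hh>) \<and> v = r \<odot>\<^bsub>env_module V \<rho>\<^esub> b) \<longleftrightarrow> ?P b"
    (is "?F \<longleftrightarrow> _") if b: "b \<in> carrier V" for b
  proof
    assume F: ?F
    show "?P b"
    proof (intro conjI ballI allI impI)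
      fix v assume "v \<in> carrier V"
      then obtain r where "r \<in> carrier (enveloping_algebra \<hh>)" "v = r \<odot>\<^bsub>env_module V \<rho>\<^esub> b" using F by blast
      then show "\<exists>t. env_term t \<and> v = eact t b" using env_smult[OF _ b] by (auto simp: carrier_env)
    next
      fix s t assume st: "env_term s" "env_term t" "eact s b = eact t b"
      have "eact s b \<in> carrier V" using eact_closed[OF b] .
      then have "\<exists>!r. r \<in> carrier (enveloping_algebra \<hh>) \<and> eact s b = r \<odot>\<^bsub>env_module V \<rho>\<^esub> b" using F by blast
      moreover have "alg_class env_gens env_rel s \<in> carrier (enveloping_algebra \<hh>)"
        "alg_class env_gens env_rel t \<in> carrier (enveloping_algebra \<hh>)" using st by (auto simp: carrier_env)
      moreover have "eact s b = alg_class env_gens env_rel s \<odot>\<^bsub>env_module V \<rho>\<^esub> b"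
        "eact s b = alg_class env_gens env_rel t \<odot>\<^bsub>env_module V \<rho>\<^esub> b" using env_smult[OF _ b] st by auto
      ultimately have "alg_class env_gens env_rel s = alg_class env_gens env_rel t" by blast
      then show "s \<asymp> t" using env_class_eq st by blast
    qed
  next
    assume P: "?P b"
    show ?F
    proof
      fix v assume "v \<in> carrier V"
      then obtain t where t: "env_term t" "v = eact t b" using P by blast
      show "\<exists>!r. r \<in> carrier (enveloping_algebra \<hh>) \<and> v = r \<odot>\<^bsub>env_module V \<rho>\<^esub> b"
      proof (rule ex1I)
        show "alg_class env_gens env_rel t \<in> carrier (enveloping_algebra \<hh>) \<and> v = alg_class env_gens env_rel t \<odot>\<^bsub>env_module V \<rho>\<^esub> b"
          using t env_smult[OF t(1) b] by (auto simp: carrier_env)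
        fix r assume r: "r \<in> carrier (enveloping_algebra \<hh>) \<and> v = r \<odot>\<^bsub>env_module V \<rho>\<^esub> b"
        then obtain s where s: "env_term s" "r = alg_class env_gens env_rel s" by (auto simp: carrier_env)
        then have "eact s b = eact t b" using r t env_smult[OF s(1) b] by simp
        then have "s \<asymp> t" using P s t by blast
        then show "r = alg_class env_gens env_rel t" using s t env_class_eq by blast
      qed
    qed
  qed
  moreover have "carrier (env_module V \<rho>) = carrier V" by (simp add: env_module_def)
  ultimately show ?thesis unfolding free_of_rank_one_def by auto
qed

end

section \<open>Translation of polynomials by simple roots\<close>

context kac_moody
begin

text \<open>The automorphism of the enveloping algebra that arises when a root vector is moved past
  a coefficient; on polynomial functions it is the translation in
  \<open>ev_shift_term\<close>.\<close>

primrec shift_term :: "bool \<Rightarrow> 'n \<Rightarrow> ('h, 'n) km_gen alg_term set set option alg_term \<Rightarrow> ('h, 'n) km_gen alg_term set set option alg_term" where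
  "shift_term e i (Gen g) = (case g of None \<Rightarrow> Gen None
      | Some y \<Rightarrow> Add (Gen (Some y)) (Scale (- (of_int (sg e) * \<alpha> i (inv_into UNIV cart y))) (Gen None)))"
| "shift_term e i Zero = Zero"
| "shift_term e i (Add s t) = Add (shift_term e i s) (shift_term e i t)"
| "shift_term e i (Scale k s) = Scale k (shift_term e i s)"
| "shift_term e i (Prod s t) = Prod (shift_term e i s) (shift_term e i t)"

lemma shift_term_env_term: "env_term t \<Longrightarrow> env_term (shift_term e i t)"
proof (induction t)
  case (Gen g)
  then show ?case by (rule env_term_cases) auto
qed auto

lemma ev_shift_term: "env_term t \<Longrightarrow> ev (shift_term e i t) c = ev t (\<lambda>x. c x + (- of_int (sg e)) * \<alpha> i x)"
proof (induction t)
  case (Gen g)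
  then show ?case
    by (rule env_term_cases) (use lam_\<alpha>[of c "- of_int (sg e)" i] in \<open>simp_all add: inv_f_f[OF cart_inj]\<close>)
qed auto

end

context km_module
begin

abbreviation "xg e i \<equiv> proj (root_gen e i)"

lemma xg_closed: "xg e i \<in> carrier \<gg>"
  by (simp add: carrier_km)

lemma act_xg_cart:
  assumes "v \<in> carrier V"
  shows "\<rho> (xg e i) (\<rho> (cart x) v) = \<rho> (cart x) (\<rho> (xg e i) v) \<oplus>\<^bsub>V\<^esub> (- (of_int (sg e) * \<alpha> i x)) \<odot>\<^bsub>V\<^esub> \<rho> (xg e i) v"
proof -
  let ?k = "of_int (sg e) * \<alpha> i x" and ?a = "\<rho> (cart x) (\<rho> (xg e i) v)" and ?b = "\<rho> (xg e i) (\<rho> (cart x) v)" and ?w = "\<rho> (xg e i) v"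
  have cl: "?a \<in> carrier V" "?b \<in> carrier V" "?w \<in> carrier V"
    using assms by (simp_all add: Mod.act_closed xg_closed cart_ops(4))
  have "cart x \<otimes>\<^bsub>\<gg>\<^esub> xg e i = ?k \<odot>\<^bsub>\<gg>\<^esub> xg e i"
    unfolding cart_def mult_km smult_km by (rule proj_cong[OF rel_HX])
  then have e: "?k \<odot>\<^bsub>V\<^esub> ?w = ?a \<ominus>\<^bsub>V\<^esub> ?b"
    using Mod.bracket_act[of "cart x" "xg e i" v] Mod.smult_act[of "xg e i" v ?k] assms
    by (simp add: xg_closed cart_ops(4))
  have "(- ?k) \<odot>\<^bsub>V\<^esub> ?w = (-1) \<odot>\<^bsub>V\<^esub> (?k \<odot>\<^bsub>V\<^esub> ?w)" using sm(4)[OF cl(3,3), of "-1" ?k] by simp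
  also have "\<dots> = \<ominus>\<^bsub>V\<^esub> (?a \<ominus>\<^bsub>V\<^esub> ?b)" unfolding e by (rule sm(7)) (use cl in auto)
  also have "\<dots> = ?b \<ominus>\<^bsub>V\<^esub> ?a" using cl by (simp add: a_minus_def V_neg V_comm)
  finally have "?a \<oplus>\<^bsub>V\<^esub> (- ?k) \<odot>\<^bsub>V\<^esub> ?w = ?a \<oplus>\<^bsub>V\<^esub> (?b \<ominus>\<^bsub>V\<^esub> ?a)" by simp
  also have "\<dots> = ?b" using cl by (simp add: a_minus_def V_lcomm[of ?a ?b] V_neg)
  finally show ?thesis by simp
qed

lemma act_xg_eact:
  "env_term t \<Longrightarrow> v \<in> carrier V \<Longrightarrow> \<rho> (xg e i) (eact t v) = eact (shift_term e i t) (\<rho> (xg e i) v)"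
proof (induction t arbitrary: v)
  case (Gen g)
  from Gen(1) show ?case
    by (rule env_term_cases) (simp_all add: act_xg_cart Gen(2) inv_f_f[OF cart_inj])
next
  case Zero
  then show ?case by (simp add: act_zero xg_closed)
next
  case (Add s t)
  then show ?case by (simp add: Mod.act_add xg_closed eact_closed)
next
  case (Scale k s)
  then show ?case by (simp add: Mod.act_smult xg_closed eact_closed)
next
  case (Prod s t)
  then show ?case by (simp add: eact_closed)
qed

text \<open>The action of a root vector is known from its value on the basis vector, since it moves
  past coefficients by translation. Freeness and \<open>ev_cong\<close> turn identities between
  vectors into identities between polynomial functions.\<close>

theorem free_imp_type_A_or_C:
  assumes gcm: "generalized_cartan_matrix A" and indec: "indecomposable A"
    and free: "free_of_rank_one (enveloping_algebra \<hh>) (env_module V \<rho>)"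
  shows "(\<exists>l\<ge>1. type_A l A) \<or> (\<exists>l\<ge>2. type_C l A)"
proof -
  obtain b where b: "b \<in> carrier V" "\<And>v. v \<in> carrier V \<Longrightarrow> \<exists>t. env_term t \<and> v = eact t b"
    "\<And>s t. env_term s \<Longrightarrow> env_term t \<Longrightarrow> eact s b = eact t b \<Longrightarrow> s \<asymp> t"
    using free unfolding free_iff by blast
  define P where "P e i = (SOME t. env_term t \<and> \<rho> (xg e i) b = eact t b)" for e i
  have P: "env_term (P e i)" "\<rho> (xg e i) b = eact (P e i) b" for e i
    using someI_ex[OF b(2)[of "\<rho> (xg e i) b"]] b(1) by (auto simp: P_def Mod.act_closed xg_closed)
  define p q where "p i = ev (P True i)" and "q i = ev (P False i)" for i
  have comp: "\<rho> (xg e i) (\<rho> (xg e' j) b) = eact (Prod (shift_term e i (P e' j)) (P e i)) b" for e e' i j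
    using act_xg_eact[OF P(1) b(1)] P by simp
  \<comment> \<open>The relation for [e_i, f_j] applied to the basis vector, with coefficients
    compared.\<close>
  have eq: "p i c * q j (\<lambda>x. c x + (-1) * \<alpha> i x) = q j c * p i (\<lambda>x. c x + 1 * \<alpha> j x) + (if i = j then lam c (\<alpha>v i) else 0)" for i j c
  proof -
    let ?u = "if i = j then hgen (\<alpha>v i) else Zero"
    let ?S = "Prod (shift_term True i (P False j)) (P True i)" and ?T = "Prod (shift_term False j (P True i)) (P False j)"
    have u: "env_term ?u" by simp
    have "xg True i \<otimes>\<^bsub>\<gg>\<^esub> xg False j = proj (if i = j then Scale 1 (Gen (H (\<alpha>v i))) else Zero)"
      using proj_cong[OF rel_XX[of True i j]] by (simp add: mult_km)
    also have "\<dots> = (if i = j then cart (\<alpha>v i) else cart 0)"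
      using proj_cong[OF alg_cong.Scale_one] proj_cong[OF H_zero] by (simp add: cart_def)
    finally have br: "xg True i \<otimes>\<^bsub>\<gg>\<^esub> xg False j = (if i = j then cart (\<alpha>v i) else cart 0)" .
    have z: "\<rho> (cart 0) b = \<zero>\<^bsub>V\<^esub>" using eact_cong[OF env_zero b(1)] by simp
    have "eact ?u b = \<rho> (xg True i \<otimes>\<^bsub>\<gg>\<^esub> xg False j) b"
      unfolding br using z by simp
    also have "\<dots> = eact ?S b \<ominus>\<^bsub>V\<^esub> eact ?T b"
      using Mod.bracket_act[OF xg_closed xg_closed b(1)] comp by simp
    finally have "eact ?u b \<oplus>\<^bsub>V\<^esub> eact ?T b = eact ?S b"
      using eact_closed[OF b(1), of ?S] eact_closed[OF b(1), of ?T]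
      by (simp only:) (simp add: a_minus_def V_assoc V_neg)
    then have "eact (Add ?u ?T) b = eact ?S b" by simp
    then have "Add ?u ?T \<asymp> ?S" using b(3) u P(1) shift_term_env_term by simp
    then have "ev (Add ?u ?T) c = ev ?S c" by (rule ev_cong)
    then show ?thesis
      using ev_shift_term[OF P(1), of True i False j c] ev_shift_term[OF P(1), of False j True i c]
      by (simp add: p_def q_def ev_hgen algebra_simps del: ev.simps(1) split: if_splits)
  qed
  define sh where "sh k s c = (\<lambda>x. c x + s * \<alpha> k x)" for k s and c :: "'h \<Rightarrow> complex"
  define r where "r i c = q i c * p i (sh i 1 c)" for i c
  define h where "h i c = lam c (\<alpha>v i)" for i c
  note eq = eq[folded sh_def]
  have shsh: "sh k s (sh k t c) = sh k (s + t) c" for k s t c by (simp add: sh_def fun_eq_iff algebra_simps)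
  have shc: "sh j t (sh k s c) = sh k s (sh j t c)" for j t k s c by (simp add: sh_def fun_eq_iff algebra_simps)
  have sh0: "sh k 0 c = c" for k c by (simp add: sh_def)
  interpret root_system_data A r h sh
  proof
    show "h i (sh k s c) = h i c + s * of_int (A $ i $ k)" for i k s c
      by (simp add: h_def sh_def lam_\<alpha> \<alpha>_\<alpha>v)
    show "\<exists>P. \<forall>s. r i (sh k s c) = poly P s" for i k c
    proof -
      obtain f where f: "\<And>s. q i (sh k s c) = poly f s"
        using ev_polynomial[of "P False i" c "\<alpha> k"] unfolding q_def sh_def by blast
      obtain g where g: "\<And>s. p i (sh k s (sh i 1 c)) = poly g s"
        using ev_polynomial[of "P True i" "sh i 1 c" "\<alpha> k"] unfolding p_def sh_def by blast
      have "r i (sh k s c) = poly (f * g) s" for s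
        by (simp add: r_def f g shc[of i 1 k])
      then show ?thesis by blast
    qed
    show "r i (sh i (-1) c) = r i c + h i c" for i c
      using eq[of i c i] by (simp add: r_def h_def shsh sh0 mult.commute)
    show "r i c * r j c = r j (sh i 1 c) * r i (sh j 1 c)" if "i \<noteq> j" for i j c
    proof -
      \<comment> \<open>[e_i, f_j] = 0 and [e_j, f_i] = 0 are taken at two different translates of
        c, chosen so that their product regroups into values of \<open>r i\<close> and
        \<open>r j\<close>.\<close>
      have 1: "p i (sh i 1 c) * q j c = q j (sh i 1 c) * p i (sh j 1 (sh i 1 c))"
        using eq[of i "sh i 1 c" j] that by (simp add: shsh sh0)
      have 2: "p j (sh j 1 c) * q i c = q i (sh j 1 c) * p j (sh i 1 (sh j 1 c))"
        using eq[of j "sh j 1 c" i] that by (simp add: shsh sh0)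
      have "r i c * r j c = (p i (sh i 1 c) * q j c) * (p j (sh j 1 c) * q i c)" by (simp add: r_def)
      also have "\<dots> = r j (sh i 1 c) * r i (sh j 1 c)"
        unfolding 1 2 by (simp add: r_def shc[of i 1 j 1])
      finally show ?thesis .
    qed
    show "z i = 0" if "\<And>c. (\<Sum>i\<in>UNIV. z i * h i c) = 0" for z i
    proof -
      have s: "lam c (\<Sum>i\<in>I. sc (z i) (\<alpha>v i)) = (\<Sum>i\<in>I. z i * h i c)" for c I
        by (induction I rule: infinite_finite_induct) (simp_all add: lam_zero lam_add lam_scale h_def)
      have "(\<Sum>i\<in>UNIV. sc (z i) (\<alpha>v i)) = 0"
        by (rule lam_separates) (simp add: s that)
      then show "z i = 0" by (rule \<alpha>v_indep)
    qed
  qed (use gcm indec shsh shc sh0 in auto)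
  show ?thesis by (rule type_A_or_C)
qed

end

section \<open>Modules of polynomial functions\<close>

text \<open>Polynomiality on every line is all that the vanishing arguments need, and it spares the
  representation of w by a term.\<close>

definition line_poly :: "(('h \<Rightarrow> complex) \<Rightarrow> complex) \<Rightarrow> bool" where
  "line_poly f \<longleftrightarrow> (\<forall>c u. \<exists>P. \<forall>s. f (\<lambda>x. c x + s * u x) = poly P s)"

lemma line_poly_add: "line_poly f \<Longrightarrow> line_poly g \<Longrightarrow> line_poly (\<lambda>c. f c + g c)"
  unfolding line_poly_def
proof (intro allI)
  fix c u
  assume "\<forall>c u. \<exists>P. \<forall>s. f (\<lambda>x. c x + s * u x) = poly P s" "\<forall>c u. \<exists>P. \<forall>s. g (\<lambda>x. c x + s * u x) = poly P s"
  then obtain P Q where "\<forall>s. f (\<lambda>x. c x + s * u x) = poly P s" "\<forall>s. g (\<lambda>x. c x + s * u x) = poly Q s" by meson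
  then show "\<exists>P. \<forall>s. f (\<lambda>x. c x + s * u x) + g (\<lambda>x. c x + s * u x) = poly P s"
    by (intro exI[of _ "P + Q"]) simp
qed

lemma line_poly_diff: "line_poly f \<Longrightarrow> line_poly g \<Longrightarrow> line_poly (\<lambda>c. f c - g c)"
  unfolding line_poly_def
proof (intro allI)
  fix c u
  assume "\<forall>c u. \<exists>P. \<forall>s. f (\<lambda>x. c x + s * u x) = poly P s" "\<forall>c u. \<exists>P. \<forall>s. g (\<lambda>x. c x + s * u x) = poly P s"
  then obtain P Q where "\<forall>s. f (\<lambda>x. c x + s * u x) = poly P s" "\<forall>s. g (\<lambda>x. c x + s * u x) = poly Q s" by meson
  then show "\<exists>P. \<forall>s. f (\<lambda>x. c x + s * u x) - g (\<lambda>x. c x + s * u x) = poly P s"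
    by (intro exI[of _ "P - Q"]) simp
qed

lemma line_poly_mult: "line_poly f \<Longrightarrow> line_poly g \<Longrightarrow> line_poly (\<lambda>c. f c * g c)"
  unfolding line_poly_def
proof (intro allI)
  fix c u
  assume "\<forall>c u. \<exists>P. \<forall>s. f (\<lambda>x. c x + s * u x) = poly P s" "\<forall>c u. \<exists>P. \<forall>s. g (\<lambda>x. c x + s * u x) = poly P s"
  then obtain P Q where "\<forall>s. f (\<lambda>x. c x + s * u x) = poly P s" "\<forall>s. g (\<lambda>x. c x + s * u x) = poly Q s" by meson
  then show "\<exists>P. \<forall>s. f (\<lambda>x. c x + s * u x) * g (\<lambda>x. c x + s * u x) = poly P s"
    by (intro exI[of _ "P * Q"]) simp
qed

lemma line_poly_const: "line_poly (\<lambda>c. k)"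
  unfolding line_poly_def by (rule allI, rule allI, rule exI[of _ "[:k:]"]) simp

lemma line_poly_translate:
  assumes "line_poly f"
  shows "line_poly (\<lambda>c. f (\<lambda>x. c x + g x))"
  unfolding line_poly_def
proof (intro allI)
  fix c u
  obtain P where "\<And>s. f (\<lambda>x. (c x + g x) + s * u x) = poly P s"
    using assms unfolding line_poly_def by meson
  then show "\<exists>P. \<forall>s. f (\<lambda>x. (c x + s * u x) + g x) = poly P s"
    by (intro exI[of _ P]) (simp add: add.commute add.left_commute)
qed

lemma line_poly_zero:
  assumes "line_poly f" "infinite {s. f (\<lambda>x. c x + s * u x) = 0}"
  shows "f (\<lambda>x. c x + s * u x) = 0"
proof -
  obtain P where P: "\<And>s. f (\<lambda>x. c x + s * u x) = poly P s" using assms(1) unfolding line_poly_def by meson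
  then have "P = 0" using assms(2) poly_roots_finite[of P] by auto
  then show ?thesis using P by simp
qed

text \<open>For linear operators this says that the functions vanishing on Z are preserved.\<close>

definition local_on :: "'a set \<Rightarrow> (('a \<Rightarrow> complex) \<Rightarrow> ('a \<Rightarrow> complex)) \<Rightarrow> bool" where
  "local_on Z T \<longleftrightarrow> (\<forall>\<phi> \<psi>. (\<forall>c\<in>Z. \<phi> c = \<psi> c) \<longrightarrow> (\<forall>c\<in>Z. T \<phi> c = T \<psi> c))"

lemma local_onD: "local_on Z T \<Longrightarrow> (\<And>c. c \<in> Z \<Longrightarrow> \<phi> c = \<psi> c) \<Longrightarrow> c \<in> Z \<Longrightarrow> T \<phi> c = T \<psi> c"
  by (simp add: local_on_def)

lemma interp_local: "(\<And>g. local_on Z (\<omega> g)) \<Longrightarrow> local_on Z (interp \<omega> t)"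
proof (induction t)
  case (Prod s t)
  then have st: "local_on Z (interp \<omega> s)" "local_on Z (interp \<omega> t)" by auto
  show ?case
    unfolding local_on_def
  proof (intro allI impI)
    fix \<phi> \<psi> :: "_ \<Rightarrow> complex" assume a: "\<forall>c\<in>Z. \<phi> c = \<psi> c"
    then have "\<forall>c\<in>Z. interp \<omega> s \<phi> c = interp \<omega> s \<psi> c" "\<forall>c\<in>Z. interp \<omega> t \<phi> c = interp \<omega> t \<psi> c"
      using st unfolding local_on_def by blast+
    then have "\<forall>c\<in>Z. interp \<omega> t (interp \<omega> s \<phi>) c = interp \<omega> t (interp \<omega> s \<psi>) c"
      "\<forall>c\<in>Z. interp \<omega> s (interp \<omega> t \<phi>) c = interp \<omega> s (interp \<omega> t \<psi>) c"
      using st unfolding local_on_def by blast+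
    then show "\<forall>c\<in>Z. interp \<omega> (alg_term.Prod s t) \<phi> c = interp \<omega> (alg_term.Prod s t) \<psi> c" by simp
  qed
next
  case (Add s t)
  then have st: "local_on Z (interp \<omega> s)" "local_on Z (interp \<omega> t)" by auto
  show ?case
    unfolding local_on_def
  proof (intro allI impI)
    fix \<phi> \<psi> :: "_ \<Rightarrow> complex" assume "\<forall>c\<in>Z. \<phi> c = \<psi> c"
    then have "\<forall>c\<in>Z. interp \<omega> s \<phi> c = interp \<omega> s \<psi> c" "\<forall>c\<in>Z. interp \<omega> t \<phi> c = interp \<omega> t \<psi> c"
      using st unfolding local_on_def by blast+
    then show "\<forall>c\<in>Z. interp \<omega> (Add s t) \<phi> c = interp \<omega> (Add s t) \<psi> c" by simp
  qed
next
  case (Scale k t)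
  then have "local_on Z (interp \<omega> t)" by auto
  then show ?case unfolding local_on_def interp.simps by metis
qed (simp_all add: local_on_def)

text \<open>A sequence is coded as one set of natural numbers: the real and imaginary parts of each
  entry become sets, marked with the tags 0 and 1 and with the position of the entry.\<close>

lemma functions_nat_complex_lepoll: "\<exists>G :: (nat \<Rightarrow> complex) \<Rightarrow> complex. inj G"
proof -
  have "lepoll (UNIV :: real set) (UNIV :: nat set set)"
    using nat_sets_eqpoll_reals eqpoll_sym eqpoll_imp_lepoll by blast
  then obtain g :: "real \<Rightarrow> nat set" where g: "inj g" unfolding lepoll_def by blast
  have "lepoll (UNIV :: nat set set) (UNIV :: real set)"
    using nat_sets_eqpoll_reals eqpoll_imp_lepoll by blast
  then obtain g' :: "nat set \<Rightarrow> real" where g': "inj g'" unfolding lepoll_def by blast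
  define G where "G f = complex_of_real (g' {prod_encode (n, prod_encode (k, m)) |n k m.
      k = 0 \<and> m \<in> g (Re (f n)) \<or> k = 1 \<and> m \<in> g (Im (f n))})" for f
  have "inj G"
  proof (rule injI)
    fix f f' assume "G f = G f'"
    then have e: "{prod_encode (n, prod_encode (k, m)) |n k m. k = 0 \<and> m \<in> g (Re (f n)) \<or> k = 1 \<and> m \<in> g (Im (f n))}
      = {prod_encode (n, prod_encode (k, m)) |n k m. k = 0 \<and> m \<in> g (Re (f' n)) \<or> k = 1 \<and> m \<in> g (Im (f' n))}" (is "?A = ?B")
      using g' by (simp add: G_def inj_eq)
    have mem: "(prod_encode (n, prod_encode (k, m)) \<in> ?A) = (k = 0 \<and> m \<in> g (Re (f n)) \<or> k = 1 \<and> m \<in> g (Im (f n)))"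
      "(prod_encode (n, prod_encode (k, m)) \<in> ?B) = (k = 0 \<and> m \<in> g (Re (f' n)) \<or> k = 1 \<and> m \<in> g (Im (f' n)))" for n k m
      by (auto simp: prod_encode_eq)
    show "f = f'"
    proof
      fix n
      have "g (Re (f n)) = g (Re (f' n))" "g (Im (f n)) = g (Im (f' n))"
        using mem[of n 0] mem[of n 1] unfolding e by auto
      then show "f n = f' n" using g by (simp add: inj_eq complex_eq_iff)
    qed
  qed
  then show ?thesis by blast
qed

section \<open>Polynomial functions on the dual of the Cartan subalgebra\<close>

context kac_moody
begin

definition translate :: "('n \<Rightarrow> int) \<Rightarrow> ('h \<Rightarrow> complex) \<Rightarrow> 'h \<Rightarrow> complex" where
  "translate d c = (\<lambda>x. c x - wt d x)"

definition move :: "'n \<Rightarrow> complex \<Rightarrow> ('h \<Rightarrow> complex) \<Rightarrow> 'h \<Rightarrow> complex" where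
  "move i s c = (\<lambda>x. c x + s * \<alpha> i x)"

lemma line_poly_ev: "line_poly (ev t)"
  unfolding line_poly_def by (intro allI) (rule ev_polynomial)

lemma line_poly_lam: "line_poly (\<lambda>c. lam c x)"
proof -
  have "ev (hgen x) = (\<lambda>c. lam c x)" by (rule ext) (rule ev_hgen)
  then show ?thesis using line_poly_ev[of "hgen x"] by (simp only:)
qed

lemma lam_move: "lam (move i s c) x = lam c x + s * \<alpha> i x"
  by (simp add: move_def lam_\<alpha>)

lemma countable_nat_points: "countable nat_points"
proof -
  have "nat_points \<subseteq> (\<lambda>m x. if x \<in> basis then of_nat (m x) else 0) ` (PiE basis (\<lambda>_. UNIV :: nat set))"
  proof
    fix c assume c: "c \<in> nat_points"
    define m where "m = restrict (\<lambda>b. SOME k. c b = of_nat k) basis"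
    have "c b = of_nat (m b)" if "b \<in> basis" for b
    proof -
      have "\<exists>k. c b = of_nat k" using c that unfolding nat_points_def Nats_def by blast
      from someI_ex[OF this] show ?thesis using that by (simp add: m_def)
    qed
    then have "c = (\<lambda>x. if x \<in> basis then of_nat (m x) else 0)" using c by (auto simp: nat_points_def)
    moreover have "m \<in> PiE basis (\<lambda>_. UNIV)" by (simp add: m_def)
    ultimately show "c \<in> (\<lambda>m x. if x \<in> basis then of_nat (m x) else 0) ` (PiE basis (\<lambda>_. UNIV :: nat set))" by blast
  qed
  moreover have "countable (PiE basis (\<lambda>_. UNIV :: nat set))" by (rule countable_PiE[OF basis(3)]) simp
  ultimately show ?thesis by (rule countable_subset[OF _ countable_image])
qed

definition poly_functions where "poly_functions = ev ` {t. env_term t}"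

lemma poly_functions_eqI:
  assumes "f \<in> poly_functions" "g \<in> poly_functions" "\<And>c. c \<in> nat_points \<Longrightarrow> f c = g c"
  shows "f = g"
proof -
  obtain s t where "f = ev s" "env_term s" "g = ev t" "env_term t" using assms(1,2) by (auto simp: poly_functions_def)
  then show ?thesis using ev_cong[OF ev_faithful[of s t]] assms(3) by blast
qed

text \<open>A polynomial function is determined by its values on the countable set
  \<open>nat_points\<close>, hence by a sequence of complex numbers.\<close>

lemma poly_functions_embedding:
  assumes "\<exists>u :: complex \<Rightarrow> 'v. inj u"
  shows "\<exists>J :: _ \<Rightarrow> 'v. inj_on J poly_functions"
proof -
  obtain u :: "complex \<Rightarrow> 'v" where u: "inj u" using assms by blast
  obtain G :: "(nat \<Rightarrow> complex) \<Rightarrow> complex" where G: "inj G" using functions_nat_complex_lepoll by blast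
  let ?J = "\<lambda>f. u (G (\<lambda>n. f (from_nat_into nat_points n)))"
  have "inj_on ?J poly_functions"
  proof (rule inj_onI)
    fix f g assume fg: "f \<in> poly_functions" "g \<in> poly_functions" "?J f = ?J g"
    then have "(\<lambda>n. f (from_nat_into nat_points n)) = (\<lambda>n. g (from_nat_into nat_points n))"
      using u G by (simp add: inj_eq)
    then have "f (from_nat_into nat_points n) = g (from_nat_into nat_points n)" for n by (rule fun_cong)
    then have "f c = g c" if "c \<in> nat_points" for c
      using from_nat_into_surj[OF countable_nat_points that] by metis
    then show "f = g" using poly_functions_eqI fg by blast
  qed
  then show ?thesis by blast
qed

end

text \<open>
  The operators \<open>e\<^sub>i\<close> and \<open>f\<^sub>i\<close> are translations by simple roots followed by multiplication with the
  polynomials \<open>Pt\<close>. The last assumption makes the radical act trivially: the conclusion holds for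
  every \<open>w\<close> that occurs in a homogeneous operator commuting with all \<open>f\<^sub>i\<close> or with all \<open>e\<^sub>i\<close>.
\<close>

locale km_polynomial_rep = kac_moody A sc \<alpha> \<alpha>v
  for A :: "int ^ 'n ^ 'n" and sc :: "complex \<Rightarrow> 'h::ab_group_add \<Rightarrow> 'h"
    and \<alpha> :: "'n::finite \<Rightarrow> 'h \<Rightarrow> complex" and \<alpha>v :: "'n \<Rightarrow> 'h" +
  fixes Pt
  assumes Pt_env_term: "env_term (Pt e i)"
    and Pt_rel: "ev (Pt True i) c * ev (Pt False j) (move i (-1) c)
        = ev (Pt False j) c * ev (Pt True i) (move j 1 c) + (if i = j then lam c (\<alpha>v i) else 0)"
    and Pt_kill: "cone e d \<Longrightarrow> line_poly w \<Longrightarrow>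
        (\<And>i c. w c * ev (Pt (\<not> e) i) (translate d c) = ev (Pt (\<not> e) i) c * w (move i (of_int (sg e)) c)) \<Longrightarrow>
        (\<And>Z c. (\<And>e i c. c \<in> Z \<Longrightarrow> ev (Pt e i) c \<noteq> 0 \<Longrightarrow> move i (- of_int (sg e)) c \<in> Z) \<Longrightarrow>
            c \<in> Z \<Longrightarrow> translate d c \<notin> Z \<Longrightarrow> w c = 0) \<Longrightarrow> w c = 0"
begin

definition hop :: "'h \<Rightarrow> (('h \<Rightarrow> complex) \<Rightarrow> complex) \<Rightarrow> ('h \<Rightarrow> complex) \<Rightarrow> complex" where
  "hop x \<phi> c = lam c x * \<phi> c"

definition xop :: "bool \<Rightarrow> 'n \<Rightarrow> (('h \<Rightarrow> complex) \<Rightarrow> complex) \<Rightarrow> ('h \<Rightarrow> complex) \<Rightarrow> complex" where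
  "xop e i \<phi> c = ev (Pt e i) c * \<phi> (move i (- of_int (sg e)) c)"

lemma move_comm: "move i s (move j t c) = move j t (move i s c)"
  by (simp add: move_def fun_eq_iff)

sublocale rep: km_representation A sc \<alpha> \<alpha>v hop xop
proof
  show "fun_linear (hop x)" for x by (auto simp: fun_linear_def hop_def algebra_simps)
  show "fun_linear (xop e i)" for e i by (auto simp: fun_linear_def xop_def algebra_simps)
  show "hop (x + y) \<phi> a = hop x \<phi> a + hop y \<phi> a" for x y \<phi> a by (simp add: hop_def lam_add algebra_simps)
  show "hop (sc k x) \<phi> a = k * hop x \<phi> a" for k x \<phi> a by (simp add: hop_def lam_scale)
  show "hop x (hop y \<phi>) a = hop y (hop x \<phi>) a" for x y \<phi> a by (simp add: hop_def)
  show "hop x (xop e i \<phi>) a = xop e i (hop x \<phi>) a + of_int (sg e) * \<alpha> i x * xop e i \<phi> a" for x e i \<phi> a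
    by (simp add: hop_def xop_def lam_move algebra_simps)
  show "xop True i (xop False j \<phi>) a - xop False j (xop True i \<phi>) a = (if i = j then hop (\<alpha>v i) \<phi> a else 0)" for i j \<phi> a
  proof -
    let ?b = "\<phi> (move j 1 (move i (-1) a))"
    have "xop True i (xop False j \<phi>) a - xop False j (xop True i \<phi>) a
      = (ev (Pt True i) a * ev (Pt False j) (move i (-1) a) - ev (Pt False j) a * ev (Pt True i) (move j 1 a)) * ?b"
      by (simp add: xop_def move_comm[of i "-1" j 1] left_diff_distrib)
    also have "\<dots> = (if i = j then lam a (\<alpha>v i) else 0) * ?b" by (simp add: Pt_rel)
    also have "\<dots> = (if i = j then hop (\<alpha>v i) \<phi> a else 0)"
      by (auto simp: hop_def move_def)
    finally show ?thesis .
  qed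
qed

abbreviation "act \<equiv> rep.act"

lemma translate_zero: "translate (\<lambda>_. 0) c = c"
  by (simp add: translate_def wt_zero)

lemma translate_upd: "translate (d(i := d i + k)) c = translate d (move i (- of_int k) c)"
  by (simp add: translate_def move_def wt_upd fun_eq_iff)

lemma translate_move: "translate d (move i s c) = move i s (translate d c)"
  by (simp add: translate_def move_def fun_eq_iff)

lemma line_poly_move: "line_poly w \<Longrightarrow> line_poly (\<lambda>c. w (move i s c))"
  unfolding move_def by (rule line_poly_translate)

lemma line_poly_sub: "line_poly w \<Longrightarrow> line_poly (\<lambda>c. w (translate d c))"
  unfolding translate_def using line_poly_translate[of w "\<lambda>x. - wt d x"] by simp

lemma act_H: "act (Gen (H x)) \<phi> c = lam c x * \<phi> c"
  by (subst rep.act_Gen(1)) (rule hop_def)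

lemma act_X: "act (root_gen e i) \<phi> c = ev (Pt e i) c * \<phi> (move i (- of_int (sg e)) c)"
  by (subst rep.act_Gen(2)) (rule xop_def)

lemma act_Prod_X:
  assumes "\<And>\<phi> c. act t \<phi> c = w c * \<phi> (translate d c)"
  shows "act (Prod (root_gen e i) t) \<phi> c =
    (ev (Pt e i) c * w (move i (- of_int (sg e)) c) - w c * ev (Pt e i) (translate d c))
      * \<phi> (translate d (move i (- of_int (sg e)) c))"
proof -
  have "act (Prod (root_gen e i) t) \<phi> c = act (root_gen e i) (act t \<phi>) c - act t (act (root_gen e i) \<phi>) c" by simp
  also have "\<dots> = ev (Pt e i) c * (w (move i (- of_int (sg e)) c) * \<phi> (translate d (move i (- of_int (sg e)) c)))
      - w c * (ev (Pt e i) (translate d c) * \<phi> (move i (- of_int (sg e)) (translate d c)))"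
    by (simp only: assms act_X)
  finally show ?thesis by (simp only: translate_move left_diff_distrib mult.assoc)
qed

lemma act_gr: "gr d t \<Longrightarrow> \<exists>w. line_poly w \<and> (\<forall>\<phi> c. act t \<phi> c = w c * \<phi> (translate d c))"
proof (induction rule: gr.induct)
  case (gr_H x)
  show ?case by (intro exI[of _ "\<lambda>c. lam c x"]) (simp only: line_poly_lam act_H translate_zero simp_thms)
next
  case (gr_X i e)
  have "translate ((\<lambda>_. 0)(i := sg e)) c = move i (- of_int (sg e)) c" for c
    using translate_upd[of "\<lambda>_. 0" i "sg e" c] by (simp only: add_0 translate_zero)
  then show ?case
    by (intro exI[of _ "ev (Pt e i)"]) (simp only: line_poly_ev act_X simp_thms)
next
  case (gr_P d t e i)
  then obtain w where w: "line_poly w" "\<And>\<phi> c. act t \<phi> c = w c * \<phi> (translate d c)" by blast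
  let ?w = "\<lambda>c. ev (Pt e i) c * w (move i (- of_int (sg e)) c) - w c * ev (Pt e i) (translate d c)"
  have "act (Prod (root_gen e i) t) \<phi> c = ?w c * \<phi> (translate (d(i := d i + sg e)) c)" for \<phi> c
    unfolding translate_upd by (rule act_Prod_X[OF w(2)])
  moreover have "line_poly ?w"
    by (intro line_poly_diff line_poly_mult line_poly_ev line_poly_move line_poly_sub w(1))
  ultimately show ?case by (intro exI[of _ ?w]) blast
next
  case (gr_Zero d)
  show ?case by (intro exI[of _ "\<lambda>_. 0"]) (simp add: line_poly_const)
next
  case (gr_Add d s t)
  then obtain w w' where "line_poly w" "\<And>\<phi> c. act s \<phi> c = w c * \<phi> (translate d c)"
    "line_poly w'" "\<And>\<phi> c. act t \<phi> c = w' c * \<phi> (translate d c)" by blast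
  then show ?case by (intro exI[of _ "\<lambda>c. w c + w' c"]) (simp add: line_poly_add distrib_right)
next
  case (gr_Scale d s k)
  then obtain w where "line_poly w" "\<And>\<phi> c. act s \<phi> c = w c * \<phi> (translate d c)" by blast
  then show ?case by (intro exI[of _ "\<lambda>c. k * w c"]) (simp add: line_poly_mult line_poly_const)
next
  case (gr_cong d s t)
  then show ?case using rep.act_cong by metis
qed

text \<open>If no generator leads out of Z with a nonzero coefficient, then values off Z do not
  influence the result on Z. This justifies the premise about Z in \<open>Pt_kill\<close>.\<close>

lemma act_local:
  assumes "\<And>e i c. c \<in> Z \<Longrightarrow> ev (Pt e i) c \<noteq> 0 \<Longrightarrow> move i (- of_int (sg e)) c \<in> Z"
  shows "local_on Z (act t)"
proof (rule interp_local)
  fix g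
  have x: "local_on Z (xop e i)" for e i
    unfolding local_on_def xop_def using assms[of _ e i] by (metis mult_zero_left)
  show "local_on Z (gen_op hop xop g)"
    using x by (cases g) (auto simp: gen_op_def local_on_def hop_def)
qed

lemma cone_lower:
  assumes "cone e d" "cone (\<not> e) (d(i := d i + sg (\<not> e)))"
  shows False
proof -
  let ?d = "d(i := d i + sg (\<not> e))"
  have c: "sg e * d m \<ge> 0" "sg (\<not> e) * ?d m \<ge> 0" for m
    using assms by (auto simp: cone_def)
  have o: "d m = 0" if "m \<noteq> i" for m
    using c[of m] that by (cases e) auto
  have "d i \<noteq> 0" using assms(1) o unfolding cone_def by metis
  then have "?d i = 0" using c[of i] by (cases e) auto
  then have "?d = (\<lambda>_. 0)" using o by auto
  then show False using assms(2) by (simp add: cone_def)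
qed

text \<open>Bracketing with a generator of the opposite sign stays in the ideal and lowers the
  height. The result acts by zero by induction, or is itself zero when degree zero is reached, since
  the ideal is trivial. So \<open>Pt_kill\<close> applies.\<close>

lemma act_trivial_cone:
  assumes T: "trivial_term_ideal T"
  shows "gr d t \<Longrightarrow> t \<in> T \<Longrightarrow> cone e d \<Longrightarrow> act t \<phi> c = 0"
proof (induction "nat (\<Sum>i\<in>UNIV. sg e * d i)" arbitrary: d t \<phi> c rule: less_induct)
  case less
  obtain w where w: "line_poly w" "\<And>\<phi> c. act t \<phi> c = w c * \<phi> (translate d c)" using act_gr[OF less.prems(1)] by blast
  have comm: "act (Prod (root_gen (\<not> e) i) t) \<phi> c = 0" for i \<phi> c
  proof -
    let ?d = "d(i := d i + sg (\<not> e))" and ?u = "Prod (root_gen (\<not> e) i) t"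
    have u: "gr ?d ?u" by (rule gr_X_closed[OF less.prems(1)])
    have uT: "?u \<in> T" using T less.prems(2) term_idealD(4) unfolding trivial_term_ideal_def by blast
    have z: "act ?u \<phi> c = 0" if "?u \<doteq> Zero" using rep.act_cong[OF that] by simp
    have "(\<exists>e'. cone e' ?d) \<longrightarrow> cone e ?d"
    proof (intro impI; elim exE)
      fix e' assume e': "cone e' ?d"
      then have "e' \<noteq> (\<not> e)" using cone_lower[OF less.prems(3), of i] by blast
      then have "e' = e" by blast
      then show "cone e ?d" using e' by simp
    qed
    then consider "?d = (\<lambda>_. 0)" | "cone e ?d" | "?u \<doteq> Zero" using gr_cone[OF u] by blast
    then show ?thesis
    proof cases
      case 1
      then have "gr (\<lambda>_. 0) ?u" using u by (simp only:)
      then show ?thesis using z trivial_gr_zero[OF T uT] by blast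
    next
      case 2
      have "(\<Sum>k\<in>UNIV. sg e * ?d k) = (\<Sum>k\<in>UNIV. sg e * d k + (if k = i then -1 else 0))"
        by (rule sum.cong) (auto simp: algebra_simps)
      then have s: "(\<Sum>k\<in>UNIV. sg e * ?d k) = (\<Sum>k\<in>UNIV. sg e * d k) - 1" by (simp add: sum.distrib)
      have "(\<Sum>k\<in>UNIV. sg e * ?d k) \<ge> 0" using 2 by (intro sum_nonneg) (auto simp: cone_def)
      then have "nat (\<Sum>k\<in>UNIV. sg e * ?d k) < nat (\<Sum>k\<in>UNIV. sg e * d k)" unfolding s by linarith
      then show ?thesis using less.hyps[OF _ u uT 2] by blast
    qed (rule z)
  qed
  have "w c = 0" for c
  proof (rule Pt_kill[OF less.prems(3) w(1)])
    fix i c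
    have "act (Prod (root_gen (\<not> e) i) t) (\<lambda>_. 1) c = 0" by (rule comm)
    then show "w c * ev (Pt (\<not> e) i) (translate d c) = ev (Pt (\<not> e) i) c * w (move i (of_int (sg e)) c)"
      by (simp only: act_Prod_X[OF w(2)] mult_1_right sg_simps of_int_minus minus_minus right_minus_eq)
  next
    fix Z c
    assume Z: "\<And>e i c. c \<in> Z \<Longrightarrow> ev (Pt e i) c \<noteq> 0 \<Longrightarrow> move i (- of_int (sg e)) c \<in> Z"
      and c: "c \<in> Z" "translate d c \<notin> Z"
    have "local_on Z (act t)" using Z by (rule act_local)
    \<comment> \<open>The zero function and the indicator of the target point agree on Z, since that
      point lies outside; the values of the operator on them at c are 0 and w c.\<close>
    then have "act t (\<lambda>_. 0) c = act t (\<lambda>c'. if c' = translate d c then 1 else 0) c"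
      by (rule local_onD[OF _ _ c(1)]) (use c(2) in auto)
    then show "w c = 0" by (simp only: w(2)) simp
  qed
  then show ?case by (simp only: w(2) mult_zero_left)
qed

lemma act_rad: "t \<in> rad \<Longrightarrow> act t \<phi> c = 0"
proof -
  have base: "act s \<phi> c = 0" if "trivial_term_ideal T" "s \<in> T" "gr d s" for T d s
    using gr_cone[OF that(3)]
  proof (elim disjE exE)
    assume "d = (\<lambda>_. 0)"
    then show ?thesis using rep.act_cong[OF trivial_gr_zero] that by simp
  next
    fix e assume "cone e d"
    then show ?thesis using act_trivial_cone that by blast
  next
    assume "s \<doteq> Zero"
    then show ?thesis using rep.act_cong by simp
  qed
  assume "t \<in> rad"
  from rad_hspan[OF this] show ?thesis
  proof (induction rule: hspan.induct)
    case (hspan_base s)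
    then show ?case using base by blast
  next
    case (hspan_cong s t)
    then show ?case using rep.act_cong[OF hspan_cong.hyps(2)] by simp
  qed simp_all
qed

lemma act_proj: "proj s = proj t \<Longrightarrow> act s = act t"
proof (intro ext)
  fix \<phi> c assume "proj s = proj t"
  then have "act (Add s (Scale (-1) t)) \<phi> c = 0" by (simp only: proj_eq_iff act_rad)
  then show "act s \<phi> c = act t \<phi> c" by simp
qed

lemma hop_ev: "hop x (ev t) = ev (Prod (hgen x) t)"
proof
  show "hop x (ev t) c = ev (Prod (hgen x) t) c" for c
    by (simp only: hop_def ev.simps(5) ev_hgen)
qed

lemma xop_ev:
  assumes "env_term t" shows "xop e i (ev t) = ev (Prod (Pt e i) (shift_term e i t))"
  using ev_shift_term[OF assms] by (simp add: xop_def fun_eq_iff move_def)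

lemma poly_functions_ops:
  "f \<in> poly_functions \<Longrightarrow> g \<in> poly_functions \<Longrightarrow> (\<lambda>c. f c + g c) \<in> poly_functions"
  "f \<in> poly_functions \<Longrightarrow> (\<lambda>c. k * f c) \<in> poly_functions"
  "(\<lambda>c. 0) \<in> poly_functions"
proof -
  have "(\<lambda>c. ev s c + ev t c) = ev (Add s t)" "(\<lambda>c. k * ev s c) = ev (Scale k s)" "(\<lambda>c. 0) = ev Zero" for s t
    by (simp_all add: fun_eq_iff)
  then show "f \<in> poly_functions \<Longrightarrow> g \<in> poly_functions \<Longrightarrow> (\<lambda>c. f c + g c) \<in> poly_functions"
    "f \<in> poly_functions \<Longrightarrow> (\<lambda>c. k * f c) \<in> poly_functions" "(\<lambda>c. 0) \<in> poly_functions"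
    unfolding poly_functions_def by (auto simp: image_iff) (metis env_term_simps(4), metis env_term_simps(6), metis env_term_simps(3))
qed

lemma act_poly_functions: "f \<in> poly_functions \<Longrightarrow> act t f \<in> poly_functions"
proof (induction t arbitrary: f)
  case (Gen g)
  then obtain s where s: "f = ev s" "env_term s" by (auto simp: poly_functions_def)
  consider x where "g = H x" | e i where "Gen g = root_gen e i"
    by (cases g) (auto simp: root_gen_def, (metis (full_types))+)
  then show ?case
  proof cases
    case 1
    then have "act (Gen g) f = ev (Prod (hgen x) s)" using s hop_ev rep.act_Gen(1) by metis
    moreover have "ev (Prod (hgen x) s) \<in> poly_functions"
      unfolding poly_functions_def by (rule imageI) (simp add: s(2))
    ultimately show ?thesis by (simp only:)
  next
    case 2
    then have "act (Gen g) f = ev (Prod (Pt e i) (shift_term e i s))" using s xop_ev rep.act_Gen(2) by metis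
    moreover have "ev (Prod (Pt e i) (shift_term e i s)) \<in> poly_functions"
      unfolding poly_functions_def by (rule imageI) (simp add: s(2) Pt_env_term shift_term_env_term)
    ultimately show ?thesis by (simp only:)
  qed
next
  case (Prod s t)
  have "act (Prod s t) f = (\<lambda>c. act s (act t f) c + (-1) * act t (act s f) c)" by (simp add: fun_eq_iff)
  then show ?case using Prod poly_functions_ops by presburger
qed (simp_all add: poly_functions_ops)

text \<open>The module is the space of polynomial functions, moved into the given universe by an
  injection. The constant function 1 is a basis because \<open>ev\<close> is faithful.\<close>

theorem category_H_nonempty:
  assumes "\<exists>u :: complex \<Rightarrow> 'v. inj u"
  shows "(category_H \<gg> (cartan_subalgebra sc \<alpha> \<alpha>v) :: ((complex, 'v) module \<times> _) set) \<noteq> {}"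
proof -
  obtain J :: "_ \<Rightarrow> 'v" where J: "inj_on J poly_functions" using poly_functions_embedding[OF assms] by blast
  define K where "K = inv_into poly_functions J"
  have KJ: "K (J f) = f" if "f \<in> poly_functions" for f using that J by (simp add: K_def)
  define V :: "(complex, 'v) module" where
    "V = \<lparr>carrier = J ` poly_functions, monoid.mult = undefined, one = undefined, zero = J (\<lambda>c. 0),
      add = (\<lambda>u v. J (\<lambda>c. K u c + K v c)), module.smult = (\<lambda>k v. J (\<lambda>c. k * K v c))\<rparr>"
  \<comment> \<open>By \<open>act_proj\<close> the choice of the representing term does not matter,
    as the radical acts by zero.\<close>
  define \<rho> where "\<rho> y v = J (act (SOME t. proj t = y) (K v))" for y v
  have Vc: "carrier V = J ` poly_functions" "\<zero>\<^bsub>V\<^esub> = J (\<lambda>c. 0)" by (simp_all add: V_def)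
  have Va: "J f \<oplus>\<^bsub>V\<^esub> J g = J (\<lambda>c. f c + g c)" if "f \<in> poly_functions" "g \<in> poly_functions" for f g
    using that by (simp add: V_def KJ)
  have Vs: "k \<odot>\<^bsub>V\<^esub> J f = J (\<lambda>c. k * f c)" if "f \<in> poly_functions" for k f
    using that by (simp add: V_def KJ)
  have \<rho>: "\<rho> (proj t) (J f) = J (act t f)" if "f \<in> poly_functions" for t f
  proof -
    have "proj (SOME s. proj s = proj t) = proj t" by (rule someI[of _ t]) simp
    then have "act (SOME s. proj s = proj t) = act t" by (rule act_proj)
    then show ?thesis using that by (simp only: \<rho>_def KJ)
  qed
  note pf = poly_functions_ops act_poly_functions
  have mod: "Module.module Cring V"
  proof (rule moduleI)
    show "cring Cring" by (rule cring_from_type_algebra)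
    show "abelian_group V"
    proof (rule abelian_groupI)
      fix x assume "x \<in> carrier V"
      then obtain f where f: "x = J f" "f \<in> poly_functions" by (auto simp: Vc)
      have "J (\<lambda>c. (-1) * f c) \<oplus>\<^bsub>V\<^esub> x = J (\<lambda>c. (-1) * f c + f c)"
        unfolding f(1) by (rule Va[OF pf(2)[OF f(2)] f(2)])
      also have "\<dots> = \<zero>\<^bsub>V\<^esub>" by (simp add: Vc)
      finally show "\<exists>y\<in>carrier V. y \<oplus>\<^bsub>V\<^esub> x = \<zero>\<^bsub>V\<^esub>"
        by (rule bexI) (use pf(2)[OF f(2), of "-1"] in \<open>simp add: Vc\<close>)
    qed (auto simp: Vc Va pf add_ac)
    show "(a \<oplus>\<^bsub>Cring\<^esub> b) \<odot>\<^bsub>V\<^esub> x = a \<odot>\<^bsub>V\<^esub> x \<oplus>\<^bsub>V\<^esub> b \<odot>\<^bsub>V\<^esub> x" if "x \<in> carrier V" for a b x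
      using that by (auto simp: Vc Va Vs pf ring_of_type_algebra_def distrib_right)
    show "a \<odot>\<^bsub>V\<^esub> (x \<oplus>\<^bsub>V\<^esub> y) = a \<odot>\<^bsub>V\<^esub> x \<oplus>\<^bsub>V\<^esub> a \<odot>\<^bsub>V\<^esub> y" if "x \<in> carrier V" "y \<in> carrier V" for a x y
      using that by (auto simp: Vc Va Vs pf distrib_left)
    show "(a \<otimes>\<^bsub>Cring\<^esub> b) \<odot>\<^bsub>V\<^esub> x = a \<odot>\<^bsub>V\<^esub> (b \<odot>\<^bsub>V\<^esub> x)" if "x \<in> carrier V" for a b x
      using that by (auto simp: Vc Vs pf ring_of_type_algebra_def mult.assoc)
    show "\<one>\<^bsub>Cring\<^esub> \<odot>\<^bsub>V\<^esub> x = x" if "x \<in> carrier V" for x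
      using that by (auto simp: Vc Vs ring_of_type_algebra_def)
  qed (auto simp: Vc Vs pf)
  have lie: "lie_module \<gg> V \<rho>"
  proof -
    interpret L: lie_algebra \<gg> by (rule km.lie_algebra_L)
    interpret M: Module.module Cring V by (rule mod)
    have neg: "\<ominus>\<^bsub>V\<^esub> J f = J (\<lambda>c. (-1) * f c)" if "f \<in> poly_functions" for f
    proof (rule M.minus_equality)
      have "J (\<lambda>c. (-1) * f c) \<oplus>\<^bsub>V\<^esub> J f = J (\<lambda>c. (-1) * f c + f c)" by (rule Va[OF pf(2)[OF that] that])
      also have "\<dots> = \<zero>\<^bsub>V\<^esub>" by (simp add: Vc)
      finally show "J (\<lambda>c. (-1) * f c) \<oplus>\<^bsub>V\<^esub> J f = \<zero>\<^bsub>V\<^esub>" .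
    qed (use that pf(2)[OF that, of "-1"] in \<open>auto simp: Vc\<close>)
    note lin = fun_linearD(1,2)[OF rep.act_linear]
    show ?thesis
    proof
      show "\<rho> x v \<in> carrier V" if "x \<in> carrier \<gg>" "v \<in> carrier V" for x v
        using that by (auto simp: carrier_km Vc \<rho> pf)
      show "\<rho> x (v \<oplus>\<^bsub>V\<^esub> w) = \<rho> x v \<oplus>\<^bsub>V\<^esub> \<rho> x w" if "x \<in> carrier \<gg>" "v \<in> carrier V" "w \<in> carrier V" for x v w
        using that by (auto simp: carrier_km Vc \<rho> pf Va lin)
      show "\<rho> x (k \<odot>\<^bsub>V\<^esub> v) = k \<odot>\<^bsub>V\<^esub> \<rho> x v" if "x \<in> carrier \<gg>" "v \<in> carrier V" for x k v
        using that by (auto simp: carrier_km Vc \<rho> pf Vs lin)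
      show "\<rho> (x \<oplus>\<^bsub>\<gg>\<^esub> y) v = \<rho> x v \<oplus>\<^bsub>V\<^esub> \<rho> y v" if "x \<in> carrier \<gg>" "y \<in> carrier \<gg>" "v \<in> carrier V" for x y v
        using that by (auto simp: carrier_km Vc \<rho> pf Va add_km)
      show "\<rho> (k \<odot>\<^bsub>\<gg>\<^esub> x) v = k \<odot>\<^bsub>V\<^esub> \<rho> x v" if "x \<in> carrier \<gg>" "v \<in> carrier V" for k x v
        using that by (auto simp: carrier_km Vc \<rho> pf Vs smult_km)
      show "\<rho> (x \<otimes>\<^bsub>\<gg>\<^esub> y) v = \<rho> x (\<rho> y v) \<ominus>\<^bsub>V\<^esub> \<rho> y (\<rho> x v)" if xyv: "x \<in> carrier \<gg>" "y \<in> carrier \<gg>" "v \<in> carrier V" for x y v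
      proof -
        obtain s t f where *: "x = proj s" "y = proj t" "v = J f" "f \<in> poly_functions" using xyv by (auto simp: carrier_km Vc)
        have 1: "act s (act t f) \<in> poly_functions" "act t (act s f) \<in> poly_functions" using * pf by auto
        have "\<rho> (x \<otimes>\<^bsub>\<gg>\<^esub> y) v = J (act (Prod s t) f)" using * by (simp only: mult_km \<rho>)
        also have "\<dots> = J (\<lambda>c. act s (act t f) c + (-1) * act t (act s f) c)" by simp
        also have "\<dots> = J (act s (act t f)) \<oplus>\<^bsub>V\<^esub> J (\<lambda>c. (-1) * act t (act s f) c)" by (rule Va[OF 1(1) pf(2)[OF 1(2)], symmetric])
        also have "\<dots> = \<rho> x (\<rho> y v) \<ominus>\<^bsub>V\<^esub> \<rho> y (\<rho> x v)" using * neg[OF 1(2)] by (simp add: \<rho> pf a_minus_def)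
        finally show ?thesis .
      qed
    qed
  qed
  interpret km_module A sc \<alpha> \<alpha>v V \<rho> by (intro km_module.intro lie kac_moody_axioms)
  \<comment> \<open>Stated for every \<open>ev s\<close> instead of only the basis vector, because
    in a product the left factor acts on a vector already transformed.\<close>
  have e1: "eact t (J (ev s)) = J (ev (Prod t s))" if "env_term t" "env_term s" for s t
    using that
  proof (induction t arbitrary: s)
    case (Gen g)
    have f: "ev s \<in> poly_functions" using Gen by (auto simp: poly_functions_def)
    from Gen(1) show ?case
    proof (rule env_term_cases)
      assume g: "g = None"
      have "ev (Prod (Gen None) s) = ev s" by (simp add: fun_eq_iff)
      then show ?thesis unfolding g by simp
    next
      fix x assume g: "g = Some (cart x)"
      then have "eact (Gen g) (J (ev s)) = J (hop x (ev s))"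
        using \<rho>[OF f, of "Gen (H x)"] by (simp add: cart_def[symmetric] rep.act_Gen(1) del: interp.simps)
      then show ?thesis unfolding g by (simp only: hop_ev)
    qed
  next
    case Zero
    have "ev (Prod Zero s) = (\<lambda>c. 0)" by (simp add: fun_eq_iff)
    then show ?case by (simp only: eact.simps(2) Vc)
  next
    case (Add t u)
    have pm: "ev (Prod t s) \<in> poly_functions" "ev (Prod u s) \<in> poly_functions"
      unfolding poly_functions_def by (rule imageI, use Add.prems in simp)+
    have "ev (Prod (Add t u) s) = (\<lambda>c. ev (Prod t s) c + ev (Prod u s) c)" by (simp add: fun_eq_iff distrib_right)
    moreover have "eact t (J (ev s)) = J (ev (Prod t s))" "eact u (J (ev s)) = J (ev (Prod u s))"
      using Add.prems by (auto intro!: Add.IH simp del: ev.simps)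
    ultimately show ?case using Va[OF pm] by (simp only: eact.simps(3))
  next
    case (Scale k t)
    have pm: "ev (Prod t s) \<in> poly_functions"
      unfolding poly_functions_def by (rule imageI) (use Scale.prems in simp)
    have "ev (Prod (Scale k t) s) = (\<lambda>c. k * ev (Prod t s) c)" by (simp add: fun_eq_iff)
    moreover have "eact t (J (ev s)) = J (ev (Prod t s))"
      by (rule Scale.IH) (use Scale.prems in auto)
    ultimately show ?case using Vs[OF pm] by (simp only: eact.simps(4))
  next
    case (Prod t u)
    have "ev (alg_term.Prod (alg_term.Prod t u) s) = ev (alg_term.Prod t (alg_term.Prod u s))"
      by (simp add: fun_eq_iff mult.assoc)
    moreover have "eact u (J (ev s)) = J (ev (alg_term.Prod u s))"
      by (rule Prod.IH(2)) (use Prod.prems in auto)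
    moreover have "eact t (J (ev (alg_term.Prod u s))) = J (ev (alg_term.Prod t (alg_term.Prod u s)))"
      by (rule Prod.IH(1)) (use Prod.prems in auto)
    ultimately show ?case by (simp only: eact.simps(5))
  qed
  have e: "eact t (J (ev (Gen None))) = J (ev t)" if "env_term t" for t
  proof -
    have "ev (Prod t (Gen None)) = ev t" by (simp add: fun_eq_iff)
    then show ?thesis using e1[OF that env_term_simps(1)] by (simp only:)
  qed
  have "free_of_rank_one (enveloping_algebra \<hh>) (env_module V \<rho>)"
    unfolding free_iff
  proof (intro bexI conjI ballI allI impI)
    show "J (ev (Gen None)) \<in> carrier V"
      unfolding Vc poly_functions_def by (intro imageI) simp
    show "\<exists>t. env_term t \<and> v = eact t (J (ev (Gen None)))" if vV: "v \<in> carrier V" for v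
    proof -
      obtain t where t: "v = J (ev t)" "env_term t" using vV unfolding Vc poly_functions_def by blast
      show ?thesis by (intro exI[of _ t] conjI t(2)) (simp only: e[OF t(2)] t(1))
    qed
    show "s \<asymp> t" if "env_term s" "env_term t" "eact s (J (ev (Gen None))) = eact t (J (ev (Gen None)))" for s t
    proof -
      have "J (ev s) = J (ev t)" using that(3) unfolding e[OF that(1)] e[OF that(2)] .
      moreover have "ev s \<in> poly_functions" "ev t \<in> poly_functions"
        using that(1,2) unfolding poly_functions_def by blast+
      ultimately have "ev s = ev t" using inj_onD[OF J] by blast
      then show ?thesis using ev_faithful[OF that(1,2)] by simp
    qed
  qed
  then have "(V, \<rho>) \<in> category_H \<gg> (cartan_subalgebra sc \<alpha> \<alpha>v)"
    unfolding category_H_def cartan_subalgebra_eq using lie by simp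
  then show ?thesis by blast
qed

end

section \<open>Modules for the types A and C\<close>

text \<open>In sl(l+1) the sum of the coroots from k to l is the diagonal matrix E_kk - E_(l+1,l+1),
  and these are the values of the root eps_j - eps_(j+1) on it.\<close>

lemma sum_cartan_A:
  assumes "1 \<le> k" "k \<le> Suc l" "1 \<le> j" "j \<le> l"
  shows "(\<Sum>i = k..l. cartan_A i j) = (if j = k then 1 else 0) - (if k = Suc j then 1 else 0) + (if j = l then 1 else 0)"
  using assms(2,1)
proof (induction k rule: inc_induct)
  case base
  then show ?case using assms by auto
next
  case (step k)
  then have "(\<Sum>i = k..l. cartan_A i j) = cartan_A k j + (\<Sum>i = Suc k..l. cartan_A i j)"
    by (simp add: sum.atLeast_Suc_atMost)
  then show ?case using step by (auto simp: cartan_A_def)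
qed

text \<open>In sp(2l) the sum of the coroots from k to l is the k-th coordinate vector of the Cartan
  subalgebra, on which the long root 2 eps_l takes the value 2 if k = l.\<close>

lemma sum_cartan_C:
  assumes "1 \<le> k" "k \<le> l" "1 \<le> j" "j \<le> l" "2 \<le> l"
  shows "(\<Sum>i = k..l. cartan_C l i j) = (if j = k then if j = l then 2 else 1 else 0) - (if k = Suc j then 1 else 0)"
proof -
  have "(\<Sum>i = k..l. cartan_C l i j) = (\<Sum>i = k..l. cartan_A i j + (if i = l - 1 \<and> j = l then -1 else 0))"
    using assms by (intro sum.cong) (auto simp: cartan_C_def cartan_A_def)
  also have "\<dots> = (\<Sum>i = k..l. cartan_A i j) + (\<Sum>i = k..l. if i = l - 1 then if j = l then -1 else 0 else 0)"
    unfolding sum.distrib by (intro arg_cong2[where f = "(+)"] sum.cong) auto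
  also have "(\<Sum>i = k..l. if i = l - 1 then if j = l then -1 else 0 else 0 :: int) = (if k \<le> l - 1 \<and> j = l then -1 else 0)"
    using assms by (simp add: sum.delta')
  finally show ?thesis using assms sum_cartan_A[of k l j] by auto
qed

lemma (in kac_moody) \<alpha>_sum: "\<alpha> i (\<Sum>x\<in>I. f x) = (\<Sum>x\<in>I. \<alpha> i (f x))"
proof -
  have "\<alpha> i 0 = 0" using \<alpha>_scale[of i 0 0] by simp
  then show ?thesis by (induction I rule: infinite_finite_induct) (simp_all add: \<alpha>_add)
qed

text \<open>
  The polynomials of the modules are built from the affine functions \<open>M k\<close>; moving by \<open>\<alpha>\<^sub>j\<close>
  changes \<open>M k\<close> by \<open>\<mu> k j\<close>.
\<close>

locale coordinates = kac_moody A sc \<alpha> \<alpha>v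
  for A :: "int ^ 'n ^ 'n" and sc :: "complex \<Rightarrow> 'h::ab_group_add \<Rightarrow> 'h"
    and \<alpha> :: "'n::finite \<Rightarrow> 'h \<Rightarrow> complex" and \<alpha>v :: "'n \<Rightarrow> 'h" +
  fixes l :: nat and \<sigma> :: "nat \<Rightarrow> 'n" and \<nu> :: "nat \<Rightarrow> 'h" and \<kappa> :: complex and \<mu> :: "nat \<Rightarrow> nat \<Rightarrow> int" and K :: "nat set"
  assumes \<sigma>: "bij_betw \<sigma> {1..l} UNIV"
    and \<alpha>_\<nu>: "k \<in> K \<Longrightarrow> j \<in> {1..l} \<Longrightarrow> \<alpha> (\<sigma> j) (\<nu> k) = of_int (\<mu> k j)"
begin

definition "M k c = lam c (\<nu> k) + \<kappa>"
definition "Mt k = Add (hgen (\<nu> k)) (Scale \<kappa> (Gen None))"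
definition "idx = inv_into {1..l} \<sigma>"

lemma idx: "idx i \<in> {1..l}" "\<sigma> (idx i) = i" "j \<in> {1..l} \<Longrightarrow> idx (\<sigma> j) = j"
  using \<sigma> unfolding idx_def bij_betw_def
  by (metis UNIV_I inv_into_into, metis UNIV_I f_inv_into_f, metis inv_into_f_f)

lemma ev_Mt: "ev (Mt k) c = M k c"
  by (simp add: Mt_def M_def ev_hgen del: ev.simps(1)) simp

lemma env_term_Mt: "env_term (Mt k)"
  by (simp add: Mt_def)

lemma M_move: "k \<in> K \<Longrightarrow> j \<in> {1..l} \<Longrightarrow> M k (move (\<sigma> j) s c) = M k c + s * of_int (\<mu> k j)"
  by (simp add: M_def lam_move \<alpha>_\<nu>)

lemma lam_translate: "lam (translate d c) x = lam c x - wt d x"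
proof -
  have "lam (wt d) x = (\<Sum>b\<in>basis. \<Sum>i\<in>UNIV. of_int (d i) * (V.representation basis x b * \<alpha> i b))"
    unfolding lam_def wt_def by (simp add: sum_distrib_left mult.left_commute)
  also have "\<dots> = (\<Sum>i\<in>UNIV. of_int (d i) * lam (\<alpha> i) x)"
    unfolding lam_def by (subst sum.swap) (simp add: sum_distrib_left)
  also have "\<dots> = wt d x" by (simp add: wt_def lam_linear[OF \<alpha>_linear])
  finally have "lam (wt d) x = wt d x" .
  then show ?thesis using lam_plus_scale[of c "-1" "wt d" x] by (simp add: translate_def)
qed

definition "D d k = (\<Sum>j = 1..l. d (\<sigma> j) * \<mu> k j)"

lemma M_translate:
  assumes "k \<in> K"
  shows "M k (translate d c) = M k c - of_int (D d k)"
proof -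
  have "wt d (\<nu> k) = (\<Sum>j\<in>{1..l}. of_int (d (\<sigma> j)) * \<alpha> (\<sigma> j) (\<nu> k))"
    unfolding wt_def using sum.reindex_bij_betw[OF \<sigma>, of "\<lambda>i. of_int (d i) * \<alpha> i (\<nu> k)"] by simp
  also have "\<dots> = of_int (D d k)"
    unfolding D_def of_int_sum of_int_mult by (rule sum.cong) (auto simp: \<alpha>_\<nu> assms)
  finally show ?thesis by (simp add: M_def lam_translate)
qed

lemma move_move: "move i s (move i t c) = move i (s + t) c"
  by (simp add: move_def fun_eq_iff algebra_simps)

lemma move_0: "move i 0 c = c"
  by (simp add: move_def)

lemma line_poly_line:
  assumes w: "line_poly w" and e: "e \<noteq> 0" and z: "\<And>n::nat. w (move i (e * of_nat n) c0) = 0"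
  shows "w (move i s c0) = 0"
proof -
  have "range (\<lambda>n::nat. e * of_nat n) \<subseteq> {s. w (move i s c0) = 0}" using z by auto
  moreover have "infinite (range (\<lambda>n::nat. e * of_nat n))"
    using e by (simp add: finite_image_iff inj_on_def)
  ultimately have "infinite {s. w (move i s c0) = 0}" using finite_subset by blast
  then show ?thesis unfolding move_def by (rule line_poly_zero[OF w])
qed

text \<open>The zero of \<open>g\<close> propagates along the root string in the direction in which \<open>g\<close> has no further zeros.\<close>

lemma kill_line:
  assumes w: "line_poly w" and e: "e \<noteq> 0" and k: "k \<in> K" and j: "j \<in> {1..l}" and \<mu>: "\<mu> k j \<noteq> 0"
    and comm: "\<And>c. w c * g (M k (translate d c)) = g (M k c) * w (move (\<sigma> j) e c)"
    and z0: "g z0 = 0" and nz: "\<And>n::nat. g (z0 - of_nat n * (e * of_int (\<mu> k j)) - of_int (D d k)) \<noteq> 0"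
  shows "w c = 0"
proof -
  \<comment> \<open>The line through c in direction \<alpha> \<open>(\<sigma> j)\<close> is followed
    to the point where \<open>M k\<close> equals the zero of g; there the equation yields the first
    zero of w.\<close>
  define s0 where "s0 = (z0 - M k c) / of_int (\<mu> k j)"
  define c0 where "c0 = move (\<sigma> j) s0 c"
  have M0: "M k c0 = z0" using \<mu> by (simp add: c0_def M_move[OF k j] s0_def)
  have "w (move (\<sigma> j) (- e * of_nat n) c0) = 0" for n
  proof (induction n)
    case 0
    have "w c0 * g (z0 - of_int (D d k)) = 0" using comm[of c0] z0 by (simp add: M0 M_translate[OF k])
    then show ?case using nz[of 0] by (simp add: move_0)
  next
    case (Suc n)
    let ?c = "move (\<sigma> j) (- e * of_nat (Suc n)) c0"
    have "move (\<sigma> j) e ?c = move (\<sigma> j) (- e * of_nat n) c0" by (simp add: move_move algebra_simps)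
    then have "w ?c * g (M k (translate d ?c)) = 0" using comm[of ?c] Suc by simp
    moreover have "M k (translate d ?c) = z0 - of_nat (Suc n) * (e * of_int (\<mu> k j)) - of_int (D d k)"
      by (simp only: M_translate[OF k] M_move[OF k j] M0) (simp add: algebra_simps)
    ultimately show ?case using nz[of "Suc n"] by simp
  qed
  then have "w (move (\<sigma> j) (- s0) c0) = 0" using line_poly_line[OF w, of "- e"] e by simp
  then show ?thesis by (simp add: c0_def move_move move_0)
qed

end

theorem (in kac_moody) type_A_nonempty:
  assumes "type_A l A" "1 \<le> l" "\<exists>u :: complex \<Rightarrow> 'v. inj u"
  shows "(category_H \<gg> (cartan_subalgebra sc \<alpha> \<alpha>v) :: ((complex, 'v) module \<times> _) set) \<noteq> {}"
proof -
  obtain \<sigma> where \<sigma>: "bij_betw \<sigma> {1..l} UNIV" "\<And>i j. i \<in> {1..l} \<Longrightarrow> j \<in> {1..l} \<Longrightarrow> A $ \<sigma> i $ \<sigma> j = cartan_A i j"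
    using assms(1) unfolding type_A_def matrix_of_type_def by blast
  define S where "S k = (\<Sum>i = k..l. \<alpha>v (\<sigma> i))" for k
  \<comment> \<open>\<open>S k\<close> is E_kk - E_(l+1,l+1). The correction turns it into the
    traceless part of E_kk, on which the roots take the values \<mu> without an exception at j =
    l.\<close>
  define \<omega> where "\<omega> = sc (- 1 / of_nat (Suc l)) (\<Sum>k = 1..l. S k)"
  define \<nu> where "\<nu> k = S k + \<omega>" for k
  define \<mu> :: "nat \<Rightarrow> nat \<Rightarrow> int" where "\<mu> k j = (if j = k then 1 else 0) - (if k = Suc j then 1 else 0)" for k j
  have \<alpha>S: "\<alpha> (\<sigma> j) (S k) = of_int (\<mu> k j) + (if j = l then 1 else 0)" if "k \<in> {1..Suc l}" "j \<in> {1..l}" for k j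
  proof -
    have "\<alpha> (\<sigma> j) (S k) = (\<Sum>i = k..l. of_int (cartan_A i j))"
      unfolding S_def \<alpha>_sum using that by (intro sum.cong) (auto simp: \<alpha>_\<alpha>v \<sigma>(2))
    also have "\<dots> = of_int (\<Sum>i = k..l. cartan_A i j)" by simp
    also have "\<dots> = of_int (\<mu> k j) + (if j = l then 1 else 0)"
      using that by (subst sum_cartan_A) (auto simp: \<mu>_def)
    finally show ?thesis .
  qed
  have \<alpha>\<omega>: "\<alpha> (\<sigma> j) \<omega> = (if j = l then -1 else 0)" if j: "j \<in> {1..l}" for j
  proof -
    have "(\<Sum>k = 1..l. \<alpha> (\<sigma> j) (S k)) = (\<Sum>k = 1..l. (if k = j then 1 else 0) + ((if k = Suc j then -1 else 0) + (if j = l then 1 else 0)))"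
      using j by (intro sum.cong) (auto simp: \<alpha>S \<mu>_def)
    also have "\<dots> = (if j = l then of_nat (Suc l) else 0)"
      unfolding sum.distrib using j by (auto simp: sum.delta)
    finally show ?thesis unfolding \<omega>_def \<alpha>_scale \<alpha>_sum by (simp del: of_nat_Suc)
  qed
  interpret coordinates A sc \<alpha> \<alpha>v l \<sigma> \<nu> 0 \<mu> "{1..Suc l}"
  proof
    show "\<alpha> (\<sigma> j) (\<nu> k) = of_int (\<mu> k j)" if "k \<in> {1..Suc l}" "j \<in> {1..l}" for k j
      using that by (simp add: \<nu>_def \<alpha>_add \<alpha>S \<alpha>\<omega>)
  qed (rule \<sigma>(1))
  define Pt where "Pt e i = (if e then Mt (Suc (idx i)) else Mt (idx i))" for e i
  have coroot: "lam c (\<alpha>v (\<sigma> j)) = M j c - M (Suc j) c" if "j \<in> {1..l}" for j c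
  proof -
    have "S j = \<alpha>v (\<sigma> j) + S (Suc j)" using that by (simp add: S_def sum.atLeast_Suc_atMost)
    then show ?thesis by (simp add: M_def \<nu>_def lam_add)
  qed
  have D1: "D d k = (if k \<le> l then d (\<sigma> k) else 0) - (if 2 \<le> k then d (\<sigma> (k - 1)) else 0)" if "k \<in> {1..Suc l}" for d k
  proof -
    have "D d k = (\<Sum>j = 1..l. (if j = k then d (\<sigma> j) else 0) + (if j = k - 1 then if 2 \<le> k then - d (\<sigma> j) else 0 else 0))"
      unfolding D_def using that by (intro sum.cong) (auto simp: \<mu>_def)
    then show ?thesis using that by (auto simp: sum.distrib sum.delta)
  qed
  interpret km_polynomial_rep A sc \<alpha> \<alpha>v Pt
  proof
    show "env_term (Pt e i)" for e i by (simp add: Pt_def env_term_Mt)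
    show "ev (Pt True i) c * ev (Pt False j) (move i (-1) c)
        = ev (Pt False j) c * ev (Pt True i) (move j 1 c) + (if i = j then lam c (\<alpha>v i) else 0)" for i j c
    proof -
      obtain a b where ab: "a \<in> {1..l}" "b \<in> {1..l}" "i = \<sigma> a" "j = \<sigma> b" using idx(1,2) by metis
      have id: "idx i = a" "idx j = b" using ab idx(3) by auto
      have 1: "M b (move i (-1) c) = M b c - of_int (\<mu> b a)" using M_move[of b a "-1" c] ab by simp
      have 2: "M (Suc a) (move j 1 c) = M (Suc a) c + of_int (\<mu> (Suc a) b)" using M_move[of "Suc a" b 1 c] ab by simp
      have 3: "(if i = j then lam c (\<alpha>v i) else 0) = (if a = b then M a c - M (Suc a) c else 0)"
      proof -
        have "i = j \<longleftrightarrow> a = b" using id ab(3,4) by metis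
        then show ?thesis using coroot[OF ab(1), of c] by (simp only: ab(3)[symmetric])
      qed
      show ?thesis
        unfolding Pt_def if_True if_False ev_Mt id 1 2 3 \<mu>_def by (simp add: algebra_simps)
    qed
    fix e d w c
    assume cone: "cone e d" and w: "line_poly w"
      and comm: "\<And>i c. w c * ev (Pt (\<not> e) i) (translate d c) = ev (Pt (\<not> e) i) c * w (move i (of_int (sg e)) c)"
    show "w c = 0"
    proof (cases e)
      case True
      \<comment> \<open>By \<open>D1\<close> these numbers are differences of consecutive
        coordinates of d, starting from 0. Were none positive, all coordinates would be nonpositive,
        against d being in the positive cone.\<close>
      have "\<exists>j\<in>{1..l}. D d j > 0"
      proof (rule ccontr)
        assume "\<not> ?thesis"
        then have n: "\<And>j. j \<in> {1..l} \<Longrightarrow> D d j \<le> 0" by force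
        have "d (\<sigma> j) \<le> 0" if "j \<in> {1..l}" for j
          using that
        proof (induction j)
          case (Suc j)
          show ?case
          proof (cases "j = 0")
            case True
            then show ?thesis using n[of 1] D1[of 1 d] Suc.prems by simp
          next
            case False
            then show ?thesis using n[of "Suc j"] D1[of "Suc j" d] Suc by simp
          qed
        qed simp
        then have "d i \<le> 0" for i using idx(1,2)[of i] by metis
        then have "d i = 0" for i using cone True by (simp add: cone_def) (metis order_antisym)
        then show False using cone by (simp add: cone_def)
      qed
      then obtain j where j: "j \<in> {1..l}" "D d j > 0" by blast
      show ?thesis
      proof (rule kill_line[OF w, where g = "\<lambda>z. z" and j = j and k = j and e = 1 and ?z0.0 = 0 and d = d])
        show "w c * M j (translate d c) = M j c * w (move (\<sigma> j) 1 c)" for c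
          using comm[of c "\<sigma> j"] True j by (simp add: Pt_def ev_Mt idx)
        show "0 - of_nat n * (1 * of_int (\<mu> j j)) - of_int (D d j) \<noteq> (0 :: complex)" for n
        proof -
          have "- int n - D d j \<noteq> 0" using j(2) by linarith
          then have "of_int (- int n - D d j) \<noteq> (0 :: complex)" by (simp only: of_int_eq_0_iff) simp
          then show ?thesis by (simp add: \<mu>_def)
        qed
      qed (use j in \<open>auto simp: \<mu>_def\<close>)
    next
      case False
      \<comment> \<open>The mirror image: the coordinates are compared from the last one downwards,
        with 0 beyond the end.\<close>
      have "\<exists>j\<in>{1..l}. D d (Suc j) > 0"
      proof (rule ccontr)
        assume "\<not> ?thesis"
        then have n: "\<And>j. j \<in> {1..l} \<Longrightarrow> D d (Suc j) \<le> 0" by force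
        have "d (\<sigma> j) \<ge> 0" if "1 \<le> j" "j \<le> l" for j
          using that(2,1)
        proof (induction j rule: inc_induct)
          case base
          then show ?case using n[of l] D1[of "Suc l" d] by simp
        next
          case (step j)
          then show ?case using n[of j] D1[of "Suc j" d] by simp
        qed
        then have "d i \<ge> 0" for i using idx(1,2)[of i] by (metis atLeastAtMost_iff)
        then have "d i = 0" for i using cone False by (simp add: cone_def) (metis order_antisym)
        then show False using cone by (simp add: cone_def)
      qed
      then obtain j where j: "j \<in> {1..l}" "D d (Suc j) > 0" by blast
      show ?thesis
      proof (rule kill_line[OF w, where g = "\<lambda>z. z" and j = j and k = "Suc j" and e = "-1" and ?z0.0 = 0 and d = d])
        show "w c * M (Suc j) (translate d c) = M (Suc j) c * w (move (\<sigma> j) (-1) c)" for c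
          using comm[of c "\<sigma> j"] False j by (simp add: Pt_def ev_Mt idx)
        show "0 - of_nat n * (- 1 * of_int (\<mu> (Suc j) j)) - of_int (D d (Suc j)) \<noteq> (0 :: complex)" for n
        proof -
          have "- int n - D d (Suc j) \<noteq> 0" using j(2) by linarith
          then have "of_int (- int n - D d (Suc j)) \<noteq> (0 :: complex)" by (simp only: of_int_eq_0_iff) simp
          then show ?thesis by (simp add: \<mu>_def)
        qed
      qed (use j in \<open>auto simp: \<mu>_def\<close>)
    qed
  qed
  show ?thesis by (rule category_H_nonempty[OF assms(3)])
qed

theorem (in kac_moody) type_C_nonempty:
  assumes "type_C l A" "2 \<le> l" "\<exists>u :: complex \<Rightarrow> 'v. inj u"
  shows "(category_H \<gg> (cartan_subalgebra sc \<alpha> \<alpha>v) :: ((complex, 'v) module \<times> _) set) \<noteq> {}"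
proof -
  obtain \<sigma> where \<sigma>: "bij_betw \<sigma> {1..l} UNIV"
      "\<And>i j. i \<in> {1..l} \<Longrightarrow> j \<in> {1..l} \<Longrightarrow> A $ \<sigma> i $ \<sigma> j = cartan_C l i j"
    using assms(1) unfolding type_C_def matrix_of_type_def by blast
  define \<nu> where "\<nu> k = (\<Sum>i = k..l. \<alpha>v (\<sigma> i))" for k
  define \<mu> :: "nat \<Rightarrow> nat \<Rightarrow> int"
    where "\<mu> k j = (if j = k then if j = l then 2 else 1 else 0) - (if k = Suc j then 1 else 0)" for k j
  have \<alpha>\<nu>: "\<alpha> (\<sigma> j) (\<nu> k) = of_int (\<mu> k j)" if "k \<in> {1..l}" "j \<in> {1..l}" for k j
  proof -
    have "\<alpha> (\<sigma> j) (\<nu> k) = (\<Sum>i = k..l. of_int (cartan_C l i j))"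
      unfolding \<nu>_def \<alpha>_sum using that by (intro sum.cong) (auto simp: \<alpha>_\<alpha>v \<sigma>(2))
    also have "\<dots> = of_int (\<Sum>i = k..l. cartan_C l i j)" by simp
    also have "(\<Sum>i = k..l. cartan_C l i j) = \<mu> k j"
      unfolding \<mu>_def using that by (intro sum_cartan_C assms(2)) auto
    finally show ?thesis .
  qed
  \<comment> \<open>The shift 1/2 is the one forced at a double edge: there \<open>fac\<close> is
    the sum of both coroots plus 1/2, which is \<open>M\<close> at l - 1. The factor -1/4 below is
    likewise the quadratic coefficient from \<open>double_edge\<close>; with it the difference of M
    (M + 1) over a step of 2 gives the coroot M - 1/2.\<close>
  interpret coordinates A sc \<alpha> \<alpha>v l \<sigma> \<nu> "1 / 2" \<mu> "{1..l}"
    by unfold_locales (use \<sigma>(1) \<alpha>\<nu> in auto)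
  define Pt where "Pt e i =
    (if e then if idx i = l then Gen None else Mt (Suc (idx i))
     else if idx i = l then Scale (- 1 / 4) (Prod (Mt l) (Add (Mt l) (Gen None))) else Mt (idx i))" for e i
  have Pt_T: "ev (Pt True (\<sigma> j)) c = (if j = l then 1 else M (Suc j) c)"
    and Pt_F: "ev (Pt False (\<sigma> j)) c = (if j = l then - (1 / 4) * (M l c * (M l c + 1)) else M j c)"
    if "j \<in> {1..l}" for j c
    by (simp_all add: Pt_def idx(3)[OF that] ev_Mt)
  have coroot: "lam c (\<alpha>v (\<sigma> j)) = (if j = l then M l c - 1 / 2 else M j c - M (Suc j) c)" if "j \<in> {1..l}" for j c
  proof -
    have "\<nu> j = \<alpha>v (\<sigma> j) + \<nu> (Suc j)" using that by (simp add: \<nu>_def sum.atLeast_Suc_atMost)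
    moreover have "\<nu> l = \<alpha>v (\<sigma> l)" by (simp add: \<nu>_def)
    ultimately show ?thesis by (simp add: M_def lam_add)
  qed
  have D1: "D d k = (if k = l then 2 * d (\<sigma> k) else d (\<sigma> k)) - (if 2 \<le> k then d (\<sigma> (k - 1)) else 0)" if "k \<in> {1..l}" for d k
  proof -
    have "D d k = (\<Sum>j = 1..l. (if j = k then if k = l then 2 * d (\<sigma> j) else d (\<sigma> j) else 0)
        + (if j = k - 1 then if 2 \<le> k then - d (\<sigma> j) else 0 else 0))"
      unfolding D_def using that assms(2) by (intro sum.cong) (auto simp: \<mu>_def)
    then show ?thesis using that by (auto simp: sum.distrib sum.delta)
  qed
  interpret km_polynomial_rep A sc \<alpha> \<alpha>v Pt
  proof
    show "env_term (Pt e i)" for e i by (simp add: Pt_def env_term_Mt)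
    show "ev (Pt True i) c * ev (Pt False j) (move i (-1) c)
        = ev (Pt False j) c * ev (Pt True i) (move j 1 c) + (if i = j then lam c (\<alpha>v i) else 0)" for i j c
    proof -
      obtain a b where ab: "a \<in> {1..l}" "b \<in> {1..l}" "i = \<sigma> a" "j = \<sigma> b" using idx(1,2) by metis
      have "i = j \<longleftrightarrow> a = b" using idx(3) ab by metis
      then have 3: "(if i = j then lam c (\<alpha>v i) else 0) = (if a = b then if a = l then M l c - 1 / 2 else M a c - M (Suc a) c else 0)"
        using coroot[OF ab(1), of c] by (simp only: ab(3)[symmetric])
      have 1: "M b (move (\<sigma> a) (-1) c) = M b c - (if a = b then if a = l then 2 else 1 else 0) + (if b = Suc a then 1 else 0)"
        using M_move[OF ab(2) ab(1), of "-1" c] by (auto simp: \<mu>_def)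
      have 2: "M (Suc a) (move (\<sigma> b) 1 c) = M (Suc a) c + (if b = Suc a then if b = l then 2 else 1 else 0) - (if a = b then 1 else 0)" if "a \<noteq> l"
        using M_move[of "Suc a" b 1 c] ab(1,2) that by (auto simp: \<mu>_def)
      show ?thesis
      proof (cases "b = l")
        case bl: True
        have l: "M l (move (\<sigma> a) (-1) c) = M l c - (if a = l then 2 else 0) + (if l = Suc a then 1 else 0)"
          using 1 unfolding bl by simp
        show ?thesis
          using 2 ab(1) unfolding 3 unfolding ab(3,4) Pt_T[OF ab(1)] Pt_F[OF ab(2)] l unfolding bl
          by (auto simp: field_simps)
      next
        case False
        have 4: "(if a = l then 1 else M (Suc a) (move (\<sigma> b) 1 c))
            = (if a = l then 1 else M (Suc a) c + (if b = Suc a then if b = l then 2 else 1 else 0) - (if a = b then 1 else 0))"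
          by (cases "a = l") (simp, insert 2, simp)
        show ?thesis
          unfolding 3 unfolding ab(3,4) Pt_T[OF ab(1)] Pt_F[OF ab(2)] 1 4
          using False ab(1,2) by (auto simp: algebra_simps)
      qed
    qed
    fix e d w c
    assume cone: "cone e d" and w: "line_poly w"
      and comm: "\<And>i c. w c * ev (Pt (\<not> e) i) (translate d c) = ev (Pt (\<not> e) i) c * w (move i (of_int (sg e)) c)"
      and loc: "\<And>Z c. (\<And>e i c. c \<in> Z \<Longrightarrow> ev (Pt e i) c \<noteq> 0 \<Longrightarrow> move i (- of_int (sg e)) c \<in> Z) \<Longrightarrow>
            c \<in> Z \<Longrightarrow> translate d c \<notin> Z \<Longrightarrow> w c = 0"
    have nonzero: False if "\<And>j. j \<in> {1..l} \<Longrightarrow> d (\<sigma> j) = 0"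
    proof -
      have "d i = 0" for i using idx(1,2)[of i] that by metis
      then show False using cone by (simp add: cone_def)
    qed
    show "w c = 0"
    proof (cases e)
      case True
      have "\<exists>j\<in>{1..l}. D d j > 0"
      proof (rule ccontr)
        assume "\<not> ?thesis"
        then have n: "\<And>j. j \<in> {1..l} \<Longrightarrow> D d j \<le> 0" by force
        have "d (\<sigma> j) \<le> 0" if "j \<in> {1..l}" for j
          using that
        proof (induction j)
          case (Suc j)
          show ?case
          proof (cases "j = 0")
            case True
            then show ?thesis using n[of 1] D1[of 1 d] Suc.prems assms(2) by simp
          next
            case False
            then have "d (\<sigma> j) \<le> 0" using Suc by simp
            then show ?thesis using n[OF Suc.prems] D1[OF Suc.prems, of d] False by (simp split: if_splits)
          qed
        qed simp
        moreover have "d (\<sigma> j) \<ge> 0" for j using cone True by (simp add: cone_def)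
        ultimately show False using nonzero by (metis order_antisym)
      qed
      then obtain j where j: "j \<in> {1..l}" "D d j > 0" by blast
      show ?thesis
      proof (cases "j = l")
        case True
        show ?thesis
        \<comment> \<open>Of the two zeros 0 and -1 only -1 serves as start: steps have length 2,
          and from 0 the factor z + 1 would vanish at once if \<open>D d l = 1\<close>.\<close>
        proof (rule kill_line[OF w, where g = "\<lambda>z. - (1 / 4) * (z * (z + 1))" and j = l and k = l and e = 1 and ?z0.0 = "-1" and d = d])
          show "w c * (- (1 / 4) * (M l (translate d c) * (M l (translate d c) + 1)))
              = - (1 / 4) * (M l c * (M l c + 1)) * w (move (\<sigma> l) 1 c)" for c
            using comm[of c "\<sigma> l"] \<open>e\<close> j True by (simp add: Pt_F)
          show "- (1 / 4) * ((- 1 - of_nat n * (1 * of_int (\<mu> l l)) - of_int (D d l)) *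
              (- 1 - of_nat n * (1 * of_int (\<mu> l l)) - of_int (D d l) + 1)) \<noteq> (0 :: complex)" for n
          proof -
            have "- 1 - 2 * int n - D d l \<noteq> 0" "- 2 * int n - D d l \<noteq> 0" using j(2) True by auto
            then have "of_int (- 1 - 2 * int n - D d l) \<noteq> (0 :: complex)" "of_int (- 2 * int n - D d l) \<noteq> (0 :: complex)"
              by (simp_all only: of_int_eq_0_iff) simp_all
            moreover have "- 1 - of_nat n * (1 * of_int (\<mu> l l)) - of_int (D d l) = (of_int (- 1 - 2 * int n - D d l) :: complex)"
              "of_int (- 1 - 2 * int n - D d l) + 1 = (of_int (- 2 * int n - D d l) :: complex)"
              by (simp_all add: \<mu>_def)
            ultimately show ?thesis by (simp only: mult_eq_0_iff) simp
          qed
        qed (use j True in \<open>auto simp: \<mu>_def\<close>)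
      next
        case False
        show ?thesis
        proof (rule kill_line[OF w, where g = "\<lambda>z. z" and j = j and k = j and e = 1 and ?z0.0 = 0 and d = d])
          show "w c * M j (translate d c) = M j c * w (move (\<sigma> j) 1 c)" for c
            using comm[of c "\<sigma> j"] \<open>e\<close> j False by (simp add: Pt_F)
          show "0 - of_nat n * (1 * of_int (\<mu> j j)) - of_int (D d j) \<noteq> (0 :: complex)" for n
          proof -
            have "- int n - D d j \<noteq> 0" using j(2) by linarith
            then have "of_int (- int n - D d j) \<noteq> (0 :: complex)" by (simp only: of_int_eq_0_iff) simp
            then show ?thesis using False by (simp add: \<mu>_def)
          qed
        qed (use j False in \<open>auto simp: \<mu>_def\<close>)
      qed
    next
      case False
      \<comment> \<open>The operator of the long simple root is a bare translation, so this equation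
        transports zeros of w but never creates one.\<close>
      have comm_l: "w c = w (move (\<sigma> l) (-1) c)" for c
        using comm[of c "\<sigma> l"] False assms(2) by (simp add: Pt_T)
      have comm_j: "w c * M (Suc j) (translate d c) = M (Suc j) c * w (move (\<sigma> j) (-1) c)" if "1 \<le> j" "j < l" for j c
        using comm[of c "\<sigma> j"] False that by (simp add: Pt_T)
      show ?thesis
      proof (cases "\<exists>j. 1 \<le> j \<and> j < l \<and> D d (Suc j) > 0")
        case True
        then obtain j where j: "1 \<le> j" "j < l" "D d (Suc j) > 0" by blast
        show ?thesis
        proof (rule kill_line[OF w, where g = "\<lambda>z. z" and j = j and k = "Suc j" and e = "-1" and ?z0.0 = 0 and d = d])
          show "w c * M (Suc j) (translate d c) = M (Suc j) c * w (move (\<sigma> j) (-1) c)" for c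
            by (rule comm_j[OF j(1,2)])
          show "0 - of_nat n * (- 1 * of_int (\<mu> (Suc j) j)) - of_int (D d (Suc j)) \<noteq> (0 :: complex)" for n
          proof -
            have "- int n - D d (Suc j) \<noteq> 0" using j(3) by linarith
            then have "of_int (- int n - D d (Suc j)) \<noteq> (0 :: complex)" by (simp only: of_int_eq_0_iff) simp
            then show ?thesis by (simp add: \<mu>_def)
          qed
        qed (use j in \<open>auto simp: \<mu>_def\<close>)
      next
        case n: False
        have "D d j \<le> 0" if j: "j \<in> {1..l}" for j
        proof (cases "j = 1")
          case True
          then show ?thesis using D1[OF j, of d] cone \<open>\<not> e\<close> assms(2) by (simp add: cone_def)
        next
          case False
          then have "1 \<le> j - 1" "j - 1 < l" "Suc (j - 1) = j" using j by auto
          then show ?thesis using n by (metis not_le)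
        qed
        moreover have "\<exists>k\<in>{1..l}. D d k \<noteq> 0"
        proof (rule ccontr)
          assume "\<not> ?thesis"
          then have n: "\<And>j. j \<in> {1..l} \<Longrightarrow> D d j = 0" by blast
          have "d (\<sigma> j) = 0" if "j \<in> {1..l}" for j
            using that
          proof (induction j)
            case (Suc j)
            show ?case
            proof (cases "j = 0")
              case True
              then show ?thesis using n[of 1] D1[of 1 d] Suc.prems assms(2) by simp
            next
              case False
              then have "d (\<sigma> j) = 0" using Suc by simp
              then show ?thesis using n[OF Suc.prems] D1[OF Suc.prems, of d] False by (simp split: if_splits)
            qed
          qed simp
          then show False by (rule nonzero)
        qed
        ultimately obtain k where k: "k \<in> {1..l}" "D d k < 0" by (metis order_less_le)
        \<comment> \<open>No generator leads out of this set: its polynomial vanishes where the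
          translation would make \<open>M k\<close> positive. For the long root, whose step is 2,
          this takes both zeros 0 and -1 of the quadratic. The translation by d, in contrast, leads
          from \<open>M k = 0\<close> to a positive value, so w vanishes on that hyperplane.\<close>
        let ?Z = "{c. \<exists>m::nat. M k c = - of_nat m}"
        have zero: "w c = 0" if M0: "M k c = 0" for c
        proof (rule loc[of ?Z])
          show "c \<in> ?Z" using M0 by (auto intro: exI[of _ 0])
          show "translate d c \<notin> ?Z"
          proof
            assume "translate d c \<in> ?Z"
            then obtain m :: nat where "- of_int (D d k) = - (of_nat m :: complex)" using M_translate[OF k(1), of d c] M0 by auto
            then have "of_int (D d k - int m) = (0 :: complex)" by simp
            then have "D d k - int m = 0" by (simp only: of_int_eq_0_iff)
            then show False using k(2) by simp
          qed
          fix e i c assume c: "c \<in> ?Z" and nz: "ev (Pt e i) c \<noteq> 0"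
          obtain a where a: "a \<in> {1..l}" "i = \<sigma> a" using idx(1,2) by metis
          obtain m :: nat where m: "M k c = - of_nat m" using c by blast
          have mv: "M k (move i (- of_int (sg e)) c) = - of_int (int m + sg e * \<mu> k a)"
            using M_move[OF k(1) a(1), of "- of_int (sg e)" c] a(2) m by simp
          have "int m + sg e * \<mu> k a \<ge> 0"
          proof (cases e)
            case True
            have "m \<noteq> 0" if "k = Suc a"
              using nz m True that k(1) a by (auto simp: Pt_T)
            then show ?thesis using True by (auto simp: \<mu>_def)
          next
            case False
            have "m \<noteq> 0" if "k = a" using nz m False that a by (auto simp: Pt_F split: if_splits)
            moreover have "m \<noteq> 1" if "k = a" "a = l" using nz m False that a by (auto simp: Pt_F)
            ultimately show ?thesis using False by (auto simp: \<mu>_def)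
          qed
          then have "M k (move i (- of_int (sg e)) c) = - of_nat (nat (int m + sg e * \<mu> k a))" using mv by simp
          then show "move i (- of_int (sg e)) c \<in> ?Z" by blast
        qed
        show ?thesis
        proof (cases "k = l")
          case True
          define c0 where "c0 = move (\<sigma> l) (- M l c / 2) c"
          have "M l c0 = 0" using M_move[of l l "- M l c / 2" c] assms(2) by (simp add: c0_def \<mu>_def)
          then have c0: "w c0 = 0" using zero True by simp
          have "w (move (\<sigma> l) (- 1 * of_nat n) c0) = 0" for n
          proof (induction n)
            case (Suc n)
            have "move (\<sigma> l) (-1) (move (\<sigma> l) (- 1 * of_nat n) c0) = move (\<sigma> l) (- 1 * of_nat (Suc n)) c0"
              by (simp add: move_move)
            then show ?case using comm_l[of "move (\<sigma> l) (- 1 * of_nat n) c0"] Suc by (simp only:)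
          qed (simp add: move_0 c0)
          then have "w (move (\<sigma> l) (M l c / 2) c0) = 0" by (rule line_poly_line[OF w, rotated]) simp
          then show ?thesis by (simp add: c0_def move_move move_0)
        next
          case False
          then have kl: "1 \<le> k" "k < l" using k(1) by auto
          have \<mu>k: "\<mu> k k = 1" "\<mu> (Suc k) k = -1" "\<mu> k (Suc k) = 0" "\<mu> (Suc k) (Suc k) \<ge> 1"
            using kl by (auto simp: \<mu>_def)
          \<comment> \<open>From the hyperplane the zeros spread along the k-th root as long as the
            factor \<open>M (Suc k)\<close>, which grows by 1 per step, does not vanish.\<close>
          have string: "w (move (\<sigma> k) s c0) = 0"
            if c0: "M k c0 = 0" and nz: "\<And>n::nat. M (Suc k) c0 + of_nat n \<noteq> 0" for c0 s
          proof (rule line_poly_line[OF w, where e = "-1"])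
            show "w (move (\<sigma> k) (- 1 * of_nat n) c0) = 0" for n
            proof (induction n)
              case 0
              show ?case using zero[OF c0] by (simp add: move_0)
            next
              case (Suc n)
              let ?c = "move (\<sigma> k) (- 1 * of_nat n) c0"
              have "move (\<sigma> k) (-1) ?c = move (\<sigma> k) (- 1 * of_nat (Suc n)) c0"
                by (simp add: move_move)
              moreover have "M (Suc k) ?c = M (Suc k) c0 + of_nat n"
                using M_move[of "Suc k" k "- 1 * of_nat n" c0] kl by (simp add: \<mu>k)
              ultimately show ?case using comm_j[OF kl, of ?c] Suc nz[of n] by simp
            qed
          qed simp
          \<comment> \<open>This is the value of \<open>M (Suc k)\<close> after c is moved along the
            k-th root into the hyperplane \<open>M k = 0\<close>. It may be a nonpositive integer,
            which would stop the string. So c is first moved far along the next root, where the real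
            part is positive, and polynomiality carries the zeros back to c.\<close>
          define x where "x = M (Suc k) c + M k c"
          obtain N :: nat where N: "of_nat N > - Re x" using reals_Archimedean2 by blast
          have far: "w (move (\<sigma> (Suc k)) (of_nat n) c) = 0" if n: "n \<ge> N" for n
          proof -
            let ?c = "move (\<sigma> (Suc k)) (of_nat n) c"
            define c0 where "c0 = move (\<sigma> k) (- M k c) ?c"
            have "M k ?c = M k c" using M_move[of k "Suc k" "of_nat n" c] kl by (simp add: \<mu>k)
            then have c0: "M k c0 = 0" using M_move[of k k "- M k c" ?c] kl by (simp add: c0_def \<mu>k)
            have M1: "M (Suc k) c0 = x + of_nat n * of_int (\<mu> (Suc k) (Suc k))"
              using M_move[of "Suc k" k "- M k c" ?c] M_move[of "Suc k" "Suc k" "of_nat n" c] kl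
              by (simp add: c0_def \<mu>k x_def)
            have "M (Suc k) c0 + of_nat m \<noteq> 0" for m
            proof
              assume "M (Suc k) c0 + of_nat m = 0"
              then have "Re x + of_nat n * of_int (\<mu> (Suc k) (Suc k)) + of_nat m = 0"
                unfolding M1 complex_eq_iff by simp
              moreover have "real n * of_int (\<mu> (Suc k) (Suc k)) \<ge> real n * 1"
                using \<mu>k(4) by (intro mult_left_mono) auto
              moreover have "real n \<ge> real N" "real m \<ge> 0" using n by simp_all
              ultimately show False using N by linarith
            qed
            from string[OF c0 this, of "M k c"] show ?thesis by (simp add: c0_def move_move move_0)
          qed
          have "w (move (\<sigma> (Suc k)) (- of_nat N) (move (\<sigma> (Suc k)) (of_nat N) c)) = 0"
          proof (rule line_poly_line[OF w, where e = 1])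
            show "w (move (\<sigma> (Suc k)) (1 * of_nat n) (move (\<sigma> (Suc k)) (of_nat N) c)) = 0" for n
              using far[of "n + N"] by (simp add: move_move)
          qed simp
          then show ?thesis by (simp add: move_move move_0)
        qed
      qed
    qed
  qed
  show ?thesis by (rule category_H_nonempty[OF assms(3)])
qed

theorem theorem20:
  fixes A :: "int ^ 'n ^ 'n"
    and sc :: "complex \<Rightarrow> 'h::ab_group_add \<Rightarrow> 'h"
    and \<alpha> :: "'n \<Rightarrow> 'h \<Rightarrow> complex"
    and \<alpha>v :: "'n \<Rightarrow> 'h"
  assumes "generalized_cartan_matrix A"
    and "indecomposable A"
    and "realization A sc \<alpha> \<alpha>v"
    and universe: "\<exists>u :: complex \<Rightarrow> 'v. inj u"
  shows "(category_H (kac_moody_algebra sc \<alpha> \<alpha>v) (cartan_subalgebra sc \<alpha> \<alpha>v)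
            :: ((complex, 'v) module \<times> _) set) \<noteq> {} \<longleftrightarrow>
         (\<exists>l\<ge>1. type_A l A) \<or> (\<exists>l\<ge>2. type_C l A)"
proof -
  interpret kac_moody A sc \<alpha> \<alpha>v by (rule kac_moody.intro) (rule assms(3))
  show ?thesis
  proof
    assume "(category_H \<gg> (cartan_subalgebra sc \<alpha> \<alpha>v) :: ((complex, 'v) module \<times> _) set) \<noteq> {}"
    then obtain V :: "(complex, 'v) module" and \<rho>
      where V: "(V, \<rho>) \<in> category_H \<gg> (cartan_subalgebra sc \<alpha> \<alpha>v)" by auto
    interpret km_module A sc \<alpha> \<alpha>v V \<rho>
      using V by (intro km_module.intro kac_moody_axioms) (simp add: category_H_def)
    have "free_of_rank_one (enveloping_algebra \<hh>) (env_module V \<rho>)"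
      using V by (simp add: category_H_def cartan_subalgebra_eq)
    then show "(\<exists>l\<ge>1. type_A l A) \<or> (\<exists>l\<ge>2. type_C l A)"
      by (rule free_imp_type_A_or_C[OF assms(1,2)])
  next
    assume "(\<exists>l\<ge>1. type_A l A) \<or> (\<exists>l\<ge>2. type_C l A)"
    then show "(category_H \<gg> (cartan_subalgebra sc \<alpha> \<alpha>v) :: ((complex, 'v) module \<times> _) set) \<noteq> {}"
      using type_A_nonempty[OF _ _ universe] type_C_nonempty[OF _ _ universe] by blast
  qed
qed

end
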